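(* For every $\delta\in(0,1]$ there exist $C(\delta)$ and $c(\delta)>0$ such that the following holds. If $f:[N]\to\mathbb{C}$ satisfies $|f|\le1$ and $\Vert f\Vert_{U^3[N]}\ge\delta$, then $|\mathbb{E}_{n\in[N]}f(n)\overline{\chi(n)}|\ge c(\delta)$, where \[\chi(n)=e(\alpha n^2+\beta n)\prod_{1\le i<i'\le k}F_{[i',i]}^{m_{[i',i]}}(g(n)\Gamma)\] for some $\alpha,\beta\in\mathbb{R}$, some $k\le C(\delta)$, integers $|m_{[i',i]}|\le C(\delta)$, and a polynomial sequence $g:\mathbb{Z}\to G$ into the free $2$-step nilpotent Lie group $G$ on $k$ generators whose Mal'cev coordinates are $t_i=\xi_in$ ($1\le i\le k$) and $t_{[i',i]}=q_{[i',i]}(n)$ for some reals $\xi_i$ and quadratic polynomials $q_{[i',i]}$.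
   Context: $e(x)=e^{2\pi ix}$. $\Vert\cdot\Vert_{U^3[N]}$: for $f:[N]\to\mathbb{C}$, $\Vert f\Vert_{U^3[N]}=\Vert\tilde f\Vert_{U^3(\mathbb{Z}/\tilde N\mathbb{Z})}/\Vert1_{[N]}\Vert_{U^3(\mathbb{Z}/\tilde N\mathbb{Z})}$ with $\tilde N\ge8N$, $\tilde f$ the zero extension, and $\Vert f\Vert_{U^3(G)}^8=\mathbb{E}_{x,h_1,h_2,h_3}\Delta_{h_1}\Delta_{h_2}\Delta_{h_3}f(x)$, $\Delta_hf(x)=f(x+h)\overline{f(x)}$. Free $2$-step nilpotent Lie group on $e_1,\dots,e_k$: elements $e_1^{t_1}\cdots e_k^{t_k}\prod_{1\le i<i'\le k}e_{[i',i]}^{t_{[i',i]}}$ ($t$'s real) with $e_{[i',i]}=[e_{i'},e_i]=e_{i'}^{-1}e_i^{-1}e_{i'}e_i$ central; in these coordinates $(t_i,t_{[i',i]})*(u_i,u_{[i',i]})=(t_i+u_i,\,t_{[i',i]}+u_{[i',i]}+t_{i'}u_i)$. $\Gamma$ is the lattice of elements with all coordinates integers. For $g$ with coordinates $(t_i,t_{[i',i]})$, the coset $g\Gamma$ has coordinates $(\{t_i\},\{t_{[i',i]}-t_{i'}\lfloor t_i\rfloor\})$ in $[0,1)$, and $F_{[i',i]}:G/\Gamma\to\mathbb{C}$ is $F_{[i',i]}(g\Gamma)=e(t_{[i',i]}-t_{i'}\lfloor t_i\rfloor)$. *)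

theory Defs
  imports Complex_Main
begin

definition e :: "real \<Rightarrow> complex" where
  "e x = cis (2 * pi * x)"

text \<open>Zero extension of f : [N] \<rightarrow> C (with [N] = {1..N}) to Z/MZ, realised as an
  M-periodic function on the integers.\<close>
definition zext :: "nat \<Rightarrow> nat \<Rightarrow> (int \<Rightarrow> complex) \<Rightarrow> int \<Rightarrow> complex" where
  "zext M N f x = (let y = x mod int M in if 1 \<le> y \<and> y \<le> int N then f y else 0)"

definition Delta :: "int \<Rightarrow> (int \<Rightarrow> complex) \<Rightarrow> int \<Rightarrow> complex" where
  "Delta h F = (\<lambda>x. F (x + h) * cnj (F x))"

definition U3_cyc_pow8 :: "nat \<Rightarrow> (int \<Rightarrow> complex) \<Rightarrow> complex" where
  "U3_cyc_pow8 M F =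
     (\<Sum>x\<in>{0..<int M}. \<Sum>h1\<in>{0..<int M}. \<Sum>h2\<in>{0..<int M}. \<Sum>h3\<in>{0..<int M}.
        Delta h1 (Delta h2 (Delta h3 F)) x) / (of_nat M ^ 4)"

definition U3_cyc :: "nat \<Rightarrow> (int \<Rightarrow> complex) \<Rightarrow> real" where
  "U3_cyc M F = (Re (U3_cyc_pow8 M F)) powr (1/8)"

text \<open>||f||_{U^3[N]}, computed with the choice Ntilde = 8N.\<close>
definition U3_interval :: "nat \<Rightarrow> (int \<Rightarrow> complex) \<Rightarrow> real" where
  "U3_interval N f = U3_cyc (8 * N) (zext (8 * N) N f) / U3_cyc (8 * N) (zext (8 * N) N (\<lambda>_. 1))"

text \<open>Mal'cev coordinates of an element of the free 2-step nilpotent Lie group: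
  (t_i)_i and (t_{[i',i]})_{i'>i}, the latter indexed as t2 i' i.\<close>
type_synonym nil2 = "(nat \<Rightarrow> real) \<times> (nat \<Rightarrow> nat \<Rightarrow> real)"

definition F_comm :: "nat \<Rightarrow> nat \<Rightarrow> nil2 \<Rightarrow> complex" where
  "F_comm i' i g = e (snd g i' i - fst g i' * of_int \<lfloor>fst g i\<rfloor>)"

definition poly_seq :: "(nat \<Rightarrow> real) \<Rightarrow> (nat \<Rightarrow> nat \<Rightarrow> real) \<Rightarrow> (nat \<Rightarrow> nat \<Rightarrow> real)
    \<Rightarrow> (nat \<Rightarrow> nat \<Rightarrow> real) \<Rightarrow> int \<Rightarrow> nil2" where
  "poly_seq \<xi> qa qb qc n =
     ((\<lambda>i. \<xi> i * of_int n), (\<lambda>i' i. qa i' i + qb i' i * of_int n + qc i' i * (of_int n)^2))"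

definition pairs :: "nat \<Rightarrow> (nat \<times> nat) set" where
  "pairs k = {(i, i'). 1 \<le> i \<and> i < i' \<and> i' \<le> k}"

definition chi :: "real \<Rightarrow> real \<Rightarrow> nat \<Rightarrow> (nat \<Rightarrow> nat \<Rightarrow> int) \<Rightarrow> (int \<Rightarrow> nil2) \<Rightarrow> int \<Rightarrow> complex" where
  "chi \<alpha> \<beta> k m g n =
     e (\<alpha> * (of_int n)^2 + \<beta> * of_int n) *
     (\<Prod>(i, i')\<in>pairs k. (F_comm i' i (g n)) powi (m i' i))"

end

(*
  If f has large U^3 norm, many derivatives Delta_h f correlate with characters n -> e(xi_h n / M), and
  two applications of Cauchy-Schwarz show that the graph of h -> xi_h has large additive energy. By
  Balog-Szemeredi-Gowers, and by passing to the popular differences (whose iterated sumsets stay small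
  for elementary reasons, so that no Pluennecke inequality is needed), a dense part of the graph has
  bounded fibres in its iterated sumsets; a further restriction makes xi a Freiman homomorphism. By
  Bogolyubov it extends to a locally additive function Phi on a Bohr set. Such a Phi is linear in n and
  the integers round(theta n): take spanning points n_i of the Bohr set with bounded coefficients c_i, so that
  t n - sum_i floor(t c_i) n_i stays in the Bohr set for all t, evaluate Phi and divide by t.

  Thus the derivative of f correlates with e(phi(h) n), phi bracket linear. The bilinear form
  psi(a, b) = phi(a) b - phi(b) a is biased, hence almost trivial on a smaller Bohr set, so that there
  phi(h) n is the derivative of a bracket quadratic (restricting to even steps avoids dividing by 2),
  and f correlates with that bracket quadratic by the U^2 inverse theorem. The Bohr cutoff is an
  autocorrelation, hence an average of characters, and can be dropped.
*)
theory Submission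
  imports Defs "HOL-Analysis.Convex" "HOL-Library.Product_Plus"
begin

section \<open>Characters and Fourier analysis on finite cyclic groups\<close>

text \<open>Two defects of Bohr sets shape the argument. Their size may jump with the radius, so no
  sharp cutoff is used where a shift has to be cheap: there the Lipschitz weight \<open>tent\<close>
  takes its place, and the cutoff that must disappear at the end is chosen positive definite. And in
  a cyclic group sums wrap around, so the graph of frequencies is lifted to the integers at the cost
  of a factor 9; from then on Bohr sets are sets of integers with real frequencies.

  Symmetry is available only modulo 1, for \<psi> and not for half of it. Writing n = x + 2y and k =
  k1 + 2z puts a factor 4 in front of \<phi>(z) y, and Q(y) = \<phi>(y) (x + 2y) satisfies 4
  \<phi>(z) y = Q(y+z) - Q(y) - Q(z) + 2 \<psi>(z, y) exactly.

  The witness takes every polynomial q to be 0. Then \<open>F_comm\<close> is e(- \<xi>' n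
  floor(\<xi> n)), and products of these with exponents of size at most 2 produce every bracket
  quadratic that arises, provided that its brackets are floors of multiples of n. This is why
  roundings and shifts inside brackets are eliminated at the end.\<close>

lemma e_0 [simp]: "e 0 = 1" by (simp add: e_def)
lemma e_add: "e (x + y) = e x * e y" by (simp add: e_def cis_mult algebra_simps)
lemma norm_e [simp]: "norm (e x) = 1" by (simp add: e_def)
lemma cnj_e: "cnj (e x) = e (- x)" by (simp add: e_def cis_cnj)
lemma e_diff: "e (x - y) = e x * cnj (e y)"
  using e_add[of x "- y"] by (simp add: cnj_e)
lemma e_of_int [simp]: "e (of_int n) = 1"
  unfolding e_def by (metis cis_multiple_2pi Ints_of_int mult.commute)
lemma e_add_int [simp]: "e (x + of_int n) = e x" by (simp add: e_add)
lemma e_mult_cnj [simp]: "e x * cnj (e x) = 1" by (simp flip: e_diff)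
lemma e_power: "e x ^ n = e (of_nat n * x)"
  by (induction n) (auto simp: e_add distrib_right)

lemma e_eq_1_iff: "e x = 1 \<longleftrightarrow> x \<in> \<int>"
proof
  assume "e x = 1"
  then have "cos (2 * pi * x) = 1" by (simp add: e_def complex_eq_iff)
  then obtain n :: int where "2 * pi * x = of_int n * 2 * pi"
    using cos_one_2pi_int by blast
  then show "x \<in> \<int>" by (auto simp: field_simps)
qed (auto elim: Ints_cases)

definition chr :: "int \<Rightarrow> int \<Rightarrow> int \<Rightarrow> complex" where
  "chr P k x = e (of_int (k * x) / of_int P)"

lemma norm_chr [simp]: "norm (chr P k x) = 1" by (simp add: chr_def)
lemma chr_0 [simp]: "chr P k 0 = 1" "chr P 0 x = 1" by (auto simp: chr_def)
lemma chr_add: "chr P k (x + y) = chr P k x * chr P k y"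
  by (simp add: chr_def e_add[symmetric] add_divide_distrib algebra_simps)
lemma chr_add_left: "chr P (k + l) x = chr P k x * chr P l x"
  by (simp add: chr_def e_add[symmetric] add_divide_distrib algebra_simps)
lemma chr_minus: "chr P k (- x) = cnj (chr P k x)"
  by (simp add: chr_def cnj_e)
lemma chr_minus_left: "chr P (- k) x = cnj (chr P k x)"
  by (simp add: chr_def cnj_e)
lemma chr_diff: "chr P k (x - y) = chr P k x * cnj (chr P k y)"
  using chr_add[of P k x "- y"] by (simp add: chr_minus)
lemma chr_diff_left: "chr P (k - l) x = chr P k x * cnj (chr P l x)"
  using chr_add_left[of P k "- l" x] by (simp add: chr_minus_left)
lemma chr_commute: "chr P k x = chr P x k" by (simp add: chr_def mult.commute)

lemma chr_mult_P: assumes "P > 0" shows "chr P k (P * m) = 1"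
proof -
  have "real_of_int (k * (P * m)) / real_of_int P = real_of_int (k * m)" using assms by simp
  then show ?thesis unfolding chr_def by (metis e_of_int)
qed

lemma chr_mod: assumes "P > 0" shows "chr P k (x mod P) = chr P k x"
proof -
  have "chr P k (P * (x div P) + x mod P) = chr P k (x mod P)"
    by (simp only: chr_add chr_mult_P[OF assms] mult_1)
  then show ?thesis by (simp only: mult_div_mod_eq)
qed

lemma sum_chr:
  assumes P: "P > 0"
  shows "(\<Sum>k\<in>{0..<P}. chr P k n) = (if P dvd n then of_int P else 0)"
proof (cases "P dvd n")
  case True
  then obtain m where "n = P * m" by blast
  then show ?thesis using P by (simp add: chr_mult_P)
next
  case False
  have ne: "chr P 1 n \<noteq> 1"
  proof
    assume "chr P 1 n = 1"
    then have "real_of_int n / real_of_int P \<in> \<int>" by (simp add: chr_def e_eq_1_iff)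
    then obtain m where "real_of_int n / real_of_int P = of_int m" by (auto elim: Ints_cases)
    then have "real_of_int n = of_int (m * P)" using P by (simp add: field_simps)
    then have "n = m * P" by linarith
    with False show False by simp
  qed
  have "(\<Sum>k\<in>{0..<P}. chr P k n) = (\<Sum>k<nat P. chr P (int k) n)"
    by (rule sum.reindex_bij_witness[of _ int nat]) auto
  also have "\<dots> = (\<Sum>k<nat P. chr P 1 n ^ k)"
    by (intro sum.cong refl) (simp add: chr_def e_power)
  also have "\<dots> = (chr P 1 n ^ nat P - 1) / (chr P 1 n - 1)" by (rule geometric_sum[OF ne])
  also have "chr P 1 n ^ nat P = 1"
  proof -
    have "chr P 1 n ^ nat P = e (of_int n)" using P by (simp add: chr_def e_power)
    then show ?thesis by simp
  qed
  finally show ?thesis using False by simp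
qed

lemma dvd_diff_iff_mod: "(P::int) dvd x - y \<longleftrightarrow> x mod P = y mod P"
  by (simp add: mod_eq_dvd_iff)

lemma cmod_sum_sq:
  "complex_of_real ((cmod (\<Sum>x\<in>X. a x))\<^sup>2) = (\<Sum>x\<in>X. \<Sum>y\<in>X. a x * cnj (a y))"
  by (simp only: complex_norm_square cnj_sum sum_product)

text \<open>Orthogonality only sees residues, so any finite set of integers that is injective mod
  \<open>P\<close> will do. In this form it applies directly to dilates of an interval and to Bohr
  sets, without reducing them.\<close>

lemma parseval:
  assumes P: "P > 0" and X: "finite X" "inj_on (\<lambda>x. x mod P) X"
  shows "(\<Sum>k\<in>{0..<P}. (cmod (\<Sum>x\<in>X. a x * chr P k x))\<^sup>2) = of_int P * (\<Sum>x\<in>X. (cmod (a x))\<^sup>2)"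
proof -
  have "complex_of_real (\<Sum>k\<in>{0..<P}. (cmod (\<Sum>x\<in>X. a x * chr P k x))\<^sup>2)
    = (\<Sum>k\<in>{0..<P}. \<Sum>x\<in>X. \<Sum>y\<in>X. a x * cnj (a y) * chr P k (x - y))"
    by (simp only: of_real_sum cmod_sum_sq) (simp add: chr_diff mult_ac)
  also have "\<dots> = (\<Sum>x\<in>X. \<Sum>k\<in>{0..<P}. \<Sum>y\<in>X. a x * cnj (a y) * chr P k (x - y))"
    by (rule sum.swap)
  also have "\<dots> = (\<Sum>x\<in>X. \<Sum>y\<in>X. \<Sum>k\<in>{0..<P}. a x * cnj (a y) * chr P k (x - y))"
    by (intro sum.cong refl sum.swap)
  also have "\<dots> = (\<Sum>x\<in>X. \<Sum>y\<in>X. if y = x then of_int P * (a x * cnj (a y)) else 0)"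
    using X(2) by (intro sum.cong refl)
      (auto simp: sum_distrib_left[symmetric] sum_chr[OF P] dvd_diff_iff_mod inj_on_def)
  also have "\<dots> = (\<Sum>x\<in>X. of_int P * (a x * cnj (a x)))" using X by simp
  also have "\<dots> = complex_of_real (of_int P * (\<Sum>x\<in>X. (cmod (a x))\<^sup>2))"
    by (simp add: sum_distrib_left complex_norm_square del: of_real_power)
  finally show ?thesis by (simp only: of_real_eq_iff)
qed

lemma inj_on_mod_interval: "inj_on (\<lambda>x. x mod P) {0..<P::int}"
  by (auto simp: inj_on_def)

lemma cauchy_schwarz_sum:
  fixes f g :: "'a \<Rightarrow> real"
  shows "(\<Sum>i\<in>I. f i * g i) \<le> sqrt (\<Sum>i\<in>I. (f i)\<^sup>2) * sqrt (\<Sum>i\<in>I. (g i)\<^sup>2)"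
proof -
  have "(\<Sum>i\<in>I. f i * g i)\<^sup>2 \<le> (\<Sum>i\<in>I. (f i)\<^sup>2) * (\<Sum>i\<in>I. (g i)\<^sup>2)"
    by (rule Cauchy_Schwarz_ineq_sum)
  then have "\<bar>\<Sum>i\<in>I. f i * g i\<bar> \<le> sqrt ((\<Sum>i\<in>I. (f i)\<^sup>2) * (\<Sum>i\<in>I. (g i)\<^sup>2))"
    using real_le_rsqrt by (metis real_sqrt_abs real_sqrt_le_iff)
  then show ?thesis by (simp add: real_sqrt_mult)
qed

definition periodic :: "int \<Rightarrow> (int \<Rightarrow> 'a) \<Rightarrow> bool" where
  "periodic P g \<longleftrightarrow> (\<forall>m. g (m mod P) = g m)"

lemma periodicD: "periodic P g \<Longrightarrow> g (m mod P) = g m"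
  by (simp add: periodic_def)

lemma fourier_inversion:
  assumes P: "P > 0" and per: "periodic P a"
  shows "a m = (\<Sum>k\<in>{0..<P}. (\<Sum>u\<in>{0..<P}. a u * cnj (chr P k u)) * chr P k m) / of_int P"
proof -
  have "(\<Sum>k\<in>{0..<P}. (\<Sum>u\<in>{0..<P}. a u * cnj (chr P k u)) * chr P k m)
     = (\<Sum>k\<in>{0..<P}. \<Sum>u\<in>{0..<P}. a u * chr P k (m - u))"
    by (simp only: sum_distrib_left sum_distrib_right chr_diff mult_ac)
  also have "\<dots> = (\<Sum>u\<in>{0..<P}. a u * (\<Sum>k\<in>{0..<P}. chr P k (m - u)))"
    by (subst sum.swap) (simp add: sum_distrib_left)
  also have "\<dots> = (\<Sum>u\<in>{0..<P}. if u = m mod P then a u * of_int P else 0)"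
    using P by (intro sum.cong refl) (auto simp: sum_chr dvd_diff_iff_mod)
  also have "\<dots> = a m * of_int P" using P periodicD[OF per] by (simp add: sum.delta)
  finally show ?thesis using P by simp
qed

text \<open>Expanding \<open>a\<close> into characters factors the sum into three Fourier
  coefficients for each \<open>k\<close>. That of \<open>b\<close> is taken out in sup norm, the
  other two are paired by Cauchy-Schwarz and Parseval; hence a large form forces a large Fourier
  coefficient of \<open>b\<close>. This one fact supplies the U^2 inverse theorem, the bound on the
  derivative phases and the last step of the integration.\<close>

lemma trilinear_bound:
  assumes P: "P > 0" and per: "periodic P a"
    and Y: "finite Y" and Z: "finite Z" "inj_on (\<lambda>x. x mod P) Z"
    and B: "\<And>k. k \<in> {0..<P} \<Longrightarrow> cmod (\<Sum>y\<in>Y. b y * chr P k y) \<le> B" "B \<ge> 0"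
  shows "cmod (\<Sum>y\<in>Y. \<Sum>z\<in>Z. a (y + z) * b y * c z)
     \<le> B * sqrt (\<Sum>z\<in>Z. (cmod (c z))\<^sup>2) * sqrt (\<Sum>m\<in>{0..<P}. (cmod (a m))\<^sup>2)"
proof -
  define A where "A k = (\<Sum>u\<in>{0..<P}. a u * cnj (chr P k u))" for k
  define BB where "BB k = (\<Sum>y\<in>Y. b y * chr P k y)" for k
  define CC where "CC k = (\<Sum>z\<in>Z. c z * chr P k z)" for k
  have A: "a m = (\<Sum>k\<in>{0..<P}. A k * chr P k m) / of_int P" for m
    unfolding A_def by (rule fourier_inversion[OF P per])
  have "(\<Sum>y\<in>Y. \<Sum>z\<in>Z. a (y + z) * b y * c z)
     = (\<Sum>y\<in>Y. \<Sum>z\<in>Z. \<Sum>k\<in>{0..<P}. A k * (b y * chr P k y) * (c z * chr P k z) / of_int P)"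
    by (subst A) (simp add: chr_add sum_distrib_left sum_distrib_right sum_divide_distrib mult_ac)
  also have "\<dots> = (\<Sum>y\<in>Y. \<Sum>k\<in>{0..<P}. \<Sum>z\<in>Z. A k * (b y * chr P k y) * (c z * chr P k z) / of_int P)"
    by (intro sum.cong refl sum.swap)
  also have "\<dots> = (\<Sum>k\<in>{0..<P}. \<Sum>y\<in>Y. \<Sum>z\<in>Z. A k * (b y * chr P k y) * (c z * chr P k z) / of_int P)"
    by (rule sum.swap)
  also have "\<dots> = (\<Sum>k\<in>{0..<P}. A k * BB k * CC k) / of_int P"
    unfolding BB_def CC_def mult.assoc sum_product
    by (simp add: sum_distrib_left sum_divide_distrib mult.assoc)
  finally have "cmod (\<Sum>y\<in>Y. \<Sum>z\<in>Z. a (y + z) * b y * c z)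
     = cmod (\<Sum>k\<in>{0..<P}. A k * BB k * CC k) / of_int P"
    using P by (simp add: norm_divide)
  also have "\<dots> \<le> (\<Sum>k\<in>{0..<P}. B * (cmod (A k) * cmod (CC k))) / of_int P"
  proof (intro divide_right_mono sum_norm_le)
    fix k assume "k \<in> {0..<P}"
    then have "cmod (BB k) \<le> B" using B unfolding BB_def by auto
    then have "cmod (BB k) * (cmod (A k) * cmod (CC k)) \<le> B * (cmod (A k) * cmod (CC k))"
      by (intro mult_right_mono) auto
    then show "cmod (A k * BB k * CC k) \<le> B * (cmod (A k) * cmod (CC k))"
      by (simp add: norm_mult mult_ac)
  qed (use P in auto)
  also have "\<dots> = B * (\<Sum>k\<in>{0..<P}. cmod (A k) * cmod (CC k)) / of_int P"
    by (simp add: sum_distrib_left)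
  also have "\<dots> \<le> B * (sqrt (\<Sum>k\<in>{0..<P}. (cmod (A k))\<^sup>2) * sqrt (\<Sum>k\<in>{0..<P}. (cmod (CC k))\<^sup>2)) / of_int P"
    using P B by (intro divide_right_mono mult_left_mono cauchy_schwarz_sum) auto
  also have "(\<Sum>k\<in>{0..<P}. (cmod (CC k))\<^sup>2) = of_int P * (\<Sum>z\<in>Z. (cmod (c z))\<^sup>2)"
    unfolding CC_def by (rule parseval[OF P Z])
  also have "(\<Sum>k\<in>{0..<P}. (cmod (A k))\<^sup>2) = of_int P * (\<Sum>m\<in>{0..<P}. (cmod (a m))\<^sup>2)"
  proof -
    have "cmod (A k) = cmod (\<Sum>u\<in>{0..<P}. cnj (a u) * chr P k u)" for k
    proof -
      have "cnj (A k) = (\<Sum>u\<in>{0..<P}. cnj (a u) * chr P k u)" by (simp add: A_def)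
      then show ?thesis by (metis complex_mod_cnj)
    qed
    then show ?thesis using parseval[OF P _ inj_on_mod_interval, of "\<lambda>u. cnj (a u)"] by simp
  qed
  finally have *: "cmod (\<Sum>y\<in>Y. \<Sum>z\<in>Z. a (y + z) * b y * c z)
     \<le> B * (sqrt (of_int P * (\<Sum>m\<in>{0..<P}. (cmod (a m))\<^sup>2)) * sqrt (of_int P * (\<Sum>z\<in>Z. (cmod (c z))\<^sup>2))) / of_int P" .
  moreover have "sqrt (real_of_int P) * (sqrt (real_of_int P) * x) = real_of_int P * x" for x
    using P by (simp flip: mult.assoc)
  ultimately show ?thesis using P by (simp add: real_sqrt_mult mult_ac)
qed

lemma sum_periodic_shift:
  assumes P: "P > 0" and per: "periodic P g"
  shows "(\<Sum>h\<in>{0..<P}. g (x + h)) = (\<Sum>h\<in>{0..<P::int}. g h)"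
proof (rule sum.reindex_bij_witness[of _ "\<lambda>h. (h - x) mod P" "\<lambda>h. (x + h) mod P"])
  fix h assume "h \<in> {0..<P}"
  then show "((x + h) mod P - x) mod P = h" "(x + (h - x) mod P) mod P = h"
    by (simp_all add: mod_diff_left_eq mod_add_right_eq)
  show "g ((x + h) mod P) = g (x + h)" by (rule periodicD[OF per])
qed (use P in auto)

section \<open>Gowers norms and additive quadruples of derivative phases\<close>

lemma ex_argmax:
  fixes f :: "'a \<Rightarrow> real"
  assumes "finite S" "S \<noteq> {}"
  shows "\<exists>k\<in>S. \<forall>l\<in>S. f l \<le> f k"
proof -
  have "Max (f ` S) \<in> f ` S" using assms by (intro Max_in) auto
  then obtain k where "k \<in> S" "f k = Max (f ` S)" by auto
  then show ?thesis using assms by (metis Max_ge finite_imageI imageI)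
qed

lemma periodic_cong:
  fixes g :: "int \<Rightarrow> 'a"
  assumes per: "periodic P g" and "x mod P = y mod P"
  shows "g x = g y"
  using assms by (metis periodicD)

lemma periodic_add:
  fixes g :: "int \<Rightarrow> 'a"
  assumes per: "periodic P g"
  shows "g (m mod P + h) = g (m + h)"
  by (rule periodic_cong[OF per]) (auto simp: mod_simps)

lemma Delta_periodic:
  assumes per: "periodic P g"
  shows "periodic P (Delta h g)"
  unfolding Delta_def periodic_def using periodicD[OF per] periodic_add[OF per] by simp

lemma Delta_commute: "Delta h1 (Delta h2 g) x = Delta h2 (Delta h1 g) x"
  by (simp add: Delta_def algebra_simps)

lemma Delta_bound: assumes "\<And>x. cmod (g x) \<le> 1" shows "cmod (Delta h g x) \<le> 1"
  using assms by (simp add: Delta_def norm_mult mult_le_one)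

lemma U2_identity:
  assumes P: "P > 0" and per: "periodic P g"
  shows "(\<Sum>x\<in>{0..<P}. \<Sum>h1\<in>{0..<P}. \<Sum>h2\<in>{0..<P}. Delta h1 (Delta h2 g) x)
    = complex_of_real (\<Sum>h\<in>{0..<P}. (cmod (\<Sum>x\<in>{0..<P}. Delta h g x))\<^sup>2)"
proof -
  have "(\<Sum>x\<in>{0..<P}. \<Sum>h1\<in>{0..<P}. \<Sum>h2\<in>{0..<P}. Delta h1 (Delta h2 g) x)
     = (\<Sum>h1\<in>{0..<P}. \<Sum>x\<in>{0..<P}. \<Sum>h2\<in>{0..<P}. Delta h1 (Delta h2 g) x)"
    by (rule sum.swap)
  also have "\<dots> = (\<Sum>h1\<in>{0..<P}. \<Sum>x\<in>{0..<P}. \<Sum>h2\<in>{0..<P}. Delta h1 g (x + h2) * cnj (Delta h1 g x))"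
    by (subst Delta_commute) (simp add: Delta_def[of _ "Delta _ g"])
  also have "\<dots> = (\<Sum>h1\<in>{0..<P}. \<Sum>x\<in>{0..<P}. (\<Sum>h2\<in>{0..<P}. Delta h1 g h2) * cnj (Delta h1 g x))"
    by (simp only: sum_distrib_right[symmetric] sum_periodic_shift[OF P Delta_periodic[OF per]])
  also have "\<dots> = (\<Sum>h1\<in>{0..<P}. complex_of_real ((cmod (\<Sum>x\<in>{0..<P}. Delta h1 g x))\<^sup>2))"
    by (simp only: complex_norm_square cnj_sum sum_distrib_left)
  finally show ?thesis by simp
qed

text \<open>The left side \<open>R\<close> is itself a trilinear form in \<open>g\<close>,
  \<open>g\<close> and the correlations \<open>r\<close>, so \<open>trilinear_bound\<close> gives R
  \<le> B sqrt(R) sqrt(G), and one factor sqrt(R) cancels.\<close>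

lemma U2_bound:
  assumes P: "P > 0" and per: "periodic P g"
    and B: "\<And>k. k \<in> {0..<P} \<Longrightarrow> cmod (\<Sum>x\<in>{0..<P}. g x * chr P k x) \<le> B" "B \<ge> 0"
  shows "(\<Sum>h\<in>{0..<P}. (cmod (\<Sum>x\<in>{0..<P}. Delta h g x))\<^sup>2) \<le> B\<^sup>2 * (\<Sum>x\<in>{0..<P}. (cmod (g x))\<^sup>2)"
proof -
  define r where "r h = (\<Sum>x\<in>{0..<P}. Delta h g x)" for h
  define R where "R = (\<Sum>h\<in>{0..<P}. (cmod (r h))\<^sup>2)"
  define G where "G = (\<Sum>x\<in>{0..<P}. (cmod (g x))\<^sup>2)"
  have R0: "R \<ge> 0" and G0: "G \<ge> 0" by (auto simp: R_def G_def intro: sum_nonneg)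
  have "complex_of_real R = (\<Sum>h\<in>{0..<P}. r h * cnj (r h))"
    by (simp add: R_def complex_norm_square del: of_real_power)
  also have "\<dots> = (\<Sum>h\<in>{0..<P}. \<Sum>x\<in>{0..<P}. cnj (g (x + h)) * g x * r h)"
  proof (intro sum.cong refl)
    fix h
    have "cnj (r h) = (\<Sum>x\<in>{0..<P}. cnj (g (x + h)) * g x)" by (simp add: r_def Delta_def)
    then show "r h * cnj (r h) = (\<Sum>x\<in>{0..<P}. cnj (g (x + h)) * g x * r h)"
      by (simp add: sum_distrib_left mult.commute)
  qed
  also have "\<dots> = (\<Sum>x\<in>{0..<P}. \<Sum>h\<in>{0..<P}. cnj (g (x + h)) * g x * r h)"
    by (rule sum.swap)
  finally have "R = cmod (\<Sum>x\<in>{0..<P}. \<Sum>h\<in>{0..<P}. cnj (g (x + h)) * g x * r h)"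
    using R0 by (metis abs_of_nonneg norm_of_real)
  also have "\<dots> \<le> B * sqrt (\<Sum>h\<in>{0..<P}. (cmod (r h))\<^sup>2) * sqrt (\<Sum>m\<in>{0..<P}. (cmod (cnj (g m)))\<^sup>2)"
    by (rule trilinear_bound[where a = "\<lambda>m. cnj (g m)"]) (use P per B inj_on_mod_interval in \<open>auto simp: periodic_def\<close>)
  finally have "R \<le> B * sqrt R * sqrt G" by (simp add: R_def G_def)
  then have "sqrt R * sqrt R \<le> (B * sqrt G) * sqrt R" using R0 by (simp add: mult_ac)
  then have "sqrt R \<le> B * sqrt G \<or> R = 0"
    using R0 by (metis mult_le_cancel_right_pos real_sqrt_gt_0_iff less_eq_real_def)
  then have "R \<le> (B * sqrt G)\<^sup>2"
  proof
    assume "sqrt R \<le> B * sqrt G"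
    then have "(sqrt R)\<^sup>2 \<le> (B * sqrt G)\<^sup>2" using R0 by (intro power_mono) auto
    then show ?thesis using R0 by simp
  qed auto
  then show ?thesis using G0 by (simp add: power_mult_distrib R_def G_def r_def)
qed

text \<open>Elements below the threshold \<tau> carry at most half of the total, so the other half
  sits on elements that carry at most \<open>T\<close> each.\<close>

lemma popular_card:
  fixes t :: "'a \<Rightarrow> real" and T \<tau> :: real
  assumes "finite S" "\<And>s. s \<in> S \<Longrightarrow> t s \<le> T" "\<tau> \<ge> 0"
    and "(\<Sum>s\<in>S. t s) \<ge> 2 * \<tau> * card S"
  shows "card {s \<in> S. t s \<ge> \<tau>} * T \<ge> \<tau> * card S"
proof -
  have "(\<Sum>s\<in>S. t s) = (\<Sum>s\<in>{s \<in> S. t s \<ge> \<tau>}. t s) + (\<Sum>s\<in>{s \<in> S. \<not> t s \<ge> \<tau>}. t s)"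
    using assms(1) by (subst sum.union_disjoint[symmetric]) (auto intro: sum.cong)
  also have "\<dots> \<le> (\<Sum>s\<in>{s \<in> S. t s \<ge> \<tau>}. T) + (\<Sum>s\<in>{s \<in> S. \<not> t s \<ge> \<tau>}. \<tau>)"
    using assms by (intro add_mono sum_mono) auto
  also have "\<dots> \<le> card {s \<in> S. t s \<ge> \<tau>} * T + card S * \<tau>"
    using assms by (auto intro!: mult_right_mono card_mono)
  finally show ?thesis using assms(4) by (simp add: mult_ac)
qed

text \<open>The inner sum over \<open>h1\<close> is the U^2 norm of the derivative along
  \<open>h\<close>, hence controlled by the largest Fourier coefficient of that derivative; \<xi>
  picks a maximising frequency for each \<open>h\<close>, and popularity selects the
  \<open>h\<close> for which the coefficient is large.\<close>

lemma derivative_correlates: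
  fixes F :: "int \<Rightarrow> complex" and M :: int and c :: real
  assumes M: "M > 0" and per: "periodic M F" and bd: "\<And>m. cmod (F m) \<le> 1"
    and c: "0 < c" "c \<le> 1"
    and U3: "(\<Sum>h\<in>{0..<M}. \<Sum>h1\<in>{0..<M}. (cmod (\<Sum>x\<in>{0..<M}. Delta h1 (Delta h F) x))\<^sup>2) \<ge> 2 * c * of_int M ^ 4"
  obtains H \<xi> where "H \<subseteq> {0..<M}" "card H \<ge> c * M" "\<And>h. h \<in> H \<Longrightarrow> \<xi> h \<in> {0..<M}"
    "\<And>h. h \<in> H \<Longrightarrow> cmod (\<Sum>x\<in>{0..<M}. Delta h F x * chr M (\<xi> h) x) \<ge> c * M"
proof -
  define w where "w h k = cmod (\<Sum>x\<in>{0..<M}. Delta h F x * chr M k x)" for h k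
  have "\<forall>h. \<exists>k\<in>{0..<M}. \<forall>l\<in>{0..<M}. w h l \<le> w h k" using M by (intro allI ex_argmax) auto
  then obtain \<xi> where \<xi>: "\<And>h. \<xi> h \<in> {0..<M}" "\<And>h l. l \<in> {0..<M} \<Longrightarrow> w h l \<le> w h (\<xi> h)" by metis
  define t where "t h = (w h (\<xi> h))\<^sup>2" for h
  have Db: "cmod (Delta h F x) \<le> 1" for h x by (rule Delta_bound[OF bd])
  have wM: "w h k \<le> M" for h k
  proof -
    have "w h k \<le> (\<Sum>x\<in>{0..<M}. 1)"
      unfolding w_def by (rule sum_norm_le) (simp add: norm_mult Db)
    then show ?thesis using M by simp
  qed
  have w0: "w h k \<ge> 0" for h k by (simp add: w_def)
  have tb: "t h \<le> (of_int M)\<^sup>2" for h unfolding t_def using wM w0 by (intro power_mono) auto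
  have "(\<Sum>h1\<in>{0..<M}. (cmod (\<Sum>x\<in>{0..<M}. Delta h1 (Delta h F) x))\<^sup>2) \<le> t h * M" for h
  proof -
    have "(\<Sum>h1\<in>{0..<M}. (cmod (\<Sum>x\<in>{0..<M}. Delta h1 (Delta h F) x))\<^sup>2)
       \<le> t h * (\<Sum>x\<in>{0..<M}. (cmod (Delta h F x))\<^sup>2)"
      unfolding t_def by (rule U2_bound) (use M Delta_periodic[OF per] \<xi> w0 in \<open>auto simp: w_def\<close>)
    also have "\<dots> \<le> t h * (\<Sum>x\<in>{0..<M}. 1)"
      using Db by (intro mult_left_mono sum_mono) (auto simp: t_def power_le_one)
    finally show ?thesis using M by simp
  qed
  then have "2 * c * of_int M ^ 4 \<le> (\<Sum>h\<in>{0..<M}. t h * M)"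
    using U3 by (meson order_trans sum_mono)
  then have "2 * c * of_int M ^ 4 \<le> (\<Sum>h\<in>{0..<M}. t h) * M" by (simp add: sum_distrib_right)
  then have "(2 * c * of_int M ^ 3) * M \<le> (\<Sum>h\<in>{0..<M}. t h) * M" by (simp add: eval_nat_numeral mult_ac)
  then have "2 * c * of_int M ^ 3 \<le> (\<Sum>h\<in>{0..<M}. t h)" using M by (simp add: mult_le_cancel_right)
  then have "2 * (c * (of_int M)\<^sup>2) * card {0..<M} \<le> (\<Sum>h\<in>{0..<M}. t h)"
    using M by (simp add: eval_nat_numeral mult_ac)
  from popular_card[OF _ tb _ this] c
  have "c * (of_int M)\<^sup>2 * card {0..<M} \<le> card {h \<in> {0..<M}. c * (of_int M)\<^sup>2 \<le> t h} * (of_int M)\<^sup>2"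
    by simp
  then have "(c * M) * (of_int M)\<^sup>2 \<le> card {h \<in> {0..<M}. c * (of_int M)\<^sup>2 \<le> t h} * (of_int M)\<^sup>2"
    using M by (simp add: mult_ac)
  then have card: "c * M \<le> card {h \<in> {0..<M}. c * (of_int M)\<^sup>2 \<le> t h}"
    using M by (simp add: mult_le_cancel_right)
  \<comment> \<open>Popularity bounds the square from below by c M^2; since \<open>c\<close> is at
    most 1, the coefficient itself is at least c M, so one constant serves for density and
    correlation.\<close>
  have "c * M \<le> w h (\<xi> h)" if "c * (of_int M)\<^sup>2 \<le> t h" for h
  proof -
    have "(c * M)\<^sup>2 = c * (c * (of_int M)\<^sup>2)" by (simp add: power2_eq_square mult_ac)
    also have "\<dots> \<le> 1 * (c * (of_int M)\<^sup>2)" using c by (intro mult_right_mono) auto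
    finally have "(c * M)\<^sup>2 \<le> (w h (\<xi> h))\<^sup>2" using that by (simp add: t_def)
    then show ?thesis using w0 power2_le_imp_le by blast
  qed
  then show ?thesis
    by (intro that[of "{h \<in> {0..<M}. c * (of_int M)\<^sup>2 \<le> t h}" \<xi>]) (use card \<xi> in \<open>auto simp: w_def\<close>)
qed

text \<open>The square of the exponential sum is a sum over pairs, and the squared modulus of that a
  sum over quadruples; orthogonality in \<open>k\<close> and in \<theta> imposes the two
  congruences.\<close>

lemma fourth_moment:
  fixes M :: int and H :: "int set"
  assumes M: "M > 0" and H: "finite H"
  shows "(\<Sum>k\<in>{0..<M}. \<Sum>\<theta>\<in>{0..<M}. (cmod (\<Sum>h\<in>H. chr M (- \<xi> h) k * chr M \<theta> h)) ^ 4)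
    = real_of_int M ^ 2 * real (card {((h1, h2), (h3, h4)) \<in> (H \<times> H) \<times> (H \<times> H).
         M dvd (h1 + h2 - h3 - h4) \<and> M dvd (\<xi> h1 + \<xi> h2 - \<xi> h3 - \<xi> h4)})" (is "?L = _ * real (card ?Q)")
proof -
  define S where "S k \<theta> = (\<Sum>h\<in>H. chr M (- \<xi> h) k * chr M \<theta> h)" for k \<theta>
  define q where "q k \<theta> p = chr M (- (\<xi> (fst p) + \<xi> (snd p))) k * chr M \<theta> (fst p + snd p)" for k \<theta> p
  define u where "u p p' = \<xi> (fst p') + \<xi> (snd p') - (\<xi> (fst p) + \<xi> (snd p))" for p p'
  define v where "v p p' = fst p + snd p - (fst p' + snd p')" for p p' :: "int \<times> int"
  have S2: "S k \<theta> ^ 2 = (\<Sum>p\<in>H \<times> H. q k \<theta> p)" for k \<theta>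
    unfolding S_def power2_eq_square sum_product q_def sum.cartesian_product
    by (intro sum.cong refl) (auto simp: chr_add chr_diff_left chr_minus_left mult_ac)
  have qq: "q k \<theta> p * cnj (q k \<theta> p') = chr M k (u p p') * chr M \<theta> (v p p')" for k \<theta> p p'
    unfolding q_def u_def v_def
    by (simp add: chr_commute[of M k] chr_add chr_diff chr_diff_left chr_minus_left chr_add_left mult_ac)
  have "complex_of_real ?L = (\<Sum>k\<in>{0..<M}. \<Sum>\<theta>\<in>{0..<M}. complex_of_real ((cmod (S k \<theta> ^ 2))\<^sup>2))"
    by (simp add: S_def norm_power power_mult[symmetric])
  also have "\<dots> = (\<Sum>k\<in>{0..<M}. \<Sum>\<theta>\<in>{0..<M}. \<Sum>p\<in>H\<times>H. \<Sum>p'\<in>H\<times>H. chr M k (u p p') * chr M \<theta> (v p p'))"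
    by (simp only: S2 cmod_sum_sq qq)
  also have "\<dots> = (\<Sum>k\<in>{0..<M}. \<Sum>\<theta>\<in>{0..<M}. \<Sum>z\<in>(H\<times>H)\<times>(H\<times>H). chr M k (u (fst z) (snd z)) * chr M \<theta> (v (fst z) (snd z)))"
    by (simp add: sum.cartesian_product split_def)
  also have "\<dots> = (\<Sum>z\<in>(H\<times>H)\<times>(H\<times>H). \<Sum>k\<in>{0..<M}. \<Sum>\<theta>\<in>{0..<M}. chr M k (u (fst z) (snd z)) * chr M \<theta> (v (fst z) (snd z)))"
    by (simp only: sum.swap[of _ "(H\<times>H)\<times>(H\<times>H)"])
  also have "\<dots> = (\<Sum>z\<in>(H\<times>H)\<times>(H\<times>H). (\<Sum>k\<in>{0..<M}. chr M k (u (fst z) (snd z))) * (\<Sum>\<theta>\<in>{0..<M}. chr M \<theta> (v (fst z) (snd z))))"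
    by (simp only: sum_product)
  also have "\<dots> = (\<Sum>z\<in>(H\<times>H)\<times>(H\<times>H). if z \<in> ?Q then of_int M ^ 2 else 0)"
  proof (intro sum.cong refl)
    fix z assume "z \<in> (H\<times>H)\<times>(H\<times>H)"
    moreover have "M dvd u (fst z) (snd z) \<longleftrightarrow> M dvd - u (fst z) (snd z)" by simp
    ultimately show "(\<Sum>k\<in>{0..<M}. chr M k (u (fst z) (snd z))) * (\<Sum>\<theta>\<in>{0..<M}. chr M \<theta> (v (fst z) (snd z)))
       = (if z \<in> ?Q then of_int M ^ 2 else 0)"
      using M by (cases z) (auto simp: sum_chr u_def v_def algebra_simps power2_eq_square)
  qed
  also have "\<dots> = of_int M ^ 2 * of_nat (card ?Q)"
  proof -
    have "?Q \<subseteq> (H\<times>H)\<times>(H\<times>H)" by auto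
    then have "((H\<times>H)\<times>(H\<times>H)) \<inter> ?Q = ?Q" by blast
    then show ?thesis using H by (simp add: sum.If_cases del: of_int_power)
  qed
  finally have "complex_of_real ?L = complex_of_real (real_of_int M ^ 2 * real (card ?Q))" by simp
  then show ?thesis by (simp only: of_real_eq_iff)
qed

lemma power4_sum_le:
  fixes b :: "'a \<Rightarrow> real"
  assumes "finite S"
  shows "(\<Sum>s\<in>S. b s) ^ 4 \<le> real (card S) ^ 3 * (\<Sum>s\<in>S. b s ^ 4)"
proof -
  have 1: "(\<Sum>s\<in>S. f s)\<^sup>2 \<le> (\<Sum>s\<in>S. (f s)\<^sup>2) * card S" for f :: "'a \<Rightarrow> real"
    using Cauchy_Schwarz_ineq_sum[of f "\<lambda>_. 1" S] by simp
  have "(\<Sum>s\<in>S. b s) ^ 4 = ((\<Sum>s\<in>S. b s)\<^sup>2)\<^sup>2" by simp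
  also have "\<dots> \<le> ((\<Sum>s\<in>S. (b s)\<^sup>2) * card S)\<^sup>2" by (intro power_mono 1) auto
  also have "\<dots> = (\<Sum>s\<in>S. (b s)\<^sup>2)\<^sup>2 * (card S)\<^sup>2" by (simp add: power_mult_distrib)
  also have "\<dots> \<le> ((\<Sum>s\<in>S. ((b s)\<^sup>2)\<^sup>2) * card S) * (card S)\<^sup>2" by (intro mult_right_mono 1) auto
  finally show ?thesis by (simp add: eval_nat_numeral mult_ac)
qed

text \<open>After squaring, the base points x and x + k share the factor e(\<xi>(h) x / M), so only
  e(- \<xi>(h) k / M) survives, between a function of h + x and one of x. By
  \<open>trilinear_bound\<close> the sequence e(- \<xi>(h) k / M) on \<open>H\<close> then has, on
  average over \<open>k\<close>, a large Fourier coefficient, and the fourth moment of these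
  coefficients counts the quadruples.\<close>

lemma derivative_phases_quadruples:
  fixes F :: "int \<Rightarrow> complex" and M :: int and c :: real
  assumes M: "M > 0" and per: "periodic M F" and bd: "\<And>m. cmod (F m) \<le> 1" and c: "c > 0"
    and H: "H \<subseteq> {0..<M}" "card H \<ge> c * M"
    and cor: "\<And>h. h \<in> H \<Longrightarrow> cmod (\<Sum>x\<in>{0..<M}. Delta h F x * chr M (\<xi> h) x) \<ge> c * M"
  shows "real (card {((h1, h2), (h3, h4)) \<in> (H \<times> H) \<times> (H \<times> H).
         M dvd (h1 + h2 - h3 - h4) \<and> M dvd (\<xi> h1 + \<xi> h2 - \<xi> h3 - \<xi> h4)}) \<ge> c ^ 12 * real_of_int M ^ 3"
    (is "real (card ?Q) \<ge> _")
proof -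
  have finH: "finite H" using H(1) finite_subset by blast
  define w where "w k \<theta> = cmod (\<Sum>h\<in>H. chr M (- \<xi> h) k * chr M \<theta> h)" for k \<theta>
  have "\<forall>k. \<exists>\<theta>\<in>{0..<M}. \<forall>l\<in>{0..<M}. w k l \<le> w k \<theta>" using M by (intro allI ex_argmax) auto
  then obtain \<theta> where \<theta>: "\<And>k. \<theta> k \<in> {0..<M}" "\<And>k l. l \<in> {0..<M} \<Longrightarrow> w k l \<le> w k (\<theta> k)" by metis
  define b where "b k = w k (\<theta> k)" for k
  have b0: "b k \<ge> 0" for k by (simp add: b_def w_def)
  define s where "s h x = Delta h F x * chr M (\<xi> h) x" for h x
  have sper: "periodic M (\<lambda>y. s h x * cnj (s h y))" for h x
    unfolding periodic_def s_def using Delta_periodic[OF per, THEN periodicD] chr_mod[OF M] by simp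
  define a where "a k m = F m * cnj (F (m + k))" for k m
  have aper: "periodic M (a k)" for k
    unfolding periodic_def a_def using periodicD[OF per] periodic_add[OF per] by simp
  have ab: "cmod (a k m) \<le> 1" for k m using bd by (simp add: a_def norm_mult mult_le_one)
  have sk: "s h x * cnj (s h (x + k)) = a k (h + x) * chr M (- \<xi> h) k * cnj (a k x)" for h x k
    unfolding s_def a_def Delta_def
    by (simp add: chr_add chr_minus_left algebra_simps)
       (simp add: chr_def e_mult_cnj mult.assoc[symmetric] mult.commute)
  have "complex_of_real (\<Sum>h\<in>H. (cmod (\<Sum>x\<in>{0..<M}. s h x))\<^sup>2)
     = (\<Sum>h\<in>H. \<Sum>x\<in>{0..<M}. \<Sum>y\<in>{0..<M}. s h x * cnj (s h y))"
    by (simp only: of_real_sum cmod_sum_sq)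
  also have "\<dots> = (\<Sum>h\<in>H. \<Sum>x\<in>{0..<M}. \<Sum>k\<in>{0..<M}. s h x * cnj (s h (x + k)))"
    using sum_periodic_shift[OF M sper] by simp
  also have "\<dots> = (\<Sum>h\<in>H. \<Sum>k\<in>{0..<M}. \<Sum>x\<in>{0..<M}. s h x * cnj (s h (x + k)))"
    by (intro sum.cong refl sum.swap)
  also have "\<dots> = (\<Sum>k\<in>{0..<M}. \<Sum>h\<in>H. \<Sum>x\<in>{0..<M}. a k (h + x) * chr M (- \<xi> h) k * cnj (a k x))"
    by (subst sum.swap) (simp only: sk)
  finally have *: "complex_of_real (\<Sum>h\<in>H. (cmod (\<Sum>x\<in>{0..<M}. s h x))\<^sup>2)
     = (\<Sum>k\<in>{0..<M}. \<Sum>h\<in>H. \<Sum>x\<in>{0..<M}. a k (h + x) * chr M (- \<xi> h) k * cnj (a k x))" .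
  have "(c * M) * (c * M)\<^sup>2 \<le> real (card H) * (c * M)\<^sup>2" using H by (intro mult_right_mono) auto
  also have "\<dots> = (\<Sum>h\<in>H. (c * M)\<^sup>2)" by simp
  also have "\<dots> \<le> (\<Sum>h\<in>H. (cmod (\<Sum>x\<in>{0..<M}. s h x))\<^sup>2)"
    unfolding s_def using cor M c by (intro sum_mono power_mono) auto
  also have "\<dots> = cmod (\<Sum>k\<in>{0..<M}. \<Sum>h\<in>H. \<Sum>x\<in>{0..<M}. a k (h + x) * chr M (- \<xi> h) k * cnj (a k x))"
    by (subst *[symmetric]) (simp add: sum_nonneg del: of_real_sum)
  also have "\<dots> \<le> (\<Sum>k\<in>{0..<M}. b k * M)"
  proof (rule sum_norm_le)
    fix k
    have le: "(\<Sum>m\<in>{0..<M}. (cmod (a k m))\<^sup>2) \<le> M"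
    proof -
      have "(\<Sum>m\<in>{0..<M}. (cmod (a k m))\<^sup>2) \<le> (\<Sum>m\<in>{0..<M}. 1)"
        using ab by (intro sum_mono) (auto simp: power_le_one)
      then show ?thesis using M by simp
    qed
    have "cmod (\<Sum>h\<in>H. \<Sum>x\<in>{0..<M}. a k (h + x) * chr M (- \<xi> h) k * cnj (a k x))
      \<le> b k * sqrt (\<Sum>x\<in>{0..<M}. (cmod (cnj (a k x)))\<^sup>2) * sqrt (\<Sum>m\<in>{0..<M}. (cmod (a k m))\<^sup>2)"
      using M aper finH inj_on_mod_interval \<theta> b0
      by (intro trilinear_bound) (auto simp: b_def w_def)
    also have "\<dots> = b k * (\<Sum>m\<in>{0..<M}. (cmod (a k m))\<^sup>2)" by (simp add: sum_nonneg)
    also have "\<dots> \<le> b k * M" using le b0 by (intro mult_left_mono)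
    finally show "cmod (\<Sum>h\<in>H. \<Sum>x\<in>{0..<M}. a k (h + x) * chr M (- \<xi> h) k * cnj (a k x)) \<le> b k * M" .
  qed
  finally have "(c ^ 3 * (of_int M)\<^sup>2) * M \<le> (\<Sum>k\<in>{0..<M}. b k) * M"
    by (simp add: sum_distrib_left[symmetric] eval_nat_numeral mult_ac)
  then have bs: "c ^ 3 * (of_int M)\<^sup>2 \<le> (\<Sum>k\<in>{0..<M}. b k)" using M by (simp add: mult_le_cancel_right)
  \<comment> \<open>Hoelder in \<open>k\<close> passes from the first moment of the maximal
    coefficients to the fourth, which is then enlarged to all \<theta>; c^12 is (c^3)^4.\<close>
  have "(c ^ 3 * (of_int M)\<^sup>2) ^ 4 \<le> (\<Sum>k\<in>{0..<M}. b k) ^ 4" using bs c by (intro power_mono) auto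
  also have "\<dots> \<le> real (card {0..<M}) ^ 3 * (\<Sum>k\<in>{0..<M}. b k ^ 4)" by (rule power4_sum_le) simp
  also have "\<dots> \<le> real (card {0..<M}) ^ 3 * (\<Sum>k\<in>{0..<M}. \<Sum>\<theta>\<in>{0..<M}. w k \<theta> ^ 4)"
  proof (intro mult_left_mono sum_mono)
    fix k
    have "w k (\<theta> k) ^ 4 \<le> (\<Sum>\<theta>\<in>{0..<M}. w k \<theta> ^ 4)"
      using \<theta> by (intro member_le_sum) auto
    then show "b k ^ 4 \<le> (\<Sum>\<theta>\<in>{0..<M}. w k \<theta> ^ 4)" by (simp add: b_def)
  qed auto
  also have "\<dots> = real_of_int M ^ 5 * real (card ?Q)"
    unfolding w_def fourth_moment[OF M finH] using M by (simp add: power_add[symmetric] mult.assoc[symmetric])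
  finally have *: "(c ^ 3 * (of_int M)\<^sup>2) ^ 4 \<le> real_of_int M ^ 5 * real (card ?Q)" .
  have "real_of_int M ^ 5 * (c ^ 12 * real_of_int M ^ 3) \<le> real_of_int M ^ 5 * real (card ?Q)"
  proof -
    have "(c ^ 3 * (of_int M)\<^sup>2) ^ 4 = c ^ 12 * real_of_int M ^ 8"
      by (simp add: power_mult_distrib power_mult[symmetric])
    also have "real_of_int M ^ 8 = real_of_int M ^ 5 * real_of_int M ^ 3"
      by (simp add: power_add[symmetric])
    finally have "real_of_int M ^ 5 * (c ^ 12 * real_of_int M ^ 3) = (c ^ 3 * (of_int M)\<^sup>2) ^ 4"
      by (simp only: mult_ac)
    with * show ?thesis by (simp only:)
  qed
  then show ?thesis using M by (simp add: mult_le_cancel_left)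
qed

definition quads :: "'a::ab_group_add set \<Rightarrow> 'a \<Rightarrow> (('a \<times> 'a) \<times> ('a \<times> 'a)) set" where
  "quads A s = {((a, b), (c, d)) \<in> (A \<times> A) \<times> (A \<times> A). a + b - c - d = s}"

text \<open>With \<open>r\<close> the number of representations as a sum of two elements, the left
  side is the correlation of \<open>r\<close> with its translate by \<open>s\<close>, which is
  largest for the trivial translate.\<close>

lemma card_quads_le:
  assumes A: "finite A"
  shows "card (quads A s) \<le> card (quads A 0)"
proof -
  define \<sigma> :: "'a \<times> 'a \<Rightarrow> 'a" where "\<sigma> p = fst p + snd p" for p
  define r where "r t = real (card {p \<in> A \<times> A. \<sigma> p = t})" for t
  define T where "T = \<sigma> ` (A \<times> A)"
  have finT: "finite T" using A by (simp add: T_def)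
  have r0: "r t = 0" if "t \<notin> T" for t
  proof -
    have "{p \<in> A \<times> A. \<sigma> p = t} = {}" using that by (auto simp: T_def)
    then show ?thesis unfolding r_def by (simp only: card.empty of_nat_0)
  qed
  have E: "real (card (quads A s)) = (\<Sum>t\<in>T. r t * r (t - s))" for s
  proof -
    have "quads A s = (\<Union>t\<in>T. {p \<in> A \<times> A. \<sigma> p = t} \<times> {p \<in> A \<times> A. \<sigma> p = t - s})"
    proof -
      have "a + b - c - d = s \<longleftrightarrow> c + d = a + b - s" for a b c d :: 'a
        by (auto simp: algebra_simps)
      then show ?thesis by (auto simp: quads_def T_def \<sigma>_def)
    qed
    moreover have "card (\<Union>t\<in>T. {p \<in> A \<times> A. \<sigma> p = t} \<times> {p \<in> A \<times> A. \<sigma> p = t - s})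
      = (\<Sum>t\<in>T. card ({p \<in> A \<times> A. \<sigma> p = t} \<times> {p \<in> A \<times> A. \<sigma> p = t - s}))"
      using finT A by (intro card_UN_disjoint) auto
    ultimately show ?thesis unfolding r_def by (simp only: card_cartesian_product of_nat_sum of_nat_mult)
  qed
  have sh: "(\<Sum>t\<in>T. (r (t - s))\<^sup>2) \<le> (\<Sum>t\<in>T. (r t)\<^sup>2)"
  proof -
    have "(\<Sum>t\<in>T. (r (t - s))\<^sup>2) = (\<Sum>u\<in>(\<lambda>t. t - s) ` T. (r u)\<^sup>2)"
      by (subst sum.reindex) (auto simp: inj_on_def)
    also have "\<dots> = (\<Sum>u\<in>(\<lambda>t. t - s) ` T \<inter> T. (r u)\<^sup>2)"
      using finT r0 by (intro sum.mono_neutral_right) auto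
    also have "\<dots> \<le> (\<Sum>u\<in>T. (r u)\<^sup>2)" using finT by (intro sum_mono2) auto
    finally show ?thesis .
  qed
  have "real (card (quads A s)) \<le> (\<Sum>t\<in>T. ((r t)\<^sup>2 + (r (t - s))\<^sup>2) / 2)"
    unfolding E
  proof (intro sum_mono)
    fix t
    show "r t * r (t - s) \<le> ((r t)\<^sup>2 + (r (t - s))\<^sup>2) / 2"
      using sum_squares_bound[of "r t" "r (t - s)"] by simp
  qed
  also have "\<dots> = ((\<Sum>t\<in>T. (r t)\<^sup>2) + (\<Sum>t\<in>T. (r (t - s))\<^sup>2)) / 2"
    by (simp add: sum_divide_distrib[symmetric] sum.distrib)
  also have "\<dots> \<le> (\<Sum>t\<in>T. (r t)\<^sup>2)" using sh by simp
  also have "\<dots> = real (card (quads A 0))" by (simp add: E power2_eq_square)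
  finally show ?thesis by simp
qed

text \<open>Representatives in [0, M) leave only -M, 0, M for each of the two defects, hence nine
  shifted systems over the integers, none with more solutions than the unshifted one. This removes
  wrap-around from the additive structure of the graph.\<close>

lemma mod_quadruples_lift:
  fixes M :: int
  assumes M: "M > 0" and H: "H \<subseteq> {0..<M}" and \<xi>: "\<And>h. h \<in> H \<Longrightarrow> \<xi> h \<in> {0..<M}"
  shows "card {((h1, h2), (h3, h4)) \<in> (H \<times> H) \<times> (H \<times> H).
         M dvd (h1 + h2 - h3 - h4) \<and> M dvd (\<xi> h1 + \<xi> h2 - \<xi> h3 - \<xi> h4)}
       \<le> 9 * card (quads ((\<lambda>h. (h, \<xi> h)) ` H) 0)" (is "card ?Q \<le> 9 * card (quads ?A 0)")
proof -
  have finH: "finite H" using H finite_subset by blast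
  define W where "W = {- M, 0, M} \<times> {- M, 0, M}"
  have W9: "card W \<le> 9" and finW: "finite W" unfolding W_def
    by (auto simp: card_cartesian_product card_insert_if)
  define j where "j = (\<lambda>((h1, h2), (h3, h4)). (((h1, \<xi> h1), (h2, \<xi> h2)), ((h3, \<xi> h3), (h4, \<xi> h4))))"
  have inj: "inj_on j ?Q" by (auto simp: inj_on_def j_def)
  have three: "d \<in> {- M, 0, M}" if "M dvd d" "- 2 * M < d" "d < 2 * M" for d
  proof -
    obtain m where m: "d = M * m" using \<open>M dvd d\<close> by blast
    have "m < 2" using that M unfolding m by (auto simp: mult.commute[of M])
    moreover have "- 2 < m"
    proof (rule ccontr)
      assume "\<not> - 2 < m"
      then have "m * M \<le> - 2 * M" using M by (intro mult_right_mono) auto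
      then show False using that m by (simp add: mult.commute)
    qed
    ultimately have "m = -1 \<or> m = 0 \<or> m = 1" by linarith
    then show ?thesis using m by auto
  qed
  have img: "j ` ?Q \<subseteq> (\<Union>s\<in>W. quads ?A s)"
  proof
    fix z assume "z \<in> j ` ?Q"
    then obtain h1 h2 h3 h4 where z: "z = j ((h1, h2), (h3, h4))" and h: "h1 \<in> H" "h2 \<in> H" "h3 \<in> H" "h4 \<in> H"
      and d: "M dvd (h1 + h2 - h3 - h4)" "M dvd (\<xi> h1 + \<xi> h2 - \<xi> h3 - \<xi> h4)" by auto
    have "h1 + h2 - h3 - h4 \<in> {- M, 0, M}" using d subsetD[OF H h(1)] subsetD[OF H h(2)] subsetD[OF H h(3)] subsetD[OF H h(4)] by (intro three) auto
    moreover have "\<xi> h1 + \<xi> h2 - \<xi> h3 - \<xi> h4 \<in> {- M, 0, M}"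
      using d \<xi>[OF h(1)] \<xi>[OF h(2)] \<xi>[OF h(3)] \<xi>[OF h(4)] by (intro three) auto
    ultimately have "(h1 + h2 - h3 - h4, \<xi> h1 + \<xi> h2 - \<xi> h3 - \<xi> h4) \<in> W" unfolding W_def by blast
    moreover have "z \<in> quads ?A (h1 + h2 - h3 - h4, \<xi> h1 + \<xi> h2 - \<xi> h3 - \<xi> h4)"
      using h unfolding z j_def quads_def by auto
    ultimately show "z \<in> (\<Union>s\<in>W. quads ?A s)" by blast
  qed
  have fin: "finite (quads ?A s)" for s
    by (rule finite_subset[of _ "(?A \<times> ?A) \<times> (?A \<times> ?A)"]) (use finH in \<open>auto simp: quads_def\<close>)
  have "card ?Q = card (j ` ?Q)" using inj by (simp add: card_image)
  also have "\<dots> \<le> card (\<Union>s\<in>W. quads ?A s)" using img fin finW by (intro card_mono) auto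
  also have "\<dots> \<le> (\<Sum>s\<in>W. card (quads ?A s))" by (rule card_UN_le[OF finW])
  also have "\<dots> \<le> (\<Sum>s\<in>W. card (quads ?A 0))" using finH by (intro sum_mono card_quads_le) auto
  also have "\<dots> \<le> 9 * card (quads ?A 0)" using W9 by simp
  finally show ?thesis .
qed

section \<open>The Balog--Szemeredi--Gowers theorem\<close>

definition rep :: "'a::ab_group_add set \<Rightarrow> 'a \<Rightarrow> nat" where
  "rep A d = card {a \<in> A. a - d \<in> A}"

lemma rep_uminus: "rep A (- d) = rep A d"
  unfolding rep_def by (rule bij_betw_same_card[of "\<lambda>a. a + d"])
    (auto simp: bij_betw_def inj_on_def image_iff intro!: exI[of _ "_ - d"] bexI[of _ "_ - d"])

lemma sum_rep:
  assumes A: "finite A"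
  shows "(\<Sum>a\<in>A. \<Sum>c\<in>A. rep A (a - c)) = card (quads A 0)"
proof -
  have key: "a + b - c - d = 0 \<longleftrightarrow> b = d - (a - c)" for a b c d :: 'a
    by (auto simp: algebra_simps)
  have "card (quads A 0) = card (SIGMA p:A \<times> A. {b \<in> A. b - (fst p - snd p) \<in> A})"
    by (rule bij_betw_same_card[of "\<lambda>((a, b), (c, d)). ((a, c), d)"], rule bij_betw_byWitness[where f' = "\<lambda>((a, c), d). ((a, d - (a - c)), (c, d))"])
      (auto simp: quads_def key)
  also have "\<dots> = (\<Sum>p\<in>A \<times> A. rep A (fst p - snd p))"
    using A by (simp add: card_SigmaI rep_def)
  finally show ?thesis by (simp add: sum.cartesian_product split_def)
qed

lemma card_mult_fibres_le:
  fixes m :: real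
  assumes "finite T" "finite D"
    and "\<And>d. d \<in> D \<Longrightarrow> m \<le> card {t \<in> T. s t = d}"
  shows "card D * m \<le> card T"
proof -
  have "card D * m = (\<Sum>d\<in>D. m)" by simp
  also have "\<dots> \<le> (\<Sum>d\<in>D. real (card {t \<in> T. s t = d}))" using assms by (intro sum_mono) auto
  also have "\<dots> = real (card (\<Union>d\<in>D. {t \<in> T. s t = d}))"
    using assms by (subst card_UN_disjoint) auto
  also have "\<dots> \<le> card T" using assms by (intro of_nat_mono card_mono) auto
  finally show ?thesis .
qed

lemma sum_card_swap:
  assumes "finite A" "finite B"
  shows "(\<Sum>a\<in>A. card {b \<in> B. R a b}) = (\<Sum>b\<in>B. card {a \<in> A. R a b})"
proof -
  have "(\<Sum>a\<in>A. card {b \<in> B. R a b}) = (\<Sum>a\<in>A. \<Sum>b\<in>B. if R a b then 1 else 0)"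
    using assms by (intro sum.cong refl) (simp add: sum.If_cases Int_def)
  also have "\<dots> = (\<Sum>b\<in>B. \<Sum>a\<in>A. if R a b then 1 else 0)" by (rule sum.swap)
  also have "\<dots> = (\<Sum>b\<in>B. card {a \<in> A. R a b})"
    using assms by (intro sum.cong refl) (simp add: sum.If_cases Int_def)
  finally show ?thesis .
qed

text \<open>The neighbourhood N(v) of a random vertex is large in mean square, while a pair with few
  common neighbours lies in N(v) only for those few \<open>v\<close>. So |N(v)|^2 minus the number
  of bad pairs over \<epsilon> has a large mean, and one \<open>v\<close> serves both
  bounds.\<close>

lemma dependent_random_choice:
  fixes \<gamma> \<epsilon> :: real
  assumes A: "finite A" "A \<noteq> {}" and \<gamma>: "\<gamma> > 0" and \<epsilon>: "\<epsilon> > 0"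
    and E: "(\<Sum>v\<in>A. real (card {a \<in> A. R a v})) \<ge> \<gamma> * real (card A) ^ 2"
  obtains v where "v \<in> A" "real (card {a \<in> A. R a v}) \<ge> \<gamma> / 2 * real (card A)"
    "real (card {(a, b) \<in> {a \<in> A. R a v} \<times> {a \<in> A. R a v}.
        real (card {x \<in> A. R a x \<and> R b x}) < \<epsilon> * \<gamma>\<^sup>2 / 2 * real (card A)})
      \<le> \<epsilon> * real (card {a \<in> A. R a v}) ^ 2"
proof -
  define n where "n = real (card A)"
  define N where "N v = {a \<in> A. R a v}" for v
  define \<eta> where "\<eta> = \<epsilon> * \<gamma>\<^sup>2 / 2"
  define bad where "bad p \<longleftrightarrow> real (card {x \<in> A. R (fst p) x \<and> R (snd p) x}) < \<eta> * n" for p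
  define Bd where "Bd v = {p \<in> N v \<times> N v. bad p}" for v
  have n: "n > 0" using A by (simp add: n_def card_gt_0_iff)
  have finN: "finite (N v)" for v using A by (simp add: N_def)
  have "(\<gamma> * n\<^sup>2)\<^sup>2 \<le> (\<Sum>v\<in>A. real (card (N v)))\<^sup>2"
    using E \<gamma> unfolding N_def n_def by (intro power_mono) auto
  also have "\<dots> \<le> (\<Sum>v\<in>A. (real (card (N v)))\<^sup>2) * n"
    using Cauchy_Schwarz_ineq_sum[of "\<lambda>v. real (card (N v))" "\<lambda>_. 1" A] by (simp add: n_def)
  finally have "(\<gamma>\<^sup>2 * n ^ 3) * n \<le> (\<Sum>v\<in>A. (real (card (N v)))\<^sup>2) * n"
    by (simp add: power_mult_distrib eval_nat_numeral mult_ac)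
  then have 1: "\<gamma>\<^sup>2 * n ^ 3 \<le> (\<Sum>v\<in>A. (real (card (N v)))\<^sup>2)" using n by (simp add: mult_le_cancel_right)
  have "(\<Sum>v\<in>A. card (Bd v)) = (\<Sum>v\<in>A. card {p \<in> {p \<in> A \<times> A. bad p}. R (fst p) v \<and> R (snd p) v})"
    by (intro sum.cong refl arg_cong[of _ _ card]) (auto simp: Bd_def N_def)
  also have "\<dots> = (\<Sum>p\<in>{p \<in> A \<times> A. bad p}. card {v \<in> A. R (fst p) v \<and> R (snd p) v})"
    using A by (intro sum_card_swap) auto
  finally have "(\<Sum>v\<in>A. real (card (Bd v))) = (\<Sum>p\<in>{p \<in> A \<times> A. bad p}. real (card {v \<in> A. R (fst p) v \<and> R (snd p) v}))"
    by (metis (mono_tags, lifting) of_nat_sum sum.cong)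
  also have "\<dots> \<le> (\<Sum>p\<in>{p \<in> A \<times> A. bad p}. \<eta> * n)" by (intro sum_mono) (auto simp: bad_def)
  also have "\<dots> \<le> real (card (A \<times> A)) * (\<eta> * n)"
  proof -
    have "real (card {p \<in> A \<times> A. bad p}) \<le> real (card (A \<times> A))" using A by (intro of_nat_mono card_mono) auto
    then show ?thesis using n \<epsilon> \<gamma> by (simp add: mult_right_mono \<eta>_def)
  qed
  also have "\<dots> = \<eta> * n ^ 3" by (simp add: card_cartesian_product n_def eval_nat_numeral)
  finally have 2: "(\<Sum>v\<in>A. real (card (Bd v))) \<le> \<eta> * n ^ 3" .
  have "(\<Sum>v\<in>A. \<gamma>\<^sup>2 * n\<^sup>2 / 2) = \<gamma>\<^sup>2 * n ^ 3 - \<eta> * n ^ 3 / \<epsilon>"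
    using \<epsilon> by (simp add: n_def[symmetric] \<eta>_def field_simps eval_nat_numeral)
  also have "\<dots> \<le> (\<Sum>v\<in>A. (real (card (N v)))\<^sup>2) - (\<Sum>v\<in>A. real (card (Bd v))) / \<epsilon>"
    using 1 2 \<epsilon> by (intro diff_mono divide_right_mono) auto
  also have "\<dots> = (\<Sum>v\<in>A. (real (card (N v)))\<^sup>2 - real (card (Bd v)) / \<epsilon>)"
    by (simp add: sum_subtractf sum_divide_distrib)
  finally obtain v where v: "v \<in> A" "\<gamma>\<^sup>2 * n\<^sup>2 / 2 \<le> (real (card (N v)))\<^sup>2 - real (card (Bd v)) / \<epsilon>"
    using sum_strict_mono[of A "\<lambda>v. (real (card (N v)))\<^sup>2 - real (card (Bd v)) / \<epsilon>" "\<lambda>_. \<gamma>\<^sup>2 * n\<^sup>2 / 2"] A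
    by (meson leD not_le_imp_less)
  have "(\<gamma> / 2 * n)\<^sup>2 \<le> \<gamma>\<^sup>2 * n\<^sup>2 / 2" by (simp add: power_mult_distrib power_divide)
  also have "\<dots> \<le> (real (card (N v)))\<^sup>2 - real (card (Bd v)) / \<epsilon>" by (rule v)
  also have "\<dots> \<le> (real (card (N v)))\<^sup>2" using \<epsilon> by simp
  finally have a: "\<gamma> / 2 * n \<le> real (card (N v))" using power2_le_imp_le by fastforce
  have "real (card (Bd v)) / \<epsilon> \<le> (real (card (N v)))\<^sup>2"
    using v(2) by (smt (verit) divide_nonneg_nonneg mult_nonneg_nonneg zero_le_power2)
  then have b: "real (card (Bd v)) \<le> \<epsilon> * (real (card (N v)))\<^sup>2" using \<epsilon> by (simp add: field_simps)
  have "Bd v = {(a, b) \<in> {a \<in> A. R a v} \<times> {a \<in> A. R a v}.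
        real (card {x \<in> A. R a x \<and> R b x}) < \<epsilon> * \<gamma>\<^sup>2 / 2 * real (card A)}"
    by (auto simp: Bd_def N_def bad_def \<eta>_def n_def)
  then show ?thesis using that[OF v(1)] a b by (simp add: N_def n_def)
qed

definition diffset :: "'a::ab_group_add set \<Rightarrow> 'a set" where
  "diffset A = {a - b | a b. a \<in> A \<and> b \<in> A}"

lemma diffset_altdef: "diffset A = (\<lambda>(a, b). a - b) ` (A \<times> A)"
  by (auto simp: diffset_def image_iff)

lemma finite_diffset [simp]: "finite A \<Longrightarrow> finite (diffset A)"
  by (simp add: diffset_altdef)

lemma card_diff_fibre:
  "card {t \<in> A \<times> A. (\<lambda>(a, b). a - b) t = d} = rep A d"
  unfolding rep_def
  by (rule bij_betw_same_card[of fst], rule bij_betw_byWitness[where f' = "\<lambda>a. (a, a - d)"]) auto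

lemma rep_le_card: "finite A \<Longrightarrow> rep A d \<le> card A"
  unfolding rep_def by (intro card_mono) auto

lemma rep_pos_diffset: "rep A d > 0 \<Longrightarrow> d \<in> diffset A"
proof -
  assume "rep A d > 0"
  then have "{a \<in> A. a - d \<in> A} \<noteq> {}" unfolding rep_def by (metis card.empty less_irrefl)
  then obtain a where "a \<in> A" "a - d \<in> A" by auto
  moreover have "d = a - (a - d)" by simp
  ultimately show ?thesis unfolding diffset_def by blast
qed

text \<open>Join two points when their difference is popular. Any two points of A' have many common
  good partners b in \<open>U\<close>, and a - a' = (a - x) + (x - b) + (b - y) + (y - a') writes
  each difference as a sum of four popular ones in at least a constant times n^3 ways, whereas there
  are only O(n) popular differences, so O(n^4) such sums.\<close>

theorem balog_szemeredi_gowers: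
  fixes A :: "'a::ab_group_add set" and \<gamma> :: real
  assumes A: "finite A" "A \<noteq> {}" and \<gamma>: "0 < \<gamma>"
    and E: "2 * \<gamma> * real (card A) ^ 3 \<le> real (card (quads A 0))"
  obtains A' where "A' \<subseteq> A" "real (card A') \<ge> \<gamma> / 4 * real (card A)"
    "real (card (diffset A')) \<le> 4096 / \<gamma> ^ 9 * real (card A)"
proof -
  define n where "n = real (card A)"
  have n: "n > 0" using A by (simp add: n_def card_gt_0_iff)
  define R where "R a v \<longleftrightarrow> \<gamma> * n \<le> real (rep A (a - v))" for a v
  have "2 * (\<gamma> * n) * real (card (A \<times> A)) \<le> (\<Sum>p\<in>A \<times> A. real (rep A (fst p - snd p)))"
  proof -
    have "(\<Sum>p\<in>A \<times> A. real (rep A (fst p - snd p))) = real (\<Sum>a\<in>A. \<Sum>c\<in>A. rep A (a - c))"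
      by (simp add: sum.cartesian_product split_def)
    then show ?thesis using E unfolding sum_rep[OF A(1)]
      by (simp add: card_cartesian_product n_def eval_nat_numeral mult_ac)
  qed
  from popular_card[OF _ _ _ this, of n]
  have "\<gamma> * n * real (card (A \<times> A)) \<le> real (card {p \<in> A \<times> A. \<gamma> * n \<le> real (rep A (fst p - snd p))}) * n"
    using A \<gamma> n rep_le_card[OF A(1)] by (simp add: n_def)
  then have "(\<gamma> * n\<^sup>2) * n \<le> real (card {p \<in> A \<times> A. R (fst p) (snd p)}) * n"
    by (simp add: card_cartesian_product n_def[symmetric] R_def power2_eq_square mult_ac)
  then have "\<gamma> * n\<^sup>2 \<le> real (card {p \<in> A \<times> A. R (fst p) (snd p)})" using n by (simp add: mult_le_cancel_right)
  also have "card {p \<in> A \<times> A. R (fst p) (snd p)} = card (SIGMA v:A. {a \<in> A. R a v})"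
    by (rule bij_betw_same_card[of prod.swap], rule bij_betw_byWitness[where f' = prod.swap]) auto
  also have "\<dots> = (\<Sum>v\<in>A. card {a \<in> A. R a v})" using A by (simp add: card_SigmaI)
  finally have "\<gamma> * real (card A) ^ 2 \<le> (\<Sum>v\<in>A. real (card {a \<in> A. R a v}))" by (simp add: n_def)
  \<comment> \<open>With 1/16 at most u^2/16 pairs of \<open>U\<close> are bad, so at most u/4
    points have more than u/4 bad partners; once these are removed, any two points still share at
    least u/2 good partners.\<close>
  from dependent_random_choice[OF A \<gamma> _ this, of "1/16"]
  obtain v where v: "v \<in> A" "real (card {a \<in> A. R a v}) \<ge> \<gamma> / 2 * real (card A)"
    "real (card {(a, b) \<in> {a \<in> A. R a v} \<times> {a \<in> A. R a v}.
        real (card {x \<in> A. R a x \<and> R b x}) < 1/16 * \<gamma>\<^sup>2 / 2 * real (card A)})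
      \<le> 1/16 * real (card {a \<in> A. R a v}) ^ 2" by auto
  define U where "U = {a \<in> A. R a v}"
  define \<eta> where "\<eta> = \<gamma>\<^sup>2 / 32"
  define C where "C a b = {x \<in> A. R a x \<and> R b x}" for a b
  define bad where "bad a b \<longleftrightarrow> real (card (C a b)) < \<eta> * n" for a b
  have badsym: "bad a b = bad b a" for a b by (simp add: bad_def C_def conj_commute)
  define u where "u = real (card U)"
  have u: "u \<ge> \<gamma> / 2 * n" using v by (simp add: u_def U_def n_def)
  then have u0: "u > 0" using \<gamma> n by (smt (verit) mult_pos_pos divide_pos_pos)
  have finU: "finite U" and UA: "U \<subseteq> A" using A by (auto simp: U_def)
  have badU: "real (card {p \<in> U \<times> U. bad (fst p) (snd p)}) \<le> u\<^sup>2 / 16"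
  proof -
    have "{p \<in> U \<times> U. bad (fst p) (snd p)} = {(a, b) \<in> {a \<in> A. R a v} \<times> {a \<in> A. R a v}.
        real (card {x \<in> A. R a x \<and> R b x}) < 1/16 * \<gamma>\<^sup>2 / 2 * real (card A)}"
      by (auto simp: U_def bad_def C_def \<eta>_def n_def)
    then show ?thesis using v(3) by (simp add: u_def U_def)
  qed
  define A' where "A' = {a \<in> U. real (card {b \<in> U. bad a b}) \<le> u / 4}"
  have A'U: "A' \<subseteq> U" by (auto simp: A'_def)
  have "real (card (U - A')) * (u / 4) = (\<Sum>a\<in>U - A'. u / 4)" by simp
  also have "\<dots> \<le> (\<Sum>a\<in>U - A'. real (card {b \<in> U. bad a b}))" by (intro sum_mono) (auto simp: A'_def)
  also have "\<dots> \<le> (\<Sum>a\<in>U. real (card {b \<in> U. bad a b}))" using finU by (intro sum_mono2) auto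
  also have "\<dots> = real (card (SIGMA a:U. {b \<in> U. bad a b}))" using finU by (simp add: card_SigmaI)
  also have "(SIGMA a:U. {b \<in> U. bad a b}) = {p \<in> U \<times> U. bad (fst p) (snd p)}" by auto
  also have "real (card \<dots>) \<le> u\<^sup>2 / 16" by (rule badU)
  finally have "real (card (U - A')) \<le> u / 4" using u0 by (simp add: power2_eq_square field_simps)
  moreover have "card (U - A') = card U - card A'" "card A' \<le> card U"
    using A'U finU by (auto intro: card_Diff_subset card_mono finite_subset)
  ultimately have A'u: "real (card A') \<ge> u / 2" using u0 unfolding u_def by linarith
  define P where "P = {d \<in> diffset A. \<gamma> * n \<le> real (rep A d)}"
  have finP: "finite P" using A by (simp add: P_def)
  have RP: "a - x \<in> P" "x - a \<in> P" if "R a x" for a x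
  proof -
    have "real (rep A (a - x)) \<ge> \<gamma> * n" using that by (simp add: R_def)
    moreover have "rep A (x - a) = rep A (a - x)" using rep_uminus[of A "a - x"] by simp
    moreover have "\<gamma> * n > 0" using \<gamma> n by simp
    ultimately show "a - x \<in> P" "x - a \<in> P"
      using rep_pos_diffset[of A "a - x"] rep_pos_diffset[of A "x - a"] by (auto simp: P_def)
  qed
  have "real (card P) * (\<gamma> * n) \<le> real (card (A \<times> A))"
    by (rule card_mult_fibres_le[where s = "\<lambda>(a, b). a - b"]) (use A finP in \<open>auto simp only: card_diff_fibre finite_SigmaI P_def\<close>)
  then have "(real (card P) * \<gamma>) * n \<le> n * n" by (simp add: card_cartesian_product n_def mult_ac)
  then have "real (card P) * \<gamma> \<le> n" using n by (simp add: mult_le_cancel_right)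
  then have cP: "real (card P) \<le> n / \<gamma>" using \<gamma> by (simp add: field_simps)
  have "real (card (diffset A')) * ((u / 2) * (\<eta> * n)\<^sup>2) \<le> real (card (P \<times> P \<times> P \<times> P))"
  proof (rule card_mult_fibres_le[where s = "\<lambda>(p, q, r, t). p + q + r + t"])
    show "finite (P \<times> P \<times> P \<times> P)" "finite (diffset A')" using finP finite_subset[OF A'U finU] by auto
    fix d assume "d \<in> diffset A'"
    then obtain a a' where a: "a \<in> A'" "a' \<in> A'" and d: "d = a - a'" by (auto simp: diffset_def)
    define Gd where "Gd = {b \<in> U. \<not> bad a b \<and> \<not> bad a' b}"
    have "U \<subseteq> Gd \<union> ({b \<in> U. bad a b} \<union> {b \<in> U. bad a' b})" by (auto simp: Gd_def)
    then have "card U \<le> card (Gd \<union> ({b \<in> U. bad a b} \<union> {b \<in> U. bad a' b}))"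
      using finU by (intro card_mono) (auto simp: Gd_def)
    also have "\<dots> \<le> card Gd + (card {b \<in> U. bad a b} + card {b \<in> U. bad a' b})"
      by (meson card_Un_le add_left_mono order_trans)
    finally have Gd: "real (card Gd) \<ge> u / 2" using a unfolding A'_def u_def by (simp add: field_simps)
    define X where "X = (SIGMA b:Gd. C a b \<times> C a' b)"
    have finC: "finite (C a b)" for a b using A by (simp add: C_def)
    have finGd: "finite Gd" using finU by (simp add: Gd_def)
    have "(u / 2) * (\<eta> * n)\<^sup>2 \<le> real (card Gd) * (\<eta> * n)\<^sup>2" using Gd by (intro mult_right_mono) auto
    also have "\<dots> = (\<Sum>b\<in>Gd. (\<eta> * n) * (\<eta> * n))" by (simp add: power2_eq_square)
    also have "\<dots> \<le> (\<Sum>b\<in>Gd. real (card (C a b)) * real (card (C a' b)))"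
      using n \<gamma> by (intro sum_mono mult_mono) (auto simp: Gd_def bad_def \<eta>_def)
    also have "\<dots> = real (card X)" unfolding X_def using finGd finC by (simp add: card_SigmaI card_cartesian_product)
    also have "\<dots> \<le> real (card {t \<in> P \<times> P \<times> P \<times> P. (\<lambda>(p, q, r, t). p + q + r + t) t = d})"
    proof (intro of_nat_mono card_inj_on_le[where f = "\<lambda>(b, x, y). (a - x, x - b, b - y, y - a')"])
      show "inj_on (\<lambda>(b, x, y). (a - x, x - b, b - y, y - a')) X" by (auto simp: inj_on_def)
      show "(\<lambda>(b, x, y). (a - x, x - b, b - y, y - a')) ` X
         \<subseteq> {t \<in> P \<times> P \<times> P \<times> P. (\<lambda>(p, q, r, t). p + q + r + t) t = d}"
        by (auto simp: X_def C_def d intro: RP)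
      show "finite {t \<in> P \<times> P \<times> P \<times> P. (\<lambda>(p, q, r, t). p + q + r + t) t = d}" using finP by auto
    qed
    finally show "(u / 2) * (\<eta> * n)\<^sup>2 \<le> real (card {t \<in> P \<times> P \<times> P \<times> P. (\<lambda>(p, q, r, t). p + q + r + t) t = d})" .
  qed
  also have "\<dots> = real (card P) ^ 4" by (simp add: card_cartesian_product eval_nat_numeral)
  also have "\<dots> \<le> (n / \<gamma>) ^ 4" using cP by (intro power_mono) auto
  finally have 1: "real (card (diffset A')) * ((u / 2) * (\<eta> * n)\<^sup>2) \<le> (n / \<gamma>) ^ 4" .
  \<comment> \<open>4096 is 4 * 32^2, from u \<ge> \<gamma> n / 2 and \<eta> = \<gamma>^2 / 32; the
    bound n / \<gamma> for each of the four popular differences raises \<gamma>^5 to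
    \<gamma>^9.\<close>
  have "real (card (diffset A')) * (\<gamma> ^ 5 * n ^ 3 / 4096) \<le> real (card (diffset A')) * ((u / 2) * (\<eta> * n)\<^sup>2)"
  proof (intro mult_left_mono)
    have "\<gamma> ^ 5 * n ^ 3 / 4096 = ((\<gamma> / 2 * n) / 2) * (\<eta> * n)\<^sup>2"
      by (simp add: \<eta>_def eval_nat_numeral)
    also have "\<dots> \<le> (u / 2) * (\<eta> * n)\<^sup>2" using u by (intro mult_right_mono) auto
    finally show "\<gamma> ^ 5 * n ^ 3 / 4096 \<le> (u / 2) * (\<eta> * n)\<^sup>2" .
  qed auto
  with 1 have "real (card (diffset A')) * (\<gamma> ^ 5 * n ^ 3 / 4096) \<le> (n / \<gamma>) ^ 4" by linarith
  then have "(real (card (diffset A')) * \<gamma> ^ 9) * n ^ 3 \<le> (4096 * n) * n ^ 3"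
    using \<gamma> by (simp add: power_divide field_simps eval_nat_numeral)
  then have "real (card (diffset A')) * \<gamma> ^ 9 \<le> 4096 * n" using n by (simp add: mult_le_cancel_right)
  then have "real (card (diffset A')) \<le> 4096 / \<gamma> ^ 9 * n" using \<gamma> by (simp add: field_simps)
  moreover have "real (card A') \<ge> \<gamma> / 4 * n" using A'u u by simp
  ultimately show ?thesis using that[of A'] A'U UA by (auto simp: n_def)
qed

section \<open>Iterated sumsets of popular differences\<close>

primrec nsum :: "nat \<Rightarrow> 'a::ab_group_add set \<Rightarrow> 'a set" where
  "nsum 0 S = {0}"
| "nsum (Suc n) S = {x + s | x s. x \<in> nsum n S \<and> s \<in> S}"

lemma finite_nsum: "finite S \<Longrightarrow> finite (nsum n S)"
proof (induction n)
  case (Suc n)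
  have "nsum (Suc n) S = (\<lambda>(x, s). x + s) ` (nsum n S \<times> S)" by (auto simp: image_iff)
  then show ?case using Suc by (metis finite_SigmaI finite_imageI)
qed auto

lemma nsum_add: "x \<in> nsum m S \<Longrightarrow> y \<in> nsum n S \<Longrightarrow> x + y \<in> nsum (m + n) S"
proof (induction n arbitrary: y)
  case (Suc n)
  then obtain y' s where "y = y' + s" "y' \<in> nsum n S" "s \<in> S" by auto
  then show ?case using Suc by (auto simp: add.assoc[symmetric])
qed auto

lemma nsum_uminus:
  assumes "\<And>s. s \<in> S \<Longrightarrow> - s \<in> S"
  shows "x \<in> nsum n S \<Longrightarrow> - x \<in> nsum n S"
proof (induction n arbitrary: x)
  case (Suc n)
  then obtain y s where "x = y + s" "y \<in> nsum n S" "s \<in> S" by auto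
  moreover from this have "- x = - y + (- s)" by simp
  ultimately show ?case using Suc.IH assms unfolding nsum.simps by blast
qed auto

lemma nsum_1: "s \<in> S \<Longrightarrow> s \<in> nsum 1 S" by simp

text \<open>Replacing s by x - (x - s), in any of its many representations, splits a + t + s - a'
  into an element of A + nS - A and one of A - A; so each further summand from \<open>S\<close>
  enlarges A + nS - A by a factor of at most 2 K^2. For the last claim, unpopular differences
  account for at most half of the pairs of \<open>A\<close>, hence some translate of
  \<open>S\<close> contains half of \<open>A\<close>.\<close>

lemma popular_differences_sumset:
  fixes A :: "'a::ab_group_add set" and K :: real
  assumes A: "finite A" "A \<noteq> {}" and K: "K > 0" "real (card (diffset A)) \<le> K * real (card A)"
  defines "S \<equiv> {d. real (rep A d) \<ge> real (card A) / (2 * K)}"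
  shows "finite S" "real (card (nsum n S)) \<le> K * (2 * K\<^sup>2) ^ n * real (card A)"
    "\<exists>a0\<in>A. real (card {a \<in> A. a - a0 \<in> S}) \<ge> real (card A) / 2"
proof -
  define m where "m = real (card A)"
  have m: "m > 0" using A by (simp add: m_def card_gt_0_iff)
  have SD: "S \<subseteq> diffset A"
  proof
    fix d assume "d \<in> S"
    then have "real (rep A d) \<ge> m / (2 * K)" by (simp add: S_def m_def)
    then have "rep A d > 0" using m K by (smt (verit) divide_pos_pos of_nat_0_less_iff mult_pos_pos)
    then show "d \<in> diffset A" by (rule rep_pos_diffset)
  qed
  then show finS: "finite S" using A finite_subset by fastforce
  define T where "T n = {a + t - a' | a t a'. a \<in> A \<and> a' \<in> A \<and> t \<in> nsum n S}" for n
  have finT: "finite (T n)" for n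
  proof -
    have "T n = (\<lambda>(a, t, a'). a + t - a') ` (A \<times> nsum n S \<times> A)" by (force simp: T_def image_iff)
    then show ?thesis using A finite_nsum[OF finS] by simp
  qed
  have T0: "T 0 = diffset A" by (auto simp: T_def diffset_def)
  have step: "real (card (T (Suc n))) \<le> (2 * K\<^sup>2) * real (card (T n))" for n
  proof -
    have "real (card (T (Suc n))) * (m / (2 * K)) \<le> real (card (T n \<times> T 0))"
    proof (rule card_mult_fibres_le[where s = "\<lambda>(x, y). x + y"])
      show "finite (T n \<times> T 0)" "finite (T (Suc n))" using finT by auto
      fix z assume "z \<in> T (Suc n)"
      then obtain a t s a' where z: "z = a + (t + s) - a'" "a \<in> A" "a' \<in> A" "t \<in> nsum n S" "s \<in> S"
        by (auto simp: T_def)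
      have "m / (2 * K) \<le> real (rep A s)" using z by (simp add: S_def m_def)
      also have "\<dots> = real (card {x \<in> A. x - s \<in> A})" by (simp add: rep_def)
      also have "\<dots> \<le> real (card {t \<in> T n \<times> T 0. (\<lambda>(x, y). x + y) t = z})"
      proof (intro of_nat_mono card_inj_on_le[where f = "\<lambda>x. (a + t - (x - s), x - a')"])
        show "inj_on (\<lambda>x. (a + t - (x - s), x - a')) {x \<in> A. x - s \<in> A}" by (auto simp: inj_on_def)
        show "(\<lambda>x. (a + t - (x - s), x - a')) ` {x \<in> A. x - s \<in> A}
           \<subseteq> {t \<in> T n \<times> T 0. (\<lambda>(x, y). x + y) t = z}"
        proof (rule image_subsetI)
          fix x assume "x \<in> {x \<in> A. x - s \<in> A}"
          then have "a + t - (x - s) \<in> T n" "x - a' \<in> T 0"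
            using z unfolding T0 unfolding T_def diffset_def by blast+
          then show "(a + t - (x - s), x - a') \<in> {t \<in> T n \<times> T 0. (\<lambda>(x, y). x + y) t = z}"
            by (simp add: z(1))
        qed
        show "finite {t \<in> T n \<times> T 0. (\<lambda>(x, y). x + y) t = z}" using finT by auto
      qed
      finally show "m / (2 * K) \<le> real (card {t \<in> T n \<times> T 0. (\<lambda>(x, y). x + y) t = z})" .
    qed
    also have "\<dots> = real (card (T n)) * real (card (diffset A))" by (simp add: card_cartesian_product T0)
    also have "\<dots> \<le> real (card (T n)) * (K * m)" using K by (intro mult_left_mono) (auto simp: m_def)
    finally show ?thesis using m K by (simp add: field_simps power2_eq_square)
  qed
  have Tn: "real (card (T n)) \<le> K * (2 * K\<^sup>2) ^ n * m" for n
  proof (induction n)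
    case 0 then show ?case using K by (simp add: T0 m_def)
  next
    case (Suc n)
    have "real (card (T (Suc n))) \<le> (2 * K\<^sup>2) * real (card (T n))" by (rule step)
    also have "\<dots> \<le> (2 * K\<^sup>2) * (K * (2 * K\<^sup>2) ^ n * m)" using Suc by (intro mult_left_mono) auto
    finally show ?case by (simp add: mult_ac)
  qed
  obtain b where b: "b \<in> A" using A by blast
  have "nsum n S \<subseteq> T n"
  proof
    fix t assume "t \<in> nsum n S"
    moreover have "t = b + t - b" by simp
    ultimately show "t \<in> T n" using b unfolding T_def by blast
  qed
  then have "card (nsum n S) \<le> card (T n)" using finT by (intro card_mono)
  then show "real (card (nsum n S)) \<le> K * (2 * K\<^sup>2) ^ n * real (card A)" using Tn[of n] by (simp add: m_def)
  show "\<exists>a0\<in>A. real (card {a \<in> A. a - a0 \<in> S}) \<ge> real (card A) / 2"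
  proof (rule ccontr)
    assume "\<not> ?thesis"
    then have lt: "\<And>a0. a0 \<in> A \<Longrightarrow> real (card {a \<in> A. a - a0 \<in> S}) < m / 2" by (auto simp: m_def not_le)
    have "real (card (A \<times> A)) = (\<Sum>d\<in>diffset A. real (rep A d))"
    proof -
      have "A \<times> A = (\<Union>d\<in>diffset A. {t \<in> A \<times> A. (\<lambda>(a, b). a - b) t = d})" by (auto simp: diffset_altdef)
      moreover have "card (\<Union>d\<in>diffset A. {t \<in> A \<times> A. (\<lambda>(a, b). a - b) t = d})
        = (\<Sum>d\<in>diffset A. card {t \<in> A \<times> A. (\<lambda>(a, b). a - b) t = d})"
        using A by (intro card_UN_disjoint) auto
      ultimately show ?thesis by (simp add: card_diff_fibre)
    qed
    also have "\<dots> = (\<Sum>d\<in>S. real (rep A d)) + (\<Sum>d\<in>diffset A - S. real (rep A d))"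
      using SD A by (simp add: sum.subset_diff add.commute)
    also have "(\<Sum>d\<in>diffset A - S. real (rep A d)) \<le> (\<Sum>d\<in>diffset A - S. m / (2 * K))"
      by (intro sum_mono) (auto simp: S_def m_def)
    also have "(\<Sum>d\<in>diffset A - S. m / (2 * K)) \<le> real (card (diffset A)) * (m / (2 * K))"
      using A m K by (auto intro!: divide_right_mono mult_right_mono card_mono)
    also have "\<dots> \<le> (K * m) * (m / (2 * K))" using K m by (intro mult_right_mono) (auto simp: m_def)
    also have "\<dots> = m\<^sup>2 / 2" using K by (simp add: power2_eq_square)
    also have "(\<Sum>d\<in>S. real (rep A d)) = (\<Sum>a0\<in>A. real (card {a \<in> A. a - a0 \<in> S}))"
    proof -
      have "(\<Sum>d\<in>S. rep A d) = card (\<Union>d\<in>S. {t \<in> A \<times> A. (\<lambda>(a, b). a - b) t = d})"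
        unfolding card_diff_fibre[symmetric] using A finS by (intro card_UN_disjoint[symmetric]) auto
      also have "\<dots> = card (SIGMA a0:A. {a \<in> A. a - a0 \<in> S})"
        by (rule bij_betw_same_card[of prod.swap], rule bij_betw_byWitness[where f' = prod.swap]) auto
      also have "\<dots> = (\<Sum>a0\<in>A. card {a \<in> A. a - a0 \<in> S})" using A by (simp add: card_SigmaI)
      finally have "real (\<Sum>d\<in>S. rep A d) = real (\<Sum>a0\<in>A. card {a \<in> A. a - a0 \<in> S})" by simp
      then show ?thesis by simp
    qed
    also have "(\<Sum>a0\<in>A. real (card {a \<in> A. a - a0 \<in> S})) < (\<Sum>a0\<in>A. m / 2)"
      using A lt by (intro sum_strict_mono) auto
    finally show False by (simp add: card_cartesian_product m_def power2_eq_square)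
  qed
qed

section \<open>Freiman homomorphisms on graphs\<close>

definition nd :: "real \<Rightarrow> real" where "nd x = \<bar>x - of_int (round x)\<bar>"

lemma nd_le: "nd x \<le> \<bar>x - of_int m\<bar>"
  unfolding nd_def by (rule round_diff_minimal)
lemma nd_nonneg [simp]: "nd x \<ge> 0" by (simp add: nd_def)
lemma nd_0 [simp]: "nd 0 = 0" by (simp add: nd_def)
lemma nd_add: "nd (x + y) \<le> nd x + nd y"
  using nd_le[of "x + y" "round x + round y"] unfolding nd_def[of x] nd_def[of y] by simp
lemma nd_minus [simp]: "nd (- x) = nd x"
proof -
  have "nd (- x) \<le> nd x" for x using nd_le[of "- x" "- round x"] unfolding nd_def[of x] by simp
  from this[of x] this[of "- x"] show ?thesis by simp
qed
lemma round_unique_nd: "\<bar>x - of_int m\<bar> < 1/2 \<Longrightarrow> round x = m"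
  by (rule round_unique') simp

lemma norm_e_diff_1: "cmod (e t - 1) \<le> 2 * pi * \<bar>t\<bar>"
proof -
  have "(cmod (e t - 1))\<^sup>2 = (cos (2 * pi * t) - 1)\<^sup>2 + (sin (2 * pi * t))\<^sup>2"
    by (simp add: e_def cmod_def)
  also have "\<dots> = 2 - 2 * cos (2 * pi * t)"
    using sin_cos_squared_add[of "2 * pi * t"] by (simp add: power2_eq_square algebra_simps)
  also have "cos (2 * pi * t) = 1 - 2 * (sin (pi * t))\<^sup>2"
    using cos_double_sin[of "pi * t"] by (simp add: mult.assoc)
  also have "2 - 2 * (1 - 2 * (sin (pi * t))\<^sup>2) = (2 * \<bar>sin (pi * t)\<bar>)\<^sup>2" by (simp add: power_mult_distrib)
  also have "\<dots> \<le> (2 * \<bar>pi * t\<bar>)\<^sup>2"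
    using abs_sin_x_le_abs_x[of "pi * t"] by (intro power_mono) auto
  also have "\<dots> = (2 * pi * \<bar>t\<bar>)\<^sup>2" by (simp add: abs_mult mult.assoc)
  finally show ?thesis by (rule power2_le_imp_le) simp
qed

lemma e_round: "e x = e (x - of_int (round x))"
  using e_add_int[of "x - of_int (round x)" "round x"] by simp

text \<open>The average over \<open>x\<close> of a Fejer kernel at \<open>k x\<close> is small for each nonzero \<open>k\<close>, so some
  \<open>x\<close> keeps all the \<open>k x\<close> away from the integers simultaneously.\<close>
lemma separating_frequency:
  fixes K :: "int set" and L :: nat
  assumes K: "finite K" "0 \<notin> K" and L: "4 * card K < L"
  obtains x :: real where "\<And>k. k \<in> K \<Longrightarrow> nd (of_int k * x) > 1 / (16 * real L)"
proof -
  \<comment> \<open>Beyond all L |k|, the modulus makes the multiples of \<open>k\<close> distinct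
    residues, so Parseval gives the exact mean \<open>L\<close> of each kernel.\<close>
  obtain P :: int where P: "P > 0" "\<And>k. k \<in> K \<Longrightarrow> int L * \<bar>k\<bar> < P"
  proof
    define P where "P = (\<Sum>k\<in>K. int L * \<bar>k\<bar>) + 1"
    show "P > 0" by (simp add: P_def sum_nonneg add_nonneg_pos)
    fix k assume "k \<in> K"
    then have "int L * \<bar>k\<bar> \<le> (\<Sum>k\<in>K. int L * \<bar>k\<bar>)" using K by (intro member_le_sum) auto
    then show "int L * \<bar>k\<bar> < P" by (simp add: P_def)
  qed
  define F where "F k j = (cmod (\<Sum>y\<in>(\<lambda>l. l * k) ` {0..<int L}. chr P j y))\<^sup>2" for k j
  have F: "(\<Sum>j\<in>{0..<P}. F k j) = of_int P * real L" if k: "k \<in> K" for k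
  proof -
    have k0: "k \<noteq> 0" using k K by auto
    have "inj_on (\<lambda>x. x mod P) ((\<lambda>l. l * k) ` {0..<int L})"
    proof (rule inj_onI; elim imageE; hypsubst)
      fix l l' assume l: "l \<in> {0..<int L}" "l' \<in> {0..<int L}" and eq: "l * k mod P = l' * k mod P"
      have "P dvd (l - l') * k" using eq by (simp add: mod_eq_dvd_iff left_diff_distrib)
      moreover have "\<bar>(l - l') * k\<bar> < P"
      proof -
        have "\<bar>(l - l') * k\<bar> \<le> int L * \<bar>k\<bar>" unfolding abs_mult using l by (intro mult_right_mono) auto
        then show ?thesis using P(2)[OF k] by linarith
      qed
      ultimately have "(l - l') * k = 0" using P(1) dvd_imp_le_int[of "(l - l') * k" P] by linarith
      then show "l * k = l' * k" using k0 by simp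
    qed
    moreover have "card ((\<lambda>l. l * k) ` {0..<int L}) = L" using k0 by (subst card_image) (auto simp: inj_on_def)
    ultimately show ?thesis unfolding F_def using parseval[OF P(1), of "(\<lambda>l. l * k) ` {0..<int L}" "\<lambda>_. 1"] by simp
  qed
  have "\<exists>j\<in>{0..<P}. (\<Sum>k\<in>K. F k j) \<le> real L * real (card K)"
  proof (rule ccontr)
    assume "\<not> ?thesis"
    then have "(\<Sum>j\<in>{0..<P}. real L * real (card K)) < (\<Sum>j\<in>{0..<P}. \<Sum>k\<in>K. F k j)"
      using P by (intro sum_strict_mono) (auto simp: not_le)
    also have "\<dots> = (\<Sum>k\<in>K. \<Sum>j\<in>{0..<P}. F k j)" by (rule sum.swap)
    also have "\<dots> = (\<Sum>k\<in>K. of_int P * real L)" using F by simp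
    finally show False using P by simp
  qed
  then obtain j where j: "(\<Sum>k\<in>K. F k j) \<le> real L * real (card K)" by auto
  show ?thesis
  proof (rule that[of "of_int j / of_int P"])
    fix k assume k: "k \<in> K"
    have L0: "L > 0" and k0: "k \<noteq> 0" using L k K by auto
    define x where "x = real_of_int k * (of_int j / of_int P)"
    show "nd (of_int k * (of_int j / of_int P)) > 1 / (16 * real L)"
    proof (rule ccontr)
      assume "\<not> ?thesis"
      then have small: "nd x \<le> 1 / (16 * real L)" by (simp add: x_def)
      have chr: "chr P j (l * k) = e (of_int l * x)" for l by (simp add: chr_def x_def algebra_simps)
      have S: "(\<Sum>y\<in>(\<lambda>l. l * k) ` {0..<int L}. chr P j y) = (\<Sum>l\<in>{0..<int L}. e (of_int l * x))"
        using k0 by (subst sum.reindex) (auto simp: inj_on_def chr)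
      have "cmod (of_nat L - (\<Sum>l\<in>{0..<int L}. e (of_int l * x))) = cmod (\<Sum>l\<in>{0..<int L}. (1 - e (of_int l * x)))"
        by (simp add: sum_subtractf)
      also have "\<dots> \<le> (\<Sum>l\<in>{0..<int L}. 1/2)"
      proof (rule sum_norm_le)
        fix l assume l: "l \<in> {0..<int L}"
        define \<delta> where "\<delta> = x - of_int (round x)"
        have "real_of_int l * x = of_int l * \<delta> + of_int (l * round x)" by (simp add: \<delta>_def algebra_simps)
        then have "e (of_int l * x) = e (of_int l * \<delta>)" by (metis e_add_int)
        then have "cmod (1 - e (of_int l * x)) \<le> 2 * pi * \<bar>of_int l * \<delta>\<bar>"
          using norm_e_diff_1[of "of_int l * \<delta>"] by (simp add: norm_minus_commute)
        also have "\<bar>of_int l * \<delta>\<bar> = of_int l * nd x" using l by (simp add: \<delta>_def nd_def abs_mult)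
        also have "2 * pi * (of_int l * nd x) \<le> 2 * pi * (real L * (1 / (16 * real L)))"
          using l small by (intro mult_left_mono mult_mono) auto
        \<comment> \<open>2 \<pi> / 16 is below 1/2: if k x were this close to an integer, all
          \<open>L\<close> terms of the kernel would lie within 1/2 of 1, and the kernel would be at
          least L^2/4.\<close>
        also have "\<dots> \<le> 1/2" using L0 pi_less_4 by simp
        finally show "cmod (1 - e (of_int l * x)) \<le> 1/2" .
      qed
      also have "\<dots> = real L / 2" by simp
      finally have "real L / 2 \<le> cmod (\<Sum>l\<in>{0..<int L}. e (of_int l * x))"
        using norm_triangle_ineq2[of "of_nat L" "\<Sum>l\<in>{0..<int L}. e (of_int l * x)"] by simp
      then have "(real L / 2)\<^sup>2 \<le> F k j" unfolding F_def S by (intro power_mono) auto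
      also have "\<dots> \<le> (\<Sum>k\<in>K. F k j)" using k K by (intro member_le_sum) (auto simp: F_def)
      also have "\<dots> \<le> real L * real (card K)" by (rule j)
      finally have "real L * real L \<le> real L * (4 * real (card K))" by (simp add: power2_eq_square)
      then show False using L L0 by (simp add: mult_le_cancel_left)
    qed
  qed
qed

lemma nsum_mono: "S \<subseteq> T \<Longrightarrow> nsum n S \<subseteq> nsum n T"
  by (induction n) (simp, simp only: nsum.simps, blast)

lemma diffset_mono: "A \<subseteq> B \<Longrightarrow> diffset A \<subseteq> diffset B"
  by (auto simp: diffset_def)

lemma nsum_nsum: "(\<And>d. d \<in> D \<Longrightarrow> d \<in> nsum m S) \<Longrightarrow> x \<in> nsum n D \<Longrightarrow> x \<in> nsum (n * m) S"
proof (induction n arbitrary: x)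
  case (Suc n)
  then obtain y d where "x = y + d" "y \<in> nsum n D" "d \<in> D" by auto
  then show ?case using nsum_add[of y "n * m" S d m] Suc by (simp add: add.commute)
qed auto

lemma pigeonhole_fibre:
  fixes cell :: "'a \<Rightarrow> int"
  assumes "finite A" "q > 0" "\<And>a. a \<in> A \<Longrightarrow> cell a \<in> {0..<int q}"
  obtains c where "real (card A) \<le> real q * real (card {a \<in> A. cell a = c})"
proof -
  have "A = (\<Union>c\<in>{0..<int q}. {a \<in> A. cell a = c})" using assms by auto
  then have "card A \<le> (\<Sum>c\<in>{0..<int q}. card {a \<in> A. cell a = c})"
    using card_UN_le[of "{0..<int q}" "\<lambda>c. {a \<in> A. cell a = c}"] by simp
  then have 1: "real (card A) \<le> (\<Sum>c\<in>{0..<int q}. real (card {a \<in> A. cell a = c}))"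
    by (metis of_nat_le_iff of_nat_sum)
  obtain c where c: "\<forall>l\<in>{0..<int q}. real (card {a \<in> A. cell a = l}) \<le> real (card {a \<in> A. cell a = c})"
    using ex_argmax[of "{0..<int q}" "\<lambda>c. real (card {a \<in> A. cell a = c})"] assms(2) by auto
  have "(\<Sum>l\<in>{0..<int q}. real (card {a \<in> A. cell a = l})) \<le> (\<Sum>l\<in>{0..<int q}. real (card {a \<in> A. cell a = c}))"
    using c by (intro sum_mono) auto
  with 1 have "real (card A) \<le> real q * real (card {a \<in> A. cell a = c})" by simp
  then show ?thesis by (rule that)
qed

lemma frac_cell_nd:
  assumes q: "q > 0" and "\<lfloor>frac u * real q\<rfloor> = \<lfloor>frac v * real q\<rfloor>"
  shows "nd (u - v) \<le> 1 / real q"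
proof -
  have "\<bar>frac u * real q - frac v * real q\<bar> \<le> 1" using assms by linarith
  then have "\<bar>frac u - frac v\<bar> * real q \<le> 1" by (simp add: left_diff_distrib[symmetric] abs_mult)
  then have "\<bar>frac u - frac v\<bar> \<le> 1 / real q" using q by (simp add: field_simps)
  moreover have "nd (u - v) \<le> \<bar>(u - v) - of_int (\<lfloor>u\<rfloor> - \<lfloor>v\<rfloor>)\<bar>" by (rule nd_le)
  moreover have "(u - v) - of_int (\<lfloor>u\<rfloor> - \<lfloor>v\<rfloor>) = frac u - frac v" by (simp add: frac_def)
  ultimately show ?thesis by simp
qed

lemma frac_cell_range: "q > 0 \<Longrightarrow> \<lfloor>frac u * real q\<rfloor> \<in> {0..<int q}"
  using frac_lt_1[of u] frac_ge_0[of u] by (auto simp: floor_less_iff mult_less_cancel_right2)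

text \<open>A point of 6(A2 - A2) above 0 can be added to any point of A2 - a0, and since A2 is a
  graph the results are distinct points of 13S; so there are boundedly many such points. A frequency
  \<open>x\<close> separates the nonzero ones from 0, and keeping only points whose second
  coordinate times \<open>x\<close> lies in one short arc makes all of 6(A3 - A3) nearly integral
  along \<open>x\<close>, which leaves only 0. Six summands are what additivity of the extension
  will use.\<close>

theorem freiman_homomorphism_on_dense_subset:
  fixes \<gamma> :: real
  assumes \<gamma>: "0 < \<gamma>"
  shows "\<exists>c>0. \<forall>A :: (int \<times> int) set. finite A \<longrightarrow> A \<noteq> {} \<longrightarrow> inj_on fst A \<longrightarrow>
    2 * \<gamma> * real (card A) ^ 3 \<le> real (card (quads A 0)) \<longrightarrow>
    (\<exists>A'\<subseteq>A. real (card A') \<ge> c * real (card A) \<and> (\<forall>x\<in>nsum 6 (diffset A'). fst x = 0 \<longrightarrow> snd x = 0))"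
proof -
  \<comment> \<open>\<open>K\<close> is (4096 / \<gamma>^9) / (\<gamma> / 4), the doubling of the
    set from \<open>balog_szemeredi_gowers\<close>. \<open>Q\<close> bounds the fibre above 0, where
    13 = 6 * 2 + 1 and the 2 is the passage to half of that set. q = 6 * 16 L matches six arcs of
    length 1/q with the separation 1/(16 L).\<close>
  define K where "K = 16384 / \<gamma> ^ 10"
  have K0: "K > 0" using \<gamma> by (simp add: K_def)
  define Q where "Q = 2 * K * (2 * K\<^sup>2) ^ 13"
  define L where "L = nat \<lceil>4 * Q\<rceil> + 1"
  have L: "real L > 4 * Q" unfolding L_def by linarith
  define q where "q = 96 * L"
  have q0: "q > 0" by (simp add: q_def L_def)
  define c where "c = \<gamma> / (8 * real q)"
  show ?thesis
  proof (intro exI[of _ c] conjI allI impI)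
    show "c > 0" using \<gamma> q0 by (simp add: c_def)
    fix A :: "(int \<times> int) set"
    assume A: "finite A" "A \<noteq> {}" and inj: "inj_on fst A"
      and E: "2 * \<gamma> * real (card A) ^ 3 \<le> real (card (quads A 0))"
    define n where "n = real (card A)"
    have n: "n > 0" using A by (simp add: n_def card_gt_0_iff)
    obtain A1 where A1: "A1 \<subseteq> A" "real (card A1) \<ge> \<gamma> / 4 * n" "real (card (diffset A1)) \<le> 4096 / \<gamma> ^ 9 * n"
      using balog_szemeredi_gowers[OF A \<gamma> E] by (auto simp: n_def)
    have finA1: "finite A1" using A A1 finite_subset by blast
    have "\<gamma> / 4 * n > 0" using \<gamma> n by simp
    then have A1pos: "card A1 > 0" using A1(2) by linarith
    then have A1ne: "A1 \<noteq> {}" by auto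
    have dK: "real (card (diffset A1)) \<le> K * real (card A1)"
    proof -
      have "4096 / \<gamma> ^ 9 * n = K * (\<gamma> / 4 * n)" using \<gamma> by (simp add: K_def field_simps eval_nat_numeral)
      also have "\<dots> \<le> K * real (card A1)" using K0 A1 by (intro mult_left_mono) auto
      finally show ?thesis using A1 by linarith
    qed
    define S where "S = {d. real (rep A1 d) \<ge> real (card A1) / (2 * K)}"
    note S = popular_differences_sumset[OF finA1 A1ne K0 dK, folded S_def]
    obtain a0 where a0: "a0 \<in> A1" "real (card {a \<in> A1. a - a0 \<in> S}) \<ge> real (card A1) / 2" using S(3) by blast
    have Ssym: "- s \<in> S" if "s \<in> S" for s using that by (simp add: S_def rep_uminus)
    define A2 where "A2 = {a \<in> A1. a - a0 \<in> S}"
    have finA2: "finite A2" and A2A: "A2 \<subseteq> A" using finA1 A1 by (auto simp: A2_def)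
    have A2card: "real (card A2) \<ge> real (card A1) / 2" using a0 by (simp add: A2_def)
    then have A2pos: "real (card A2) > 0" using A1pos by linarith
    have d2: "d \<in> nsum 2 S" if "d \<in> diffset A2" for d
    proof -
      obtain a b where "d = a - b" "a \<in> A2" "b \<in> A2" using \<open>d \<in> diffset A2\<close> by (auto simp: diffset_def)
      then have "d = (a - a0) + (- (b - a0))" "a - a0 \<in> S" "- (b - a0) \<in> S"
        using Ssym[of "b - a0"] by (auto simp: A2_def)
      then show ?thesis using nsum_add[of "a - a0" 1 S "- (b - a0)" 1] nsum_1 by (metis one_add_one)
    qed
    define Kf where "Kf = {v. (0, v) \<in> nsum 6 (diffset A2)}"
    have finKf: "finite Kf"
    proof -
      have "Kf \<subseteq> snd ` nsum 6 (diffset A2)" by (force simp: Kf_def)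
      then show ?thesis using finite_nsum[of "diffset A2" 6] finA2 finite_surj by auto
    qed
    have "card (Kf \<times> A2) \<le> card (nsum 13 S)"
    proof (rule card_inj_on_le[where f = "\<lambda>(v, a). (0, v) + (a - a0)"])
      show "inj_on (\<lambda>(v, a). (0, v) + (a - a0)) (Kf \<times> A2)"
      proof (rule inj_onI; clarify)
        fix v a v' a' assume a: "(a :: int \<times> int) \<in> A2" "a' \<in> A2"
          and eq: "(0::int, v::int) + (a - a0) = (0, v') + (a' - a0)"
        have "fst a = fst a'" using arg_cong[OF eq, of fst] by simp
        then have "a = a'" using inj A2A a by (meson inj_onD subsetD)
        then show "v = v' \<and> a = a'" using arg_cong[OF eq, of snd] by simp
      qed
      show "(\<lambda>(v, a). (0, v) + (a - a0)) ` (Kf \<times> A2) \<subseteq> nsum 13 S"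
      proof (rule image_subsetI)
        fix z assume "z \<in> Kf \<times> A2"
        then obtain v a where z: "z = (v, a)" and v: "v \<in> Kf" and a: "a \<in> A2" by blast
        have 1: "(0, v) \<in> nsum (6 * 2) S" using nsum_nsum[of "diffset A2" 2 S "(0, v)" 6, OF d2] v by (simp add: Kf_def)
        have 2: "a - a0 \<in> nsum 1 S" using a by (intro nsum_1) (simp add: A2_def)
        have "6 * 2 + 1 = (13::nat)" by simp
        with nsum_add[OF 1 2] show "(\<lambda>(v, a). (0, v) + (a - a0)) z \<in> nsum 13 S"
          unfolding z prod.case by (simp only:)
      qed
      show "finite (nsum 13 S)" using S(1) finite_nsum by blast
    qed
    then have "real (card Kf) * real (card A2) \<le> real (card (nsum 13 S))"
      by (metis card_cartesian_product of_nat_le_iff of_nat_mult)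
    also have "\<dots> \<le> K * (2 * K\<^sup>2) ^ 13 * real (card A1)" by (rule S(2))
    also have "\<dots> \<le> K * (2 * K\<^sup>2) ^ 13 * (2 * real (card A2))" using A2card K0 by (intro mult_left_mono) auto
    also have "\<dots> = Q * real (card A2)" by (simp add: Q_def)
    finally have KfQ: "real (card Kf) \<le> Q" using A2pos by (simp add: mult_le_cancel_right)
    have "card (Kf - {0}) \<le> card Kf" using finKf by (intro card_mono) auto
    then have "4 * real (card (Kf - {0})) < real L" using KfQ L by linarith
    then have "4 * card (Kf - {0}) < L" by linarith
    then obtain x where x: "\<And>k. k \<in> Kf - {0} \<Longrightarrow> nd (of_int k * x) > 1 / (16 * real L)"
      using separating_frequency[of "Kf - {0}" L] finKf by auto
    define cell where "cell a = \<lfloor>frac (of_int (snd a) * x) * real q\<rfloor>" for a :: "int \<times> int"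
    obtain c0 where c0: "real (card A2) \<le> real q * real (card {a \<in> A2. cell a = c0})"
      using pigeonhole_fibre[OF finA2 q0, of cell] frac_cell_range[OF q0] unfolding cell_def by auto
    define A3 where "A3 = {a \<in> A2. cell a = c0}"
    have A32: "A3 \<subseteq> A2" by (auto simp: A3_def)
    have small: "nd (of_int (snd z) * x) \<le> real m / real q" if "z \<in> nsum m (diffset A3)" for m z
      using that
    proof (induction m arbitrary: z)
      case (Suc m)
      then obtain y d where z: "z = y + d" "y \<in> nsum m (diffset A3)" "d \<in> diffset A3" by auto
      then obtain a b where d: "d = a - b" "a \<in> A3" "b \<in> A3" by (auto simp: diffset_def)
      have "nd (of_int (snd d) * x) \<le> 1 / real q"
        using frac_cell_nd[OF q0, of "of_int (snd a) * x" "of_int (snd b) * x"] d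
        by (simp add: A3_def cell_def left_diff_distrib)
      moreover have "nd (of_int (snd y) * x) \<le> real m / real q" using Suc z by auto
      moreover have "nd (of_int (snd z) * x) \<le> nd (of_int (snd y) * x) + nd (of_int (snd d) * x)"
        unfolding z(1) using nd_add[of "of_int (snd y) * x" "of_int (snd d) * x"] by (simp add: distrib_right)
      ultimately show ?case by (simp add: add_divide_distrib)
    qed auto
    show "\<exists>A'\<subseteq>A. real (card A') \<ge> c * real (card A) \<and> (\<forall>x\<in>nsum 6 (diffset A'). fst x = 0 \<longrightarrow> snd x = 0)"
    proof (intro exI[of _ A3] conjI ballI impI)
      show "A3 \<subseteq> A" using A32 A2A by blast
      have "\<gamma> / 8 * n \<le> real q * real (card A3)" using c0 A2card A1(2) by (simp add: A3_def)
      then show "c * real (card A) \<le> real (card A3)" using q0 by (simp add: c_def n_def field_simps)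
      fix z assume z: "z \<in> nsum 6 (diffset A3)" "fst z = 0"
      have "z \<in> nsum 6 (diffset A2)" using z nsum_mono[OF diffset_mono[OF A32]] by blast
      then have "snd z \<in> Kf" using z(2) by (simp add: Kf_def prod_eq_iff) (metis prod.collapse)
      moreover have "nd (of_int (snd z) * x) \<le> 6 / real q" using small[OF z(1)] by simp
      moreover have "6 / real q = 1 / (16 * real L)" by (simp add: q_def)
      ultimately show "snd z = 0" using x[of "snd z"] by fastforce
    qed
  qed
qed

section \<open>Bohr sets and the Bogolyubov lemma\<close>

text \<open>Length and frequencies are combined in one even subadditive gauge, so every passage
  between radii is a single triangle inequality and a Bohr set automatically lies in an
  interval.\<close>

definition bnorm :: "real set \<Rightarrow> real \<Rightarrow> int \<Rightarrow> real" where
  "bnorm \<Theta> L n = \<bar>of_int n\<bar> / L + (\<Sum>\<theta>\<in>\<Theta>. nd (\<theta> * of_int n))"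

definition bohr :: "real set \<Rightarrow> real \<Rightarrow> real \<Rightarrow> int set" where
  "bohr \<Theta> L \<rho> = {n. bnorm \<Theta> L n \<le> \<rho>}"

lemma bnorm_0 [simp]: "bnorm \<Theta> L 0 = 0" by (simp add: bnorm_def)

lemma bnorm_minus [simp]: "bnorm \<Theta> L (- n) = bnorm \<Theta> L n" by (simp add: bnorm_def)

lemma bnorm_nonneg: "L > 0 \<Longrightarrow> bnorm \<Theta> L n \<ge> 0"
  by (auto simp: bnorm_def intro!: add_nonneg_nonneg sum_nonneg)

lemma bnorm_add: assumes "L > 0" shows "bnorm \<Theta> L (m + n) \<le> bnorm \<Theta> L m + bnorm \<Theta> L n"
proof -
  have "\<bar>of_int (m + n)\<bar> / L \<le> \<bar>of_int m\<bar> / L + \<bar>of_int n\<bar> / L"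
    using assms by (simp add: add_divide_distrib[symmetric] divide_right_mono abs_triangle_ineq)
  moreover have "(\<Sum>\<theta>\<in>\<Theta>. nd (\<theta> * of_int (m + n))) \<le> (\<Sum>\<theta>\<in>\<Theta>. nd (\<theta> * of_int m) + nd (\<theta> * of_int n))"
    by (intro sum_mono) (simp add: distrib_left nd_add)
  ultimately show ?thesis by (simp add: bnorm_def sum.distrib)
qed

lemma bnorm_diff: "L > 0 \<Longrightarrow> bnorm \<Theta> L (m - n) \<le> bnorm \<Theta> L m + bnorm \<Theta> L n"
  using bnorm_add[of L \<Theta> m "- n"] by simp

lemma abs_le_bnorm: "L > 0 \<Longrightarrow> \<bar>of_int n\<bar> \<le> L * bnorm \<Theta> L n"
  by (simp add: bnorm_def distrib_left sum_nonneg)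

lemma nd_le_bnorm: "L > 0 \<Longrightarrow> finite \<Theta> \<Longrightarrow> \<theta> \<in> \<Theta> \<Longrightarrow> nd (\<theta> * of_int n) \<le> bnorm \<Theta> L n"
  unfolding bnorm_def by (rule add_increasing) (auto intro: member_le_sum)

lemma bnorm_mono: "finite \<Theta>' \<Longrightarrow> \<Theta> \<subseteq> \<Theta>' \<Longrightarrow> bnorm \<Theta> L n \<le> bnorm \<Theta>' L n"
  unfolding bnorm_def by (intro add_mono sum_mono2) auto

lemma bohr_subset_interval: "L > 0 \<Longrightarrow> bohr \<Theta> L \<rho> \<subseteq> {- \<lfloor>L * \<rho>\<rfloor>..\<lfloor>L * \<rho>\<rfloor>}"
proof
  fix n assume L: "L > 0" and n: "n \<in> bohr \<Theta> L \<rho>"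
  have "\<bar>real_of_int n\<bar> \<le> L * bnorm \<Theta> L n" by (rule abs_le_bnorm[OF L])
  also have "\<dots> \<le> L * \<rho>" using L n by (simp add: bohr_def)
  finally have "\<bar>n\<bar> \<le> \<lfloor>L * \<rho>\<rfloor>" by (simp add: le_floor_iff)
  then show "n \<in> {- \<lfloor>L * \<rho>\<rfloor>..\<lfloor>L * \<rho>\<rfloor>}" by auto
qed

lemma finite_bohr: "L > 0 \<Longrightarrow> finite (bohr \<Theta> L \<rho>)"
  by (rule finite_subset[OF bohr_subset_interval]) auto

lemma simultaneous_pigeonhole:
  fixes X :: "int set"
  assumes "finite \<Theta>" "finite X" and q: "q > 0"
  shows "\<exists>Y\<subseteq>X. real (card X) \<le> real q ^ card \<Theta> * real (card Y) \<and>
    (\<forall>x\<in>Y. \<forall>y\<in>Y. \<forall>\<theta>\<in>\<Theta>. nd (\<theta> * of_int (x - y)) \<le> 1 / real q)"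
  using assms(1)
proof (induction \<Theta> rule: finite_induct)
  case empty
  show ?case by (intro exI[of _ X]) auto
next
  case (insert \<theta> \<Theta>)
  then obtain Y where Y: "Y \<subseteq> X" "real (card X) \<le> real q ^ card \<Theta> * real (card Y)"
    "\<forall>x\<in>Y. \<forall>y\<in>Y. \<forall>\<theta>\<in>\<Theta>. nd (\<theta> * of_int (x - y)) \<le> 1 / real q" by blast
  have finY: "finite Y" using Y assms finite_subset by blast
  define cell where "cell n = \<lfloor>frac (\<theta> * of_int n) * real q\<rfloor>" for n :: int
  obtain c where c: "real (card Y) \<le> real q * real (card {y \<in> Y. cell y = c})"
    using pigeonhole_fibre[OF finY q, of cell] frac_cell_range[OF q] unfolding cell_def by auto
  have "real (card X) \<le> real q ^ card \<Theta> * (real q * real (card {y \<in> Y. cell y = c}))"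
    using Y(2) c by (meson mult_left_mono order_trans zero_le_power of_nat_0_le_iff)
  moreover have "nd (\<theta> * of_int (x - y)) \<le> 1 / real q" if "cell x = c" "cell y = c" for x y
    using frac_cell_nd[OF q, of "\<theta> * of_int x" "\<theta> * of_int y"] that
    by (simp add: cell_def right_diff_distrib)
  ultimately show ?case using Y insert
    by (intro exI[of _ "{y \<in> Y. cell y = c}"]) (auto simp: mult_ac)
qed

text \<open>Half of the radius is spent on the length and half on the frequencies: some box of side
  1/q, with q about 2d/\<rho>, holds a positive proportion of an interval of length \<rho> L / 2,
  and the differences from one of its points lie in the Bohr set. The constant depends on \<Theta>
  only through \<open>d\<close>.\<close>

lemma bohr_card_lower:
  fixes d :: nat and \<rho> :: real
  assumes \<rho>: "\<rho> > 0"
  shows "\<exists>c>0. \<forall>\<Theta> L. finite \<Theta> \<longrightarrow> card \<Theta> \<le> d \<longrightarrow> L > 0 \<longrightarrow> real (card (bohr \<Theta> L \<rho>)) \<ge> c * L"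
proof -
  define q where "q = nat \<lceil>2 * real d / \<rho>\<rceil> + 1"
  have q0: "q > 0" by (simp add: q_def)
  have q: "real d / real q \<le> \<rho> / 2"
  proof -
    have "real q \<ge> 2 * real d / \<rho>" unfolding q_def by linarith
    then have "2 * real d \<le> \<rho> * real q" using \<rho> by (simp add: field_simps)
    then show ?thesis using q0 by (simp add: field_simps)
  qed
  define c where "c = \<rho> / (2 * real q ^ d)"
  show ?thesis
  proof (intro exI[of _ c] conjI allI impI)
    show "c > 0" using \<rho> q0 by (simp add: c_def)
    fix \<Theta> :: "real set" and L :: real assume \<Theta>: "finite \<Theta>" "card \<Theta> \<le> d" and L: "L > 0"
    define X where "X = {0..\<lfloor>\<rho> * L / 2\<rfloor>}"
    obtain Y where Y: "Y \<subseteq> X" "real (card X) \<le> real q ^ card \<Theta> * real (card Y)"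
      "\<forall>x\<in>Y. \<forall>y\<in>Y. \<forall>\<theta>\<in>\<Theta>. nd (\<theta> * of_int (x - y)) \<le> 1 / real q"
      using simultaneous_pigeonhole[OF \<Theta>(1) _ q0, of X] by (auto simp: X_def)
    have X0: "0 \<le> \<rho> * L / 2" using \<rho> L by simp
    have cX: "real (card X) \<ge> \<rho> * L / 2" unfolding X_def using X0 by simp
    have "\<rho> * L / 2 \<le> real q ^ d * real (card Y)"
    proof -
      have "real q ^ card \<Theta> \<le> real q ^ d" using \<Theta> q0 by (intro power_increasing) auto
      then show ?thesis using Y(2) cX by (meson mult_right_mono of_nat_0_le_iff order_trans)
    qed
    then have cY: "c * L \<le> real (card Y)" using q0 by (simp add: c_def field_simps)
    have "real (card Y) > 0" using cY L \<open>c > 0\<close> by (smt (verit) mult_pos_pos)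
    then obtain y where y: "y \<in> Y" by (metis card.empty of_nat_0 less_irrefl ex_in_conv)
    have "card Y \<le> card (bohr \<Theta> L \<rho>)"
    proof (rule card_inj_on_le[where f = "\<lambda>x. x - y"])
      show "inj_on (\<lambda>x. x - y) Y" by (auto simp: inj_on_def)
      show "finite (bohr \<Theta> L \<rho>)" by (rule finite_bohr[OF L])
      show "(\<lambda>x. x - y) ` Y \<subseteq> bohr \<Theta> L \<rho>"
      proof (rule image_subsetI)
        fix x assume x: "x \<in> Y"
        have "x \<in> X" "y \<in> X" using x y Y by auto
        then have "\<bar>x - y\<bar> \<le> \<lfloor>\<rho> * L / 2\<rfloor>" unfolding X_def by auto
        then have "\<bar>real_of_int (x - y)\<bar> \<le> \<rho> * L / 2" by (simp add: le_floor_iff)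
        then have "\<bar>real_of_int (x - y)\<bar> / L \<le> \<rho> / 2" using L by (simp add: field_simps)
        moreover have "(\<Sum>\<theta>\<in>\<Theta>. nd (\<theta> * of_int (x - y))) \<le> (\<Sum>\<theta>\<in>\<Theta>. 1 / real q)"
          using Y(3) x y by (intro sum_mono) auto
        moreover have "(\<Sum>\<theta>\<in>\<Theta>. 1 / real q) \<le> real d / real q" using \<Theta> q0 by (simp add: divide_right_mono)
        ultimately show "x - y \<in> bohr \<Theta> L \<rho>" unfolding bohr_def bnorm_def mem_Collect_eq using q by linarith
      qed
    qed
    then show "c * L \<le> real (card (bohr \<Theta> L \<rho>))" using cY by linarith
  qed
qed

section \<open>Bogolyubov's lemma by Fourier analysis\<close>

lemma Re_e_nonneg: assumes "nd t \<le> 1/4" shows "Re (e t) \<ge> 0"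
proof -
  have "Re (e t) = cos (2 * pi * (t - of_int (round t)))" by (subst e_round) (simp add: e_def)
  also have "\<dots> \<ge> 0"
  proof (rule cos_ge_zero)
    have "\<bar>t - of_int (round t)\<bar> \<le> 1/4" using assms by (simp add: nd_def)
    then have "- (1/4) \<le> t - of_int (round t)" "t - of_int (round t) \<le> 1/4" by linarith+
    then have "2 * pi * (- (1/4)) \<le> 2 * pi * (t - of_int (round t))" "2 * pi * (t - of_int (round t)) \<le> 2 * pi * (1/4)"
      by (intro mult_left_mono; simp)+
    then show "- (pi / 2) \<le> 2 * pi * (t - of_int (round t))" "2 * pi * (t - of_int (round t)) \<le> pi / 2" by auto
  qed
  finally show ?thesis .
qed

text \<open>\<Theta> is the large spectrum of \<open>W\<close>, whose size Parseval bounds. If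
  \<open>n\<close> had no such representation, the sum of |S(k)|^4 e(- k n / P) over all k would
  vanish; but k = 0 contributes t^4, the other large frequencies have nonnegative real part because
  \<open>n\<close> is within 1/4 of an integer along them, and the rest is small by
  Parseval.\<close>

lemma bogolyubov:
  fixes W :: "int set" and L :: int and c :: real
  assumes L: "L > 0" and W: "W \<subseteq> {- L..L}" and c: "c > 0" "real (card W) \<ge> c * of_int L"
  obtains \<Theta> :: "real set" where "finite \<Theta>" "real (card \<Theta>) \<le> 128 / c\<^sup>2"
    "\<forall>n. \<bar>n\<bar> \<le> L \<longrightarrow> (\<forall>\<theta>\<in>\<Theta>. nd (\<theta> * of_int n) \<le> 1/4)
       \<longrightarrow> (\<exists>w1\<in>W. \<exists>w2\<in>W. \<exists>w3\<in>W. \<exists>w4\<in>W. n = w1 + w2 - w3 - w4)"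
proof -
  have finW: "finite W" using W finite_subset by blast
  \<comment> \<open>Every w1 + w2 - w3 - w4 - n is at most 5 L in size, so congruences mod 8 L are
    equalities.\<close>
  define P where "P = 8 * L"
  have P: "P > 0" using L by (simp add: P_def)
  define t where "t = real (card W)"
  have t: "t > 0" using c L unfolding t_def by (smt (verit) mult_pos_pos of_int_0_less_iff)
  define S where "S k = (\<Sum>w\<in>W. chr P k w)" for k
  \<comment> \<open>Chosen so that \<epsilon> P = c L / 2 is at most t / 2, half of the main term;
    the resulting bound 128 / c^2 for the spectrum is 8 * 16 / c^2.\<close>
  define \<epsilon> where "\<epsilon> = c / 16"
  define Spec where "Spec = {k \<in> {0..<P}. (cmod (S k))\<^sup>2 \<ge> \<epsilon> * t\<^sup>2}"
  have finS: "finite Spec" by (rule finite_subset[of _ "{0..<P}"]) (auto simp: Spec_def)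
  have inj: "inj_on (\<lambda>x. x mod P) W"
  proof (rule inj_onI)
    fix x y assume xy: "x \<in> W" "y \<in> W" and eq: "x mod P = y mod P"
    have "P dvd x - y" using eq by (simp add: mod_eq_dvd_iff)
    moreover have "\<bar>x - y\<bar> < P" using subsetD[OF W xy(1)] subsetD[OF W xy(2)] L by (auto simp: P_def)
    ultimately show "x = y" using dvd_imp_le_int[of "x - y" P] P by linarith
  qed
  have pars: "(\<Sum>k\<in>{0..<P}. (cmod (S k))\<^sup>2) = of_int P * t"
    using parseval[OF P finW inj, of "\<lambda>_. 1"] by (simp add: S_def t_def)
  have "real (card Spec) * (\<epsilon> * t\<^sup>2) = (\<Sum>k\<in>Spec. \<epsilon> * t\<^sup>2)" by simp
  also have "\<dots> \<le> (\<Sum>k\<in>Spec. (cmod (S k))\<^sup>2)" by (intro sum_mono) (auto simp: Spec_def)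
  also have "\<dots> \<le> (\<Sum>k\<in>{0..<P}. (cmod (S k))\<^sup>2)" by (intro sum_mono2) (auto simp: Spec_def)
  finally have "(real (card Spec) * (\<epsilon> * t)) * t \<le> of_int P * t" using pars by (simp add: power2_eq_square mult_ac)
  then have "real (card Spec) * (\<epsilon> * t) \<le> of_int P" using t by (simp add: mult_le_cancel_right)
  moreover have "real (card Spec) * (\<epsilon> * (c * of_int L)) \<le> real (card Spec) * (\<epsilon> * t)"
    using c by (intro mult_left_mono) (auto simp: \<epsilon>_def t_def)
  ultimately have "real (card Spec) * (\<epsilon> * (c * of_int L)) \<le> 8 * of_int L" by (simp add: P_def)
  then have cS: "real (card Spec) \<le> 128 / c\<^sup>2" using c L by (simp add: \<epsilon>_def field_simps power2_eq_square)
  have \<epsilon>P: "\<epsilon> * of_int P < t"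
  proof -
    have "\<epsilon> * of_int P = c * of_int L / 2" by (simp add: \<epsilon>_def P_def)
    also have "\<dots> \<le> t / 2" using c by (simp add: t_def)
    also have "\<dots> < t" using t by simp
    finally show ?thesis .
  qed
  define \<Theta> where "\<Theta> = (\<lambda>k. real_of_int k / of_int P) ` Spec"
  show ?thesis
  proof (rule that[of \<Theta>]; (intro allI impI)?)
    show "finite \<Theta>" using finS by (simp add: \<Theta>_def)
    show "real (card \<Theta>) \<le> 128 / c\<^sup>2" using card_image_le[OF finS, of "\<lambda>k. real_of_int k / of_int P"] cS
      unfolding \<Theta>_def by linarith
    fix n :: int assume n: "\<bar>n\<bar> \<le> L" and nd: "\<forall>\<theta>\<in>\<Theta>. nd (\<theta> * of_int n) \<le> 1/4"
    show "\<exists>w1\<in>W. \<exists>w2\<in>W. \<exists>w3\<in>W. \<exists>w4\<in>W. n = w1 + w2 - w3 - w4"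
    proof (rule ccontr)
      assume no: "\<not> ?thesis"
      have S2: "S k ^ 2 = (\<Sum>p\<in>W \<times> W. chr P k (fst p + snd p))" for k
        unfolding S_def power2_eq_square sum_product sum.cartesian_product
        by (intro sum.cong refl) (auto simp: chr_add)
      have "(\<Sum>k\<in>{0..<P}. complex_of_real (cmod (S k) ^ 4) * chr P k (- n))
         = (\<Sum>k\<in>{0..<P}. \<Sum>p\<in>W\<times>W. \<Sum>p'\<in>W\<times>W. chr P k (fst p + snd p - (fst p' + snd p') - n))"
      proof (intro sum.cong refl)
        fix k
        have "complex_of_real (cmod (S k) ^ 4) = complex_of_real ((cmod (S k ^ 2))\<^sup>2)"
          by (simp add: norm_power power_mult[symmetric])
        also have "\<dots> = (\<Sum>p\<in>W\<times>W. \<Sum>p'\<in>W\<times>W. chr P k (fst p + snd p - (fst p' + snd p')))"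
          unfolding S2 cmod_sum_sq by (simp only: chr_diff)
        finally show "complex_of_real (cmod (S k) ^ 4) * chr P k (- n) = (\<Sum>p\<in>W\<times>W. \<Sum>p'\<in>W\<times>W. chr P k (fst p + snd p - (fst p' + snd p') - n))"
          by (simp only: sum_distrib_right chr_add[symmetric]) simp
      qed
      also have "\<dots> = (\<Sum>p\<in>W\<times>W. \<Sum>k\<in>{0..<P}. \<Sum>p'\<in>W\<times>W. chr P k (fst p + snd p - (fst p' + snd p') - n))"
        by (rule sum.swap)
      also have "\<dots> = (\<Sum>p\<in>W\<times>W. \<Sum>p'\<in>W\<times>W. \<Sum>k\<in>{0..<P}. chr P k (fst p + snd p - (fst p' + snd p') - n))"
        by (intro sum.cong refl sum.swap)
      also have "\<dots> = 0"
      proof (rule sum.neutral, rule ballI, rule sum.neutral, rule ballI)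
        fix p p' assume p: "p \<in> W \<times> W" "p' \<in> W \<times> W"
        define z where "z = fst p + snd p - (fst p' + snd p') - n"
        have "z \<noteq> 0" using no p unfolding z_def by (cases p; cases p') (simp, force)
        moreover have "\<bar>z\<bar> < P"
        proof -
          have "fst p \<in> {- L..L}" "snd p \<in> {- L..L}" "fst p' \<in> {- L..L}" "snd p' \<in> {- L..L}" using p W by auto
          then show ?thesis using n L unfolding z_def P_def by auto
        qed
        ultimately have "\<not> P dvd z" using dvd_imp_le_int[of z P] P by linarith
        then show "(\<Sum>k\<in>{0..<P}. chr P k (fst p + snd p - (fst p' + snd p') - n)) = 0"
          using sum_chr[OF P, of z] by (simp add: z_def)
      qed
      finally have z: "(\<Sum>k\<in>{0..<P}. complex_of_real (cmod (S k) ^ 4) * chr P k (- n)) = 0" .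
      have Reterm: "Re (complex_of_real (cmod (S k) ^ 4) * chr P k (- n)) = cmod (S k) ^ 4 * Re (chr P k (- n))" for k
        by (simp del: of_real_power)
      have "0 = (\<Sum>k\<in>{0..<P}. cmod (S k) ^ 4 * Re (chr P k (- n)))"
        using arg_cong[OF z, of Re] by (simp only: Re_sum Reterm zero_complex.sel)
      also have "\<dots> \<ge> (\<Sum>k\<in>{0..<P}. (if k = 0 then t ^ 4 else 0) - \<epsilon> * t\<^sup>2 * (cmod (S k))\<^sup>2)"
      proof (intro sum_mono)
        fix k assume k: "k \<in> {0..<P}"
        have S4: "cmod (S k) ^ 4 = (cmod (S k))\<^sup>2 * (cmod (S k))\<^sup>2" by (simp add: power_add[symmetric])
        have \<epsilon>t: "\<epsilon> * t\<^sup>2 * (cmod (S k))\<^sup>2 \<ge> 0" using c by (simp add: \<epsilon>_def)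
        show "(if k = 0 then t ^ 4 else 0) - \<epsilon> * t\<^sup>2 * (cmod (S k))\<^sup>2 \<le> cmod (S k) ^ 4 * Re (chr P k (- n))"
        proof (cases "k = 0")
          case True
          then have "cmod (S k) = t" by (simp add: S_def t_def)
          then show ?thesis using True \<epsilon>t by simp
        next
          case False
          show ?thesis
          proof (cases "k \<in> Spec")
            case True
            then have "nd (of_int k / of_int P * of_int n) \<le> 1/4" using nd by (auto simp: \<Theta>_def)
            then have "nd (of_int (k * (- n)) / of_int P) \<le> 1/4"
              using nd_minus[of "of_int k / of_int P * of_int n"] by simp
            then have "Re (chr P k (- n)) \<ge> 0" unfolding chr_def by (rule Re_e_nonneg)
            then have "cmod (S k) ^ 4 * Re (chr P k (- n)) \<ge> 0" by simp
            then show ?thesis using \<epsilon>t False by simp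
          next
            case nS: False
            then have "(cmod (S k))\<^sup>2 \<le> \<epsilon> * t\<^sup>2" using k by (auto simp: Spec_def)
            then have "cmod (S k) ^ 4 \<le> \<epsilon> * t\<^sup>2 * (cmod (S k))\<^sup>2" unfolding S4 by (intro mult_right_mono) auto
            moreover have "cmod (S k) ^ 4 * Re (chr P k (- n)) \<ge> cmod (S k) ^ 4 * (- 1)"
              using abs_Re_le_cmod[of "chr P k (- n)"] by (intro mult_left_mono) auto
            ultimately show ?thesis using False by simp
          qed
        qed
      qed
      also have "(\<Sum>k\<in>{0..<P}. (if k = 0 then t ^ 4 else 0) - \<epsilon> * t\<^sup>2 * (cmod (S k))\<^sup>2)
         = t ^ 4 - \<epsilon> * t\<^sup>2 * (of_int P * t)"
        using P by (simp add: sum_subtractf sum_distrib_left[symmetric] pars)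
      also have "\<dots> = t ^ 3 * (t - \<epsilon> * of_int P)" by (simp add: eval_nat_numeral algebra_simps)
      finally show False using \<epsilon>P t by (smt (verit) mult_pos_pos zero_less_power)
    qed
  qed
qed

section \<open>Locally additive functions are bracket linear\<close>

text \<open>Gaussian elimination with pivots of maximal absolute value keeps the coefficients bounded.\<close>
lemma bounded_spanning_subset:
  fixes E :: "'i \<Rightarrow> 'j \<Rightarrow> real"
  assumes "finite J" "finite I"
  shows "\<exists>V \<gamma>. V \<subseteq> I \<and> card V \<le> card J \<and> (\<forall>n\<in>I.
     (\<forall>j\<in>J. E n j = (\<Sum>v\<in>V. (\<Sum>l\<in>J. \<gamma> v l * E n l) * E v j)) \<and>
     (\<Sum>v\<in>V. \<bar>\<Sum>l\<in>J. \<gamma> v l * E n l\<bar>) \<le> 2 ^ card J - 1)"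
  using assms(1)
proof (induction J arbitrary: E rule: finite_induct)
  case empty
  show ?case by (intro exI[of _ "{}"]) auto
next
  case (insert j0 J)
  show ?case
  proof (cases "\<forall>n\<in>I. E n j0 = 0")
    case True
    from insert.IH[of E] obtain V \<gamma> where V: "V \<subseteq> I" "card V \<le> card J"
      "\<And>n j. n \<in> I \<Longrightarrow> j \<in> J \<Longrightarrow> E n j = (\<Sum>v\<in>V. (\<Sum>l\<in>J. \<gamma> v l * E n l) * E v j)"
      "\<And>n. n \<in> I \<Longrightarrow> (\<Sum>v\<in>V. \<bar>\<Sum>l\<in>J. \<gamma> v l * E n l\<bar>) \<le> 2 ^ card J - 1" by blast
    have ins: "(\<Sum>l\<in>insert j0 J. \<gamma> v l * E n l) = (\<Sum>l\<in>J. \<gamma> v l * E n l)" if "n \<in> I" for v n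
      using insert True that by simp
    show ?thesis
    proof (intro exI[of _ V] exI[of _ \<gamma>] conjI ballI)
      show "card V \<le> card (insert j0 J)" using V insert by simp
      fix n assume n: "n \<in> I"
      have "(2::real) ^ card J \<le> 2 ^ card (insert j0 J)" using insert by simp
      then show "(\<Sum>v\<in>V. \<bar>\<Sum>l\<in>insert j0 J. \<gamma> v l * E n l\<bar>) \<le> 2 ^ card (insert j0 J) - 1"
        using V(4)[OF n] unfolding ins[OF n] by linarith
      fix j assume "j \<in> insert j0 J"
      then show "E n j = (\<Sum>v\<in>V. (\<Sum>l\<in>insert j0 J. \<gamma> v l * E n l) * E v j)"
      proof
        assume "j = j0"
        have "E v j0 = 0" if "v \<in> V" for v using V that True by auto
        then have "(\<Sum>v\<in>V. (\<Sum>l\<in>insert j0 J. \<gamma> v l * E n l) * E v j0) = 0" by (intro sum.neutral) auto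
        then show ?thesis using \<open>j = j0\<close> True n by simp
      next
        assume "j \<in> J"
        then show ?thesis unfolding ins[OF n] using V(3) n by simp
      qed
    qed (use V in auto)
  next
    case False
    then have "I \<noteq> {}" by auto
    then obtain n0 where n0: "n0 \<in> I" "\<And>n. n \<in> I \<Longrightarrow> \<bar>E n j0\<bar> \<le> \<bar>E n0 j0\<bar>"
      using ex_argmax[OF assms(2), of "\<lambda>n. \<bar>E n j0\<bar>"] by auto
    define p where "p = E n0 j0"
    have p0: "p \<noteq> 0" using False n0 unfolding p_def by fastforce
    define a where "a n = E n j0 / p" for n
    have a1: "\<bar>a n\<bar> \<le> 1" if "n \<in> I" for n using n0(2)[OF that] p0 by (simp add: a_def p_def)
    define E' where "E' n j = E n j - a n * E n0 j" for n j
    from insert.IH[of E'] obtain V' \<gamma>' where V': "V' \<subseteq> I" "card V' \<le> card J"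
      "\<And>n j. n \<in> I \<Longrightarrow> j \<in> J \<Longrightarrow> E' n j = (\<Sum>v\<in>V'. (\<Sum>l\<in>J. \<gamma>' v l * E' n l) * E' v j)"
      "\<And>n. n \<in> I \<Longrightarrow> (\<Sum>v\<in>V'. \<bar>\<Sum>l\<in>J. \<gamma>' v l * E' n l\<bar>) \<le> 2 ^ card J - 1" by blast
    have finV': "finite V'" using V' assms finite_subset by blast
    define c' where "c' v n = (\<Sum>l\<in>J. \<gamma>' v l * E' n l)" for v n
    \<comment> \<open>The functional \<gamma>' acts on the row after elimination. Rewritten for the
      original row, the subtracted multiple of the pivot row is charged to the column
      \<open>j0\<close>.\<close>
    define g where "g v l = (if l = j0 then - (\<Sum>m\<in>J. \<gamma>' v m * E n0 m) / p else \<gamma>' v l)" for v l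
    have g: "(\<Sum>l\<in>insert j0 J. g v l * E n l) = c' v n" for v n
    proof -
      have "(\<Sum>l\<in>insert j0 J. g v l * E n l) = - (\<Sum>m\<in>J. \<gamma>' v m * E n0 m) / p * E n j0 + (\<Sum>l\<in>J. g v l * E n l)"
        using insert by (simp add: g_def)
      also have "(\<Sum>l\<in>J. g v l * E n l) = (\<Sum>l\<in>J. \<gamma>' v l * E n l)"
        using insert by (intro sum.cong) (auto simp: g_def)
      also have "- (\<Sum>m\<in>J. \<gamma>' v m * E n0 m) / p * E n j0 + \<dots> = (\<Sum>l\<in>J. \<gamma>' v l * E n l) - a n * (\<Sum>m\<in>J. \<gamma>' v m * E n0 m)"
        by (simp add: a_def)
      also have "\<dots> = c' v n" by (simp add: c'_def E'_def right_diff_distrib sum_subtractf sum_distrib_left mult_ac)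
      finally show ?thesis .
    qed
    define V where "V = insert n0 V'"
    \<comment> \<open>The pivot point \<open>n0\<close> may already lie in V', so the two
      contributions are added rather than given by disjoint cases. The coefficients stay linear
      functionals of the row, which later makes \<Phi> a linear combination of the
      coordinates.\<close>
    define \<gamma> where "\<gamma> v l = (if v \<in> V' then g v l else 0) +
       (if v = n0 then (if l = j0 then 1 / p else 0) - (\<Sum>u\<in>V'. g u l * a u) else 0)" for v l
    define b where "b n = a n - (\<Sum>u\<in>V'. c' u n * a u)" for n
    have coef: "(\<Sum>l\<in>insert j0 J. \<gamma> v l * E n l) = (if v \<in> V' then c' v n else 0) + (if v = n0 then b n else 0)" for v n
    proof -
      have "(\<Sum>l\<in>insert j0 J. ((if l = j0 then 1 / p else 0) - (\<Sum>u\<in>V'. g u l * a u)) * E n l) = b n"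
      proof -
        have "(\<Sum>l\<in>insert j0 J. ((if l = j0 then 1 / p else 0) - (\<Sum>u\<in>V'. g u l * a u)) * E n l)
          = (\<Sum>l\<in>insert j0 J. (if l = j0 then E n l / p else 0)) - (\<Sum>l\<in>insert j0 J. \<Sum>u\<in>V'. (g u l * E n l) * a u)"
          by (simp only: left_diff_distrib sum_subtractf sum_distrib_right)
             (auto intro!: arg_cong2[of _ _ _ _ "(-)"] sum.cong simp: mult_ac)
        also have "(\<Sum>l\<in>insert j0 J. \<Sum>u\<in>V'. (g u l * E n l) * a u) = (\<Sum>u\<in>V'. (\<Sum>l\<in>insert j0 J. g u l * E n l) * a u)"
          by (subst sum.swap) (simp only: sum_distrib_right)
        also have "\<dots> = (\<Sum>u\<in>V'. c' u n * a u)" by (simp only: g)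
        also have "(\<Sum>l\<in>insert j0 J. (if l = j0 then E n l / p else 0)) = a n"
          using insert by (simp add: a_def)
        finally show ?thesis by (simp add: b_def)
      qed
      then show ?thesis using g[of v n] by (cases "v = n0") (simp_all add: \<gamma>_def distrib_right sum.distrib)
    qed
    have sumV: "(\<Sum>v\<in>V. ((if v \<in> V' then f v else 0) + (if v = n0 then z else 0)) * h v) = (\<Sum>v\<in>V'. f v * h v) + z * h n0"
      for f h :: "'i \<Rightarrow> real" and z
    proof -
      have "(\<Sum>v\<in>V. (if v \<in> V' then f v else 0) * h v) = (\<Sum>v\<in>V'. f v * h v)"
        by (rule sum.mono_neutral_cong_right) (use finV' in \<open>auto simp: V_def\<close>)
      moreover have "(\<Sum>v\<in>V. (if v = n0 then z else 0) * h v) = z * h n0"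
      proof -
        have "(\<Sum>v\<in>V. (if v = n0 then z else 0) * h v) = (\<Sum>v\<in>V. if v = n0 then z * h v else 0)"
          by (intro sum.cong) auto
        then show ?thesis using finV' by (simp add: V_def)
      qed
      ultimately show ?thesis by (simp only: distrib_right sum.distrib)
    qed
    show ?thesis
    proof (intro exI[of _ V] exI[of _ \<gamma>] conjI ballI)
      show "V \<subseteq> I" using V' n0 by (auto simp: V_def)
      show "card V \<le> card (insert j0 J)"
      proof -
        have "card V \<le> Suc (card V')" unfolding V_def by (rule card_insert_le_m1) auto
        also have "\<dots> \<le> card (insert j0 J)" using V' insert by simp
        finally show ?thesis .
      qed
      fix n assume n: "n \<in> I"
      have l1: "(\<Sum>v\<in>V'. \<bar>c' v n\<bar>) \<le> 2 ^ card J - 1" using V'(4)[OF n] by (simp add: c'_def)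
      have "(\<Sum>v\<in>V. \<bar>\<Sum>l\<in>insert j0 J. \<gamma> v l * E n l\<bar>)
         \<le> (\<Sum>v\<in>V. ((if v \<in> V' then \<bar>c' v n\<bar> else 0) + (if v = n0 then \<bar>b n\<bar> else 0)) * 1)"
        unfolding coef by (intro sum_mono) auto
      also have "\<dots> = (\<Sum>v\<in>V'. \<bar>c' v n\<bar>) + \<bar>b n\<bar>" by (subst sumV) simp
      \<comment> \<open>The new coefficient is at most one plus the previous total s, so the total
        grows to 2 s + 1, whence 2^card J - 1.\<close>
      also have "\<bar>b n\<bar> \<le> 1 + (\<Sum>v\<in>V'. \<bar>c' v n\<bar>)"
      proof -
        have "\<bar>\<Sum>u\<in>V'. c' u n * a u\<bar> \<le> (\<Sum>u\<in>V'. \<bar>c' u n * a u\<bar>)" by (rule sum_abs)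
        also have "\<dots> \<le> (\<Sum>u\<in>V'. \<bar>c' u n\<bar>)"
        proof (intro sum_mono)
          fix u assume "u \<in> V'"
          then have "\<bar>a u\<bar> \<le> 1" using a1 V' by auto
          then show "\<bar>c' u n * a u\<bar> \<le> \<bar>c' u n\<bar>" by (simp add: abs_mult mult_left_le)
        qed
        finally show ?thesis using a1[OF n] unfolding b_def by linarith
      qed
      also have "(\<Sum>v\<in>V'. \<bar>c' v n\<bar>) + (1 + (\<Sum>v\<in>V'. \<bar>c' v n\<bar>)) \<le> 2 ^ card (insert j0 J) - 1"
        using l1 insert by simp
      finally show "(\<Sum>v\<in>V. \<bar>\<Sum>l\<in>insert j0 J. \<gamma> v l * E n l\<bar>) \<le> 2 ^ card (insert j0 J) - 1" by simp
      fix j assume j: "j \<in> insert j0 J"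
      have "(\<Sum>v\<in>V. (\<Sum>l\<in>insert j0 J. \<gamma> v l * E n l) * E v j) = (\<Sum>v\<in>V'. c' v n * E v j) + b n * E n0 j"
        unfolding coef by (rule sumV)
      also have "\<dots> = (\<Sum>v\<in>V'. c' v n * E' v j) + a n * E n0 j"
        by (simp add: b_def E'_def algebra_simps sum_subtractf sum_distrib_left sum_distrib_right)
      also have "(\<Sum>v\<in>V'. c' v n * E' v j) = E' n j"
      proof (cases "j = j0")
        case True
        have "E' v j0 = 0" for v using p0 by (simp add: E'_def a_def p_def)
        then show ?thesis using True by simp
      next
        case False
        then show ?thesis using j V'(3)[OF n, of j] by (simp add: c'_def)
      qed
      finally show "E n j = (\<Sum>v\<in>V. (\<Sum>l\<in>insert j0 J. \<gamma> v l * E n l) * E v j)" by (simp add: E'_def)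
    qed
  qed
qed

context
  fixes \<Theta> :: "real set" and L \<rho> :: real and \<Phi> :: "int \<Rightarrow> real"
  assumes L: "L > 0" and \<rho>: "\<rho> > 0"
    and add: "\<And>x y. bnorm \<Theta> L x \<le> \<rho> \<Longrightarrow> bnorm \<Theta> L y \<le> \<rho> \<Longrightarrow> \<Phi> (x + y) = \<Phi> x + \<Phi> y"
begin

lemma locally_additive_0: "\<Phi> 0 = 0"
  using add[of 0 0] \<rho> by simp

lemma locally_additive_minus: "bnorm \<Theta> L x \<le> \<rho> \<Longrightarrow> \<Phi> (- x) = - \<Phi> x"
  using add[of x "- x"] locally_additive_0 by simp

lemma bnorm_nat_mult: "bnorm \<Theta> L (int k * x) \<le> real k * bnorm \<Theta> L x"
proof (induction k)
  case (Suc k)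
  have "int (Suc k) * x = int k * x + x" by (simp add: distrib_right)
  then have "bnorm \<Theta> L (int (Suc k) * x) \<le> bnorm \<Theta> L (int k * x) + bnorm \<Theta> L x" using bnorm_add[OF L] by metis
  then show ?case using Suc by (simp add: distrib_right)
qed auto

lemma locally_additive_nat_mult: "real k * bnorm \<Theta> L x \<le> \<rho> \<Longrightarrow> \<Phi> (int k * x) = real k * \<Phi> x"
proof (induction k)
  case 0 show ?case by (simp add: locally_additive_0)
next
  case (Suc k)
  have b0: "bnorm \<Theta> L x \<ge> 0" by (rule bnorm_nonneg[OF L])
  have k: "real k * bnorm \<Theta> L x \<le> \<rho>" and x: "bnorm \<Theta> L x \<le> \<rho>"
  proof -
    have "0 \<le> real k * bnorm \<Theta> L x" using b0 by simp
    moreover have "real k * bnorm \<Theta> L x + bnorm \<Theta> L x \<le> \<rho>" using Suc.prems by (simp add: distrib_right)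
    ultimately show "real k * bnorm \<Theta> L x \<le> \<rho>" "bnorm \<Theta> L x \<le> \<rho>" using b0 by linarith+
  qed
  have "int (Suc k) * x = int k * x + x" by (simp add: distrib_right)
  then have "\<Phi> (int (Suc k) * x) = \<Phi> (int k * x) + \<Phi> x"
    using add[of "int k * x" x] bnorm_nat_mult[of k x] k x by simp
  then show ?case using Suc.IH[OF k] by (simp add: distrib_right)
qed

lemma locally_additive_int_mult:
  assumes "\<bar>real_of_int s\<bar> * bnorm \<Theta> L x \<le> \<rho>"
  shows "\<Phi> (s * x) = of_int s * \<Phi> x" "bnorm \<Theta> L (s * x) \<le> \<bar>real_of_int s\<bar> * bnorm \<Theta> L x"
proof -
  obtain k where k: "s = int k \<or> s = - int k" by (meson int_cases2)
  then have ab: "\<bar>real_of_int s\<bar> = real k" by auto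
  have 1: "\<Phi> (int k * x) = real k * \<Phi> x" using assms ab by (intro locally_additive_nat_mult) simp
  have 2: "bnorm \<Theta> L (int k * x) \<le> real k * bnorm \<Theta> L x" by (rule bnorm_nat_mult)
  have 3: "bnorm \<Theta> L (int k * x) \<le> \<rho>" using 2 assms ab by simp
  show "\<Phi> (s * x) = of_int s * \<Phi> x" using k 1 locally_additive_minus[OF 3] by auto
  show "bnorm \<Theta> L (s * x) \<le> \<bar>real_of_int s\<bar> * bnorm \<Theta> L x" unfolding ab using k 2 by auto
qed

text \<open>The bound on the total of the norms keeps every partial sum in the range where \<Phi> is
  additive; the second half of the conclusion is what carries the induction.\<close>

lemma locally_additive_sum:
  assumes "finite V" "(\<Sum>v\<in>V. \<bar>real_of_int (s v)\<bar> * bnorm \<Theta> L v) \<le> \<rho>"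
  shows "\<Phi> (\<Sum>v\<in>V. s v * v) = (\<Sum>v\<in>V. of_int (s v) * \<Phi> v)
    \<and> bnorm \<Theta> L (\<Sum>v\<in>V. s v * v) \<le> (\<Sum>v\<in>V. \<bar>real_of_int (s v)\<bar> * bnorm \<Theta> L v)"
  using assms
proof (induction V rule: finite_induct)
  case empty show ?case by (simp add: locally_additive_0)
next
  case (insert v V)
  have nn: "\<bar>real_of_int (s v)\<bar> * bnorm \<Theta> L v \<ge> 0" "(\<Sum>v\<in>V. \<bar>real_of_int (s v)\<bar> * bnorm \<Theta> L v) \<ge> 0"
    using bnorm_nonneg[OF L] by (auto intro!: mult_nonneg_nonneg sum_nonneg)
  have 1: "\<bar>real_of_int (s v)\<bar> * bnorm \<Theta> L v \<le> \<rho>" and 2: "(\<Sum>v\<in>V. \<bar>real_of_int (s v)\<bar> * bnorm \<Theta> L v) \<le> \<rho>"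
    using insert nn by auto
  note IH = insert.IH[OF 2]
  note m = locally_additive_int_mult[OF 1]
  have "\<Phi> (s v * v + (\<Sum>v\<in>V. s v * v)) = \<Phi> (s v * v) + \<Phi> (\<Sum>v\<in>V. s v * v)"
    using m(2) IH 1 2 by (intro add) auto
  moreover have "bnorm \<Theta> L (s v * v + (\<Sum>v\<in>V. s v * v)) \<le> bnorm \<Theta> L (s v * v) + bnorm \<Theta> L (\<Sum>v\<in>V. s v * v)"
    by (rule bnorm_add[OF L])
  ultimately show ?case using insert m IH by simp
qed

text \<open>A point n enters as the vector of n and all round(\<theta> n). A relation with bounded
  real coefficients between such vectors passes to \<Phi>, although \<Phi> is only locally additive:
  multiples of the relation, with coefficients replaced by their integer parts, can be walked
  through without leaving the Bohr set.\<close>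

theorem locally_additive_bracket_linear:
  assumes \<Theta>: "finite \<Theta>" "card \<Theta> \<le> d"
  shows "\<exists>\<beta> \<alpha>. \<forall>n. bnorm \<Theta> L n \<le> \<rho> / 2 ^ (d + 3) \<longrightarrow>
    \<Phi> n = \<beta> * of_int n + (\<Sum>\<theta>\<in>\<Theta>. \<alpha> \<theta> * of_int (round (\<theta> * of_int n)))"
proof -
  \<comment> \<open>A step of the walk costs 2 * 2^(d+1) r = \<rho>/2 for the combination of the
    \<open>v\<close>, plus \<open>r\<close> for \<open>n\<close>; the walking point itself stays
    within 2^(d+1) r = \<rho>/4.\<close>
  define r where "r = \<rho> / 2 ^ (d + 3)"
  have r0: "r > 0" using \<rho> by (simp add: r_def)
  define I where "I = bohr \<Theta> L r"
  define J where "J = insert None (Some ` \<Theta>)"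
  define E where "E n j = (case j of None \<Rightarrow> real_of_int n | Some \<theta> \<Rightarrow> of_int (round (\<theta> * of_int n)))" for n :: int and j :: "real option"
  have finI: "finite I" unfolding I_def by (rule finite_bohr[OF L])
  have finJ: "finite J" using \<Theta> by (simp add: J_def)
  have cJ: "card J \<le> d + 1"
    using \<Theta> by (simp add: J_def card_insert_if card_image image_iff)
  obtain V \<gamma> where V: "V \<subseteq> I" "card V \<le> card J"
    and E: "\<And>n j. n \<in> I \<Longrightarrow> j \<in> J \<Longrightarrow> E n j = (\<Sum>v\<in>V. (\<Sum>l\<in>J. \<gamma> v l * E n l) * E v j)"
    and l1: "\<And>n. n \<in> I \<Longrightarrow> (\<Sum>v\<in>V. \<bar>\<Sum>l\<in>J. \<gamma> v l * E n l\<bar>) \<le> 2 ^ card J - 1"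
    using bounded_spanning_subset[OF finJ finI, of E] by blast
  have finV: "finite V" using V finI finite_subset by blast
  have Vr: "bnorm \<Theta> L v \<le> r" if "v \<in> V" for v using V that by (auto simp: I_def bohr_def)
  have b0: "bnorm \<Theta> L v \<ge> 0" for v by (rule bnorm_nonneg[OF L])
  have cV: "real (card V) \<le> 2 ^ (d + 1)"
  proof -
    have "card V \<le> d + 1" using V cJ by simp
    also have "\<dots> \<le> 2 ^ (d + 1)" by (metis less_exp less_imp_le)
    finally show ?thesis by (metis numeral_power_eq_of_nat_cancel_iff of_nat_le_iff of_nat_numeral of_nat_power)
  qed
  have key: "\<Phi> n = (\<Sum>v\<in>V. (\<Sum>l\<in>J. \<gamma> v l * E n l) * \<Phi> v)" if n: "n \<in> I" for n
  proof -
    define c where "c v = (\<Sum>l\<in>J. \<gamma> v l * E n l)" for v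
    have cl1: "(\<Sum>v\<in>V. \<bar>c v\<bar>) \<le> 2 ^ (d + 1) - 1"
    proof -
      have "(2::real) ^ card J \<le> 2 ^ (d + 1)" using cJ by (intro power_increasing) auto
      then show ?thesis using l1[OF n] unfolding c_def by linarith
    qed
    have nr: "bnorm \<Theta> L n \<le> r" using n by (simp add: I_def bohr_def)
    have En: "real_of_int n = (\<Sum>v\<in>V. c v * of_int v)"
      using E[OF n, of None] by (simp add: J_def E_def c_def)
    have Er: "real_of_int (round (\<theta> * of_int n)) = (\<Sum>v\<in>V. c v * of_int (round (\<theta> * of_int v)))" if "\<theta> \<in> \<Theta>" for \<theta>
      using E[OF n, of "Some \<theta>"] that by (simp add: J_def E_def c_def)
    define u where "u t = int t * n - (\<Sum>v\<in>V. \<lfloor>real t * c v\<rfloor> * v)" for t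
    have ub: "bnorm \<Theta> L (u t) \<le> 2 ^ (d + 1) * r" for t
    proof -
      define fr where "fr v = frac (real t * c v)" for v
      have fr: "0 \<le> fr v" "fr v \<le> 1" "real t * c v = of_int \<lfloor>real t * c v\<rfloor> + fr v" for v
        unfolding fr_def by (auto simp: frac_def less_imp_le frac_lt_1) linarith
      \<comment> \<open>As n is the combination of the v with coefficients \<open>c v\<close>, the
        multiples of n cancel and only fractional parts remain, however large \<open>t\<close>
        is.\<close>
      have un: "real_of_int (u t) = (\<Sum>v\<in>V. fr v * of_int v)"
      proof -
        have "real_of_int (u t) = real t * (\<Sum>v\<in>V. c v * of_int v) - (\<Sum>v\<in>V. of_int \<lfloor>real t * c v\<rfloor> * of_int v)"
          by (simp add: u_def En)
        also have "\<dots> = (\<Sum>v\<in>V. (real t * c v - of_int \<lfloor>real t * c v\<rfloor>) * of_int v)"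
          by (simp add: sum_distrib_left left_diff_distrib sum_subtractf mult.assoc)
        finally show ?thesis using fr(3) by (simp add: fr_def frac_def)
      qed
      have "\<bar>real_of_int (u t)\<bar> \<le> (\<Sum>v\<in>V. \<bar>real_of_int v\<bar>)"
        unfolding un by (rule order_trans[OF sum_abs]) (use fr in \<open>auto intro!: sum_mono simp: abs_mult mult_left_le_one_le\<close>)
      then have 1: "\<bar>real_of_int (u t)\<bar> / L \<le> (\<Sum>v\<in>V. \<bar>real_of_int v\<bar> / L)"
        using L by (simp add: sum_divide_distrib[symmetric] divide_right_mono)
      have 2: "nd (\<theta> * of_int (u t)) \<le> (\<Sum>v\<in>V. nd (\<theta> * of_int v))" if \<theta>: "\<theta> \<in> \<Theta>" for \<theta>
      proof -
        \<comment> \<open>An integer close to \<theta> u(t): the same combination taken of the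
          roundings, so that the deviations from integers are again multiplied by fractional parts
          only.\<close>
        define m where "m = int t * round (\<theta> * of_int n) - (\<Sum>v\<in>V. \<lfloor>real t * c v\<rfloor> * round (\<theta> * of_int v))"
        have "real_of_int m = real t * (\<Sum>v\<in>V. c v * of_int (round (\<theta> * of_int v))) - (\<Sum>v\<in>V. of_int \<lfloor>real t * c v\<rfloor> * of_int (round (\<theta> * of_int v)))"
          by (simp add: m_def Er[OF \<theta>])
        also have "\<dots> = (\<Sum>v\<in>V. (real t * c v - of_int \<lfloor>real t * c v\<rfloor>) * of_int (round (\<theta> * of_int v)))"
          by (simp add: sum_distrib_left left_diff_distrib sum_subtractf mult.assoc)
        finally have mm: "real_of_int m = (\<Sum>v\<in>V. fr v * of_int (round (\<theta> * of_int v)))" by (simp add: fr_def frac_def)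
        have "nd (\<theta> * of_int (u t)) \<le> \<bar>\<theta> * of_int (u t) - of_int m\<bar>" by (rule nd_le)
        also have "\<theta> * of_int (u t) - of_int m = (\<Sum>v\<in>V. fr v * (\<theta> * of_int v - of_int (round (\<theta> * of_int v))))"
          unfolding un mm by (simp add: sum_distrib_left right_diff_distrib sum_subtractf mult_ac)
        also have "\<bar>\<dots>\<bar> \<le> (\<Sum>v\<in>V. nd (\<theta> * of_int v))"
          by (rule order_trans[OF sum_abs]) (use fr in \<open>auto intro!: sum_mono simp: nd_def abs_mult mult_left_le_one_le\<close>)
        finally show ?thesis .
      qed
      have "bnorm \<Theta> L (u t) \<le> (\<Sum>v\<in>V. \<bar>real_of_int v\<bar> / L) + (\<Sum>\<theta>\<in>\<Theta>. \<Sum>v\<in>V. nd (\<theta> * of_int v))"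
        unfolding bnorm_def using 1 2 by (intro add_mono sum_mono) auto
      also have "\<dots> = (\<Sum>v\<in>V. bnorm \<Theta> L v)" unfolding bnorm_def by (subst sum.swap) (simp add: sum.distrib)
      also have "\<dots> \<le> (\<Sum>v\<in>V. r)" using Vr by (intro sum_mono)
      also have "\<dots> \<le> 2 ^ (d + 1) * r" using cV r0 by (simp add: mult_right_mono)
      finally show ?thesis .
    qed
    have rr: "2 ^ (d + 1) * r = \<rho> / 4" by (simp add: r_def power_add field_simps)
    have rs: "r \<le> \<rho> / 8"
    proof -
      have "(8::real) \<le> 2 ^ (d + 3)" by (simp add: power_add)
      then show ?thesis unfolding r_def using \<rho> by (intro divide_left_mono) auto
    qed
    have walk: "\<Phi> (u t) = real t * \<Phi> n - (\<Sum>v\<in>V. of_int \<lfloor>real t * c v\<rfloor> * \<Phi> v)" for t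
    proof (induction t)
      case 0
      show ?case by (simp add: u_def locally_additive_0)
    next
      case (Suc t)
      define s where "s v = \<lfloor>real (Suc t) * c v\<rfloor> - \<lfloor>real t * c v\<rfloor>" for v
      have s: "\<bar>real_of_int (s v)\<bar> \<le> \<bar>c v\<bar> + 1" for v
      proof -
        have "real (Suc t) * c v = real t * c v + c v" by (simp add: distrib_right)
        then show ?thesis unfolding s_def by linarith
      qed
      have "(\<Sum>v\<in>V. \<bar>real_of_int (s v)\<bar> * bnorm \<Theta> L v) \<le> (\<Sum>v\<in>V. (\<bar>c v\<bar> + 1) * r)"
        using s Vr b0 by (intro sum_mono mult_mono) auto
      also have "\<dots> = ((\<Sum>v\<in>V. \<bar>c v\<bar>) + real (card V)) * r"
        by (simp add: sum_distrib_right[symmetric] sum.distrib)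
      also have "\<dots> \<le> (2 ^ (d + 1) + 2 ^ (d + 1)) * r" using cl1 cV r0 by (intro mult_right_mono) auto
      also have "\<dots> = \<rho> / 2" using rr by (simp add: distrib_right)
      finally have sb: "(\<Sum>v\<in>V. \<bar>real_of_int (s v)\<bar> * bnorm \<Theta> L v) \<le> \<rho> / 2" .
      have S: "\<Phi> (\<Sum>v\<in>V. s v * v) = (\<Sum>v\<in>V. of_int (s v) * \<Phi> v)" "bnorm \<Theta> L (\<Sum>v\<in>V. s v * v) \<le> \<rho> / 2"
        using locally_additive_sum[OF finV, of s] sb \<rho> by auto
      define w where "w = n + (- (\<Sum>v\<in>V. s v * v))"
      have w1: "\<Phi> w = \<Phi> n - (\<Sum>v\<in>V. of_int (s v) * \<Phi> v)"
        unfolding w_def using add[of n "- (\<Sum>v\<in>V. s v * v)"] locally_additive_minus[of "\<Sum>v\<in>V. s v * v"] S nr rs \<rho> by auto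
      have w2: "bnorm \<Theta> L w \<le> \<rho>" unfolding w_def
        using bnorm_add[OF L, of \<Theta> n "- (\<Sum>v\<in>V. s v * v)"] S nr rs \<rho> by auto
      have "u (Suc t) = u t + w"
        unfolding u_def w_def s_def by (simp add: left_diff_distrib sum_subtractf distrib_right)
      then have "\<Phi> (u (Suc t)) = \<Phi> (u t) + \<Phi> w" using add[OF _ w2, of "u t"] ub[of t] rr \<rho> by auto
      then show ?case unfolding Suc w1 s_def by (simp add: left_diff_distrib sum_subtractf distrib_right)
    qed
    define B where "B = Max ((\<lambda>x. \<bar>\<Phi> x\<bar>) ` bohr \<Theta> L \<rho>)"
    have B: "\<bar>\<Phi> x\<bar> \<le> B" if "bnorm \<Theta> L x \<le> \<rho>" for x
      unfolding B_def using finite_bohr[OF L] that by (intro Max_ge) (auto simp: bohr_def)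
    \<comment> \<open>The defect \<open>D\<close> is multiplied by \<open>t\<close> along the walk,
      whereas \<Phi> is bounded on the finite Bohr set; hence it is 0.\<close>
    define D where "D = \<Phi> n - (\<Sum>v\<in>V. c v * \<Phi> v)"
    define B' where "B' = B + (\<Sum>v\<in>V. \<bar>\<Phi> v\<bar>)"
    have "real t * \<bar>D\<bar> \<le> B'" for t
    proof -
      have "real t * D = \<Phi> (u t) - (\<Sum>v\<in>V. (real t * c v - of_int \<lfloor>real t * c v\<rfloor>) * \<Phi> v)"
        unfolding walk D_def by (simp add: left_diff_distrib right_diff_distrib sum_subtractf sum_distrib_left mult.assoc)
      moreover have "\<bar>\<Sum>v\<in>V. (real t * c v - of_int \<lfloor>real t * c v\<rfloor>) * \<Phi> v\<bar> \<le> (\<Sum>v\<in>V. \<bar>\<Phi> v\<bar>)"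
      proof (rule order_trans[OF sum_abs], rule sum_mono)
        fix v
        have "\<bar>real t * c v - of_int \<lfloor>real t * c v\<rfloor>\<bar> \<le> 1" by linarith
        then show "\<bar>(real t * c v - of_int \<lfloor>real t * c v\<rfloor>) * \<Phi> v\<bar> \<le> \<bar>\<Phi> v\<bar>"
          by (simp add: abs_mult mult_left_le_one_le)
      qed
      moreover have "\<bar>\<Phi> (u t)\<bar> \<le> B" using ub[of t] rr \<rho> by (intro B) auto
      ultimately have "\<bar>real t * D\<bar> \<le> B'" unfolding B'_def by linarith
      then show ?thesis by (simp add: abs_mult)
    qed
    then have "D = 0"
    proof -
      assume *: "\<And>t. real t * \<bar>D\<bar> \<le> B'"
      show "D = 0"
      proof (rule ccontr)
        assume "D \<noteq> 0"
        then obtain t where "B' < real t * \<bar>D\<bar>" using reals_Archimedean3[of "\<bar>D\<bar>"] by auto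
        then show False using *[of t] by simp
      qed
    qed
    then show ?thesis by (simp add: D_def c_def)
  qed
  define co where "co l = (\<Sum>v\<in>V. \<gamma> v l * \<Phi> v)" for l
  have "\<Phi> n = co None * of_int n + (\<Sum>\<theta>\<in>\<Theta>. co (Some \<theta>) * of_int (round (\<theta> * of_int n)))" if "bnorm \<Theta> L n \<le> r" for n
  proof -
    have "\<Phi> n = (\<Sum>v\<in>V. (\<Sum>l\<in>J. \<gamma> v l * E n l) * \<Phi> v)" using key[of n] that by (simp add: I_def bohr_def)
    also have "\<dots> = (\<Sum>l\<in>J. \<Sum>v\<in>V. \<gamma> v l * E n l * \<Phi> v)" by (subst sum.swap) (simp only: sum_distrib_right)
    also have "\<dots> = (\<Sum>l\<in>J. co l * E n l)" unfolding co_def by (simp add: sum_distrib_left sum_distrib_right mult_ac)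
    also have "\<dots> = co None * E n None + (\<Sum>\<theta>\<in>\<Theta>. co (Some \<theta>) * E n (Some \<theta>))"
      using \<Theta> unfolding J_def by (subst sum.insert) (auto simp: sum.reindex)
    finally show ?thesis by (simp add: E_def)
  qed
  then show ?thesis unfolding r_def by (intro exI[of _ "co None"] exI[of _ "\<lambda>\<theta>. co (Some \<theta>)"]) auto
qed

end

section \<open>Derivatives correlate with bracket-linear phases\<close>

text \<open>Rounding rather than flooring makes the deviations from integers symmetric about 0, and
  the function additive wherever these deviations add up to less than 1/2.\<close>

definition phi :: "real set \<Rightarrow> real \<Rightarrow> (real \<Rightarrow> real) \<Rightarrow> int \<Rightarrow> real" where
  "phi \<Theta> \<beta> \<alpha> n = \<beta> * of_int n + (\<Sum>\<theta>\<in>\<Theta>. \<alpha> \<theta> * of_int (round (\<theta> * of_int n)))"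

lemma nsum_0_mem: "0 \<in> S \<Longrightarrow> 0 \<in> nsum n S"
  by (induction n) (auto, force)

text \<open>Average over the shifts in [-M, 2M], at most 4 M of them. Since the locally additive
  function only describes differences lying in a Bohr set, many points of the set have to be found
  in one translate.\<close>

lemma dense_translate:
  fixes H B :: "int set" and M :: int
  assumes M: "M > 0" and H: "H \<subseteq> {0..<M}" and B: "B \<subseteq> {- M..M}"
  shows "\<exists>t. real (card H) * real (card B) \<le> 4 * of_int M * real (card {h \<in> H. h - t \<in> B})"
proof -
  have fin: "finite H" "finite B" using H B finite_subset by blast+
  define T where "T = {- M..2 * M}"
  have "(\<Sum>t\<in>T. card {h \<in> H. h - t \<in> B}) = (\<Sum>h\<in>H. card {t \<in> T. h - t \<in> B})"
    using fin by (intro sum_card_swap) (auto simp: T_def)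
  also have "\<dots> = (\<Sum>h\<in>H. card B)"
  proof (intro sum.cong refl)
    fix h assume "h \<in> H"
    then have "h \<in> {0..<M}" using H by blast
    then show "card {t \<in> T. h - t \<in> B} = card B"
      using B by (intro bij_betw_same_card[of "\<lambda>t. h - t"] bij_betw_byWitness[where f' = "\<lambda>b. h - b"])
        (auto simp: T_def)
  qed
  finally have "real (\<Sum>t\<in>T. card {h \<in> H. h - t \<in> B}) = real (card H * card B)" by simp
  then have 1: "(\<Sum>t\<in>T. real (card {h \<in> H. h - t \<in> B})) = real (card H) * real (card B)"
    by simp
  obtain t where t: "\<forall>l\<in>T. real (card {h \<in> H. h - l \<in> B}) \<le> real (card {h \<in> H. h - t \<in> B})"
    using ex_argmax[of T "\<lambda>t. real (card {h \<in> H. h - t \<in> B})"] M by (auto simp: T_def)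
  have "(\<Sum>l\<in>T. real (card {h \<in> H. h - l \<in> B})) \<le> (\<Sum>l\<in>T. real (card {h \<in> H. h - t \<in> B}))"
    using t by (intro sum_mono) auto
  also have "\<dots> \<le> 4 * of_int M * real (card {h \<in> H. h - t \<in> B})"
    using M by (simp add: T_def mult_right_mono)
  finally show ?thesis using 1 by auto
qed

lemma bohr_in_sumset_graph:
  assumes "w1 \<in> fst ` A" "w2 \<in> fst ` A" "w3 \<in> fst ` A" "w4 \<in> fst ` A"
  shows "\<exists>v. (w1 + w2 - w3 - w4, v) \<in> nsum 2 (diffset (A :: (int \<times> int) set))"
proof -
  obtain a1 a2 a3 a4 where a: "a1 \<in> A" "a2 \<in> A" "a3 \<in> A" "a4 \<in> A"
    "fst a1 = w1" "fst a2 = w2" "fst a3 = w3" "fst a4 = w4" using assms by auto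
  have "a1 - a3 \<in> nsum 1 (diffset A)" "a2 - a4 \<in> nsum 1 (diffset A)"
    using a by (intro nsum_1; unfold diffset_def; blast)+
  then have "(a1 - a3) + (a2 - a4) \<in> nsum 2 (diffset A)" using nsum_add by (metis one_add_one)
  moreover have "(a1 - a3) + (a2 - a4) = (w1 + w2 - w3 - w4, snd a1 + snd a2 - snd a3 - snd a4)"
    using a by (simp add: prod_eq_iff)
  ultimately show ?thesis by metis
qed

text \<open>On a translate of a Bohr set \<xi>(h) - \<xi>(h0) = \<Phi>(h - h0), so fixing one h0
  turns the frequencies into values of a locally additive function, and \<xi>0 absorbs the frequency
  of h0. \<Phi> is read off from the graph of \<xi>: by Bogolyubov twofold sums of its differences
  lie above a whole Bohr set, and the trivial fibre above 0 makes the value unique.\<close>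

theorem derivative_bracket_linear:
  fixes c :: real
  assumes c: "0 < c" "c \<le> 1"
  shows "\<exists>(d::nat) c1. c1 > 0 \<and> (\<forall>M F. M > 0 \<longrightarrow> periodic M F \<longrightarrow> (\<forall>m. cmod (F m) \<le> 1) \<longrightarrow>
    (\<Sum>h\<in>{0..<M}. \<Sum>h1\<in>{0..<M}. (cmod (\<Sum>x\<in>{0..<M}. Delta h1 (Delta h F) x))\<^sup>2) \<ge> 2 * c * of_int M ^ 4 \<longrightarrow>
    (\<exists>\<Theta> \<beta> \<alpha> K h0 \<xi>0. finite \<Theta> \<and> card \<Theta> \<le> d \<and> K \<subseteq> bohr \<Theta> (of_int M) (1/64) \<and>
      (\<Sum>k\<in>K. cmod (\<Sum>n\<in>{0..<M}. F (n + k + h0) * (cnj (F n) * e (\<xi>0 * of_int n)) * e (phi \<Theta> \<beta> \<alpha> k * of_int n)))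
        \<ge> c1 * (of_int M)\<^sup>2))"
proof -
  \<comment> \<open>The lift to the integers keeps a proportion c^12 / 9; the remaining 2 is the one
    in the hypothesis of the Freiman step.\<close>
  define \<gamma> where "\<gamma> = c ^ 12 / 18"
  have \<gamma>: "\<gamma> > 0" using c by (simp add: \<gamma>_def)
  obtain cF where cF: "cF > 0" and fre: "\<And>A :: (int \<times> int) set. finite A \<Longrightarrow> A \<noteq> {} \<Longrightarrow> inj_on fst A \<Longrightarrow>
    2 * \<gamma> * real (card A) ^ 3 \<le> real (card (quads A 0)) \<Longrightarrow>
    (\<exists>A'\<subseteq>A. real (card A') \<ge> cF * real (card A) \<and> (\<forall>x\<in>nsum 6 (diffset A'). fst x = 0 \<longrightarrow> snd x = 0))"
    using freiman_homomorphism_on_dense_subset[OF \<gamma>] by blast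
  define c' where "c' = cF * c"
  have c': "c' > 0" using cF c by (simp add: c'_def)
  define d where "d = nat \<lfloor>128 / c'\<^sup>2\<rfloor>"
  \<comment> \<open>\<Phi> is additive at radius 1/8, half of the 1/4 in Bogolyubov's lemma, and
    linearity costs a further 2^(d+3). The points are later taken at radius r/2, so that their
    differences have norm at most \<open>r\<close>.\<close>
  define r where "r = (1/8 :: real) / 2 ^ (d + 3)"
  have r0: "r > 0" by (simp add: r_def)
  have r64: "r \<le> 1/64"
  proof -
    have "(8::real) \<le> 2 ^ (d + 3)" by (simp add: power_add)
    then show ?thesis unfolding r_def by (simp add: field_simps)
  qed
  obtain cB where cB: "cB > 0" and Bcard: "\<And>\<Theta> L. finite \<Theta> \<Longrightarrow> card \<Theta> \<le> d \<Longrightarrow> L > 0 \<Longrightarrow> real (card (bohr \<Theta> L (r/2))) \<ge> cB * L"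
    using bohr_card_lower[of "r/2" d] r0 by auto
  define c1 where "c1 = c' * cB / 4 * c"
  show ?thesis
  proof (intro exI[of _ d] exI[of _ c1] conjI allI impI)
    show "c1 > 0" using c c' cB by (simp add: c1_def)
    fix M :: int and F :: "int \<Rightarrow> complex"
    assume M: "M > 0" and per: "periodic M F" and bd: "\<forall>m. cmod (F m) \<le> 1"
      and U: "(\<Sum>h\<in>{0..<M}. \<Sum>h1\<in>{0..<M}. (cmod (\<Sum>x\<in>{0..<M}. Delta h1 (Delta h F) x))\<^sup>2) \<ge> 2 * c * of_int M ^ 4"
    have MR: "real_of_int M > 0" using M by simp
    obtain H \<xi> where H: "H \<subseteq> {0..<M}" "card H \<ge> c * M" "\<And>h. h \<in> H \<Longrightarrow> \<xi> h \<in> {0..<M}"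
      and cor: "\<And>h. h \<in> H \<Longrightarrow> cmod (\<Sum>x\<in>{0..<M}. Delta h F x * chr M (\<xi> h) x) \<ge> c * M"
      using derivative_correlates[OF M per _ c U] bd by blast
    have finH: "finite H" using H finite_subset by blast
    have cM: "c * M > 0" using c M by simp
    define A where "A = (\<lambda>h. (h, \<xi> h)) ` H"
    have injA: "inj_on fst A" by (auto simp: A_def inj_on_def)
    have cardA: "card A = card H" unfolding A_def by (intro card_image) (auto simp: inj_on_def)
    have "card H > 0" using H(2) cM by linarith
    then have Ane: "A \<noteq> {}" using cardA by auto
    have finA: "finite A" using finH by (simp add: A_def)
    have HM: "real (card H) \<le> of_int M" using card_mono[OF _ H(1)] M by simp
    let ?Q = "{((h1, h2), (h3, h4)) \<in> (H \<times> H) \<times> (H \<times> H).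
         M dvd (h1 + h2 - h3 - h4) \<and> M dvd (\<xi> h1 + \<xi> h2 - \<xi> h3 - \<xi> h4)}"
    have "c ^ 12 * real_of_int M ^ 3 \<le> real (card ?Q)"
      using bd by (intro derivative_phases_quadruples[OF M per _ c(1) H(1,2) cor]) auto
    also have "\<dots> \<le> real (9 * card (quads A 0))"
      unfolding A_def by (intro of_nat_mono mod_quadruples_lift[OF M H(1,3)])
    finally have "c ^ 12 * real_of_int M ^ 3 \<le> 9 * real (card (quads A 0))" by simp
    moreover have "2 * \<gamma> * real (card A) ^ 3 \<le> 2 * \<gamma> * real_of_int M ^ 3"
      using \<gamma> HM cardA by (intro mult_left_mono power_mono) auto
    ultimately have "2 * \<gamma> * real (card A) ^ 3 \<le> real (card (quads A 0))" by (simp add: \<gamma>_def)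
    from fre[OF finA Ane injA this] obtain A' where A': "A' \<subseteq> A" "real (card A') \<ge> cF * real (card A)"
      and triv: "\<And>x. x \<in> nsum 6 (diffset A') \<Longrightarrow> fst x = 0 \<Longrightarrow> snd x = 0" by blast
    define H' where "H' = fst ` A'"
    have H'H: "H' \<subseteq> H" using A' by (auto simp: H'_def A_def)
    have finH': "finite H'" using H'H finH finite_subset by blast
    have gr: "(h, \<xi> h) \<in> A'" if "h \<in> H'" for h using that A' by (auto simp: H'_def A_def)
    have "card H' = card A'" unfolding H'_def using injA A' by (intro card_image) (meson inj_on_subset)
    then have cH': "real (card H') \<ge> c' * of_int M"
    proof -
      have "cF * (c * of_int M) \<le> cF * real (card A)" using H(2) cF cardA by (intro mult_left_mono) auto
      then show ?thesis using A'(2) \<open>card H' = card A'\<close> by (simp add: c'_def)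
    qed
    have H'int: "H' \<subseteq> {- M..M}" using H'H H(1) by auto
    obtain \<Theta> where \<Theta>: "finite \<Theta>" "real (card \<Theta>) \<le> 128 / c'\<^sup>2"
      and bog: "\<forall>n. \<bar>n\<bar> \<le> M \<longrightarrow> (\<forall>\<theta>\<in>\<Theta>. nd (\<theta> * of_int n) \<le> 1/4)
       \<longrightarrow> (\<exists>w1\<in>H'. \<exists>w2\<in>H'. \<exists>w3\<in>H'. \<exists>w4\<in>H'. n = w1 + w2 - w3 - w4)"
      by (rule bogolyubov[OF M H'int c' cH'])
    have cd: "card \<Theta> \<le> d" using \<Theta>(2) unfolding d_def by (simp add: le_nat_iff le_floor_iff)
    define D where "D = diffset A'"
    have "H' \<noteq> {}" using cH' mult_pos_pos[OF c' MR] by auto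
    then obtain h' where "h' \<in> H'" by blast
    then have "(0 :: int \<times> int) \<in> D" unfolding D_def diffset_def using gr[of h'] by force
    note D0 = this
    have Dsym: "- z \<in> D" if zD: "z \<in> D" for z
    proof -
      obtain a b where ab: "z = a - b" "a \<in> A'" "b \<in> A'" using zD unfolding D_def diffset_def by blast
      then have "- z = b - a" by simp
      then show ?thesis using ab unfolding D_def diffset_def by blast
    qed
    have six: "2 + 2 + 2 = (6::nat)" by simp
    \<comment> \<open>A difference of two candidates is a fourfold sum from \<open>D\<close>; adding
      0, which lies in \<open>D\<close>, makes it sixfold.\<close>
    have uni: "v = v'" if "(n, v) \<in> nsum 2 D" "(n, v') \<in> nsum 2 D" for n v v'
    proof -
      have "- (n, v') \<in> nsum 2 D" by (rule nsum_uminus[OF Dsym that(2)])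
      from nsum_add[OF that(1) this] have 1: "(n, v) + - (n, v') \<in> nsum (2 + 2) D" .
      from nsum_add[OF this nsum_0_mem[OF D0, of 2]] have "(n, v) + - (n, v') + 0 \<in> nsum (2 + 2 + 2) D" .
      then have "(n, v) + - (n, v') + 0 \<in> nsum 6 D" using six by (simp only:)
      from triv[OF this[unfolded D_def]] show ?thesis by simp
    qed
    \<comment> \<open>Where no v exists this is an arbitrary value; \<Phi> is used only on the Bohr
      set, where one exists.\<close>
    define \<Phi> where "\<Phi> n = (SOME v. (n, v) \<in> nsum 2 D)" for n
    have ex: "\<exists>v. (n, v) \<in> nsum 2 D" if n: "bnorm \<Theta> (of_int M) n \<le> 1/4" for n
    proof -
      have "\<bar>real_of_int n\<bar> \<le> of_int M * bnorm \<Theta> (of_int M) n" by (rule abs_le_bnorm[OF MR])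
      also have "\<dots> \<le> of_int M * 1" using MR n by (intro mult_left_mono) auto
      finally have "\<bar>n\<bar> \<le> M" by linarith
      moreover have "nd (\<theta> * of_int n) \<le> 1/4" if "\<theta> \<in> \<Theta>" for \<theta>
        using nd_le_bnorm[OF MR \<Theta>(1) that, of n] n by simp
      ultimately obtain w1 w2 w3 w4 where "w1 \<in> H'" "w2 \<in> H'" "w3 \<in> H'" "w4 \<in> H'" "n = w1 + w2 - w3 - w4"
        using bog by blast
      then show ?thesis using bohr_in_sumset_graph[of w1 A' w2 w3 w4] unfolding H'_def D_def by auto
    qed
    have \<Phi>: "(n, \<Phi> n) \<in> nsum 2 D" if "bnorm \<Theta> (of_int M) n \<le> 1/4" for n
      unfolding \<Phi>_def by (rule someI_ex[OF ex[OF that]])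
    have \<Phi>eq: "\<Phi> n = v" if "(n, v) \<in> nsum 2 D" for n v
      using uni[OF _ that] someI[of "\<lambda>v. (n, v) \<in> nsum 2 D", OF that] unfolding \<Phi>_def by blast
    have \<Phi>add: "\<Phi> (x + y) = \<Phi> x + \<Phi> y" if x: "bnorm \<Theta> (of_int M) x \<le> 1/8" and y: "bnorm \<Theta> (of_int M) y \<le> 1/8" for x y
    proof -
      have xy: "bnorm \<Theta> (of_int M) (x + y) \<le> 1/4" using bnorm_add[OF MR, of \<Theta> x y] x y by linarith
      have "- (x + y, \<Phi> (x + y)) \<in> nsum 2 D" by (rule nsum_uminus[OF Dsym \<Phi>[OF xy]])
      moreover have "(x, \<Phi> x) \<in> nsum 2 D" "(y, \<Phi> y) \<in> nsum 2 D" using x y by (auto intro!: \<Phi>)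
      ultimately have "(x, \<Phi> x) + (y, \<Phi> y) + - (x + y, \<Phi> (x + y)) \<in> nsum (2 + 2 + 2) D"
        by (intro nsum_add)
      moreover have "2 + 2 + 2 = (6::nat)" by simp
      ultimately have "(x, \<Phi> x) + (y, \<Phi> y) + - (x + y, \<Phi> (x + y)) \<in> nsum 6 D" by (simp only:)
      from triv[OF this[unfolded D_def]] show ?thesis by simp
    qed
    have "\<exists>\<beta> \<alpha>. \<forall>n. bnorm \<Theta> (of_int M) n \<le> (1/8) / 2 ^ (d + 3) \<longrightarrow>
      real_of_int (\<Phi> n) = \<beta> * of_int n + (\<Sum>\<theta>\<in>\<Theta>. \<alpha> \<theta> * of_int (round (\<theta> * of_int n)))"
      by (rule locally_additive_bracket_linear[where \<Phi> = "\<lambda>n. real_of_int (\<Phi> n)", OF MR _ _ \<Theta>(1) cd]) (auto simp: \<Phi>add)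
    then obtain \<beta> \<alpha> where lin: "\<And>n. bnorm \<Theta> (of_int M) n \<le> r \<Longrightarrow>
      real_of_int (\<Phi> n) = \<beta> * of_int n + (\<Sum>\<theta>\<in>\<Theta>. \<alpha> \<theta> * of_int (round (\<theta> * of_int n)))"
      unfolding r_def by blast
    define \<beta>' where "\<beta>' = \<beta> / of_int M"
    define \<alpha>' where "\<alpha>' \<theta> = \<alpha> \<theta> / of_int M" for \<theta>
    have phi: "phi \<Theta> \<beta>' \<alpha>' n = real_of_int (\<Phi> n) / of_int M" if "bnorm \<Theta> (of_int M) n \<le> r" for n
      unfolding lin[OF that] phi_def \<beta>'_def \<alpha>'_def by (simp add: add_divide_distrib sum_divide_distrib)
    define B where "B = bohr \<Theta> (of_int M) (r/2)"
    have BM: "B \<subseteq> {- M..M}"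
    proof
      fix b assume "b \<in> B"
      then have "b \<in> {- \<lfloor>of_int M * (r/2)\<rfloor>..\<lfloor>of_int M * (r/2)\<rfloor>}" using bohr_subset_interval[OF MR] unfolding B_def by blast
      moreover have "of_int M * (r/2) \<le> of_int M" using MR r64 r0 by simp
      then have "\<lfloor>of_int M * (r/2)\<rfloor> \<le> M" by linarith
      ultimately show "b \<in> {- M..M}" by auto
    qed
    have H'M: "H' \<subseteq> {0..<M}" using H'H H(1) by blast
    obtain t where t: "real (card H') * real (card B) \<le> 4 * of_int M * real (card {h \<in> H'. h - t \<in> B})"
      using dense_translate[OF M H'M BM] by blast
    define X where "X = {h \<in> H'. h - t \<in> B}"
    have "(c' * of_int M) * (cB * of_int M) \<le> real (card H') * real (card B)"
      using cH' Bcard[OF \<Theta>(1) cd MR] c' cB MR unfolding B_def by (intro mult_mono) auto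
    with t have "of_int M * (c' * cB / 4 * of_int M) \<le> of_int M * real (card X)" by (simp add: X_def mult_ac)
    then have cX: "c' * cB / 4 * of_int M \<le> real (card X)" using MR by (simp add: mult_le_cancel_left)
    have "c' * cB / 4 * of_int M > 0" using c' cB MR by simp
    then have "card X > 0" using cX by linarith
    then obtain h0 where h0: "h0 \<in> X" by (metis card.empty ex_in_conv less_irrefl)
    define K where "K = (\<lambda>h. h - h0) ` X"
    have cK: "card K = card X" unfolding K_def by (intro card_image) (auto simp: inj_on_def)
    have Kr: "bnorm \<Theta> (of_int M) k \<le> r" if k: "k \<in> K" for k
    proof -
      obtain h where "h \<in> X" "k = h - h0" using k by (auto simp: K_def)
      then have "k = (h - t) - (h0 - t)" "bnorm \<Theta> (of_int M) (h - t) \<le> r/2" "bnorm \<Theta> (of_int M) (h0 - t) \<le> r/2"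
        using h0 by (auto simp: X_def B_def bohr_def)
      then show ?thesis using bnorm_diff[OF MR, of \<Theta> "h - t" "h0 - t"] by simp
    qed
    define \<xi>0 where "\<xi>0 = real_of_int (\<xi> h0) / of_int M"
    have trm: "cmod (\<Sum>n\<in>{0..<M}. F (n + k + h0) * (cnj (F n) * e (\<xi>0 * of_int n)) * e (phi \<Theta> \<beta>' \<alpha>' k * of_int n)) \<ge> c * of_int M"
      if k: "k \<in> K" for k
    proof -
      obtain h where h: "h \<in> X" "k = h - h0" using k by (auto simp: K_def)
      have hH: "h \<in> H'" "h0 \<in> H'" using h h0 by (auto simp: X_def)
      \<comment> \<open>One difference of the graph plus 0 is a twofold sum, so by uniqueness
        \<xi>(h) - \<xi>(h0) is the value of \<Phi>.\<close>
      have "(h, \<xi> h) - (h0, \<xi> h0) \<in> D" unfolding D_def diffset_def using gr hH by blast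
      from nsum_add[OF nsum_1[OF this] nsum_1[OF D0]] have "(k, \<xi> h - \<xi> h0) \<in> nsum (1 + 1) D" by (simp add: h)
      then have "(k, \<xi> h - \<xi> h0) \<in> nsum 2 D" by (simp only: one_add_one)
      then have "\<Phi> k = \<xi> h - \<xi> h0" by (rule \<Phi>eq)
      then have ph: "phi \<Theta> \<beta>' \<alpha>' k = real_of_int (\<xi> h - \<xi> h0) / of_int M" using phi[OF Kr[OF k]] by simp
      have "F (n + k + h0) * (cnj (F n) * e (\<xi>0 * of_int n)) * e (phi \<Theta> \<beta>' \<alpha>' k * of_int n) = Delta h F n * chr M (\<xi> h) n" for n
      proof -
        have "e (\<xi>0 * of_int n) * e (phi \<Theta> \<beta>' \<alpha>' k * of_int n) = chr M (\<xi> h) n"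
          unfolding e_add[symmetric] chr_def \<xi>0_def ph by (rule arg_cong[of _ _ e]) (simp add: algebra_simps add_divide_distrib[symmetric])
        then show ?thesis by (simp add: Delta_def h mult.assoc)
      qed
      then show ?thesis using cor[of h] hH H'H by auto
    qed
    have "c1 * (of_int M)\<^sup>2 = (c' * cB / 4 * of_int M) * (c * of_int M)" by (simp add: c1_def power2_eq_square)
    also have "\<dots> \<le> real (card K) * (c * of_int M)" using cX cK c MR by (intro mult_right_mono) auto
    also have "\<dots> = (\<Sum>k\<in>K. c * of_int M)" by simp
    also have "\<dots> \<le> (\<Sum>k\<in>K. cmod (\<Sum>n\<in>{0..<M}. F (n + k + h0) * (cnj (F n) * e (\<xi>0 * of_int n)) * e (phi \<Theta> \<beta>' \<alpha>' k * of_int n)))"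
      using trm by (intro sum_mono) auto
    finally have fin: "c1 * (of_int M)\<^sup>2 \<le> (\<Sum>k\<in>K. cmod (\<Sum>n\<in>{0..<M}. F (n + k + h0) * (cnj (F n) * e (\<xi>0 * of_int n)) * e (phi \<Theta> \<beta>' \<alpha>' k * of_int n)))" .
    have "K \<subseteq> bohr \<Theta> (of_int M) (1/64)" using Kr r64 by (force simp: bohr_def)
    then show "\<exists>\<Theta> \<beta> \<alpha> K h0 \<xi>0. finite \<Theta> \<and> card \<Theta> \<le> d \<and> K \<subseteq> bohr \<Theta> (of_int M) (1/64) \<and>
      (\<Sum>k\<in>K. cmod (\<Sum>n\<in>{0..<M}. F (n + k + h0) * (cnj (F n) * e (\<xi>0 * of_int n)) * e (phi \<Theta> \<beta> \<alpha> k * of_int n)))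
        \<ge> c1 * (of_int M)\<^sup>2"
      using \<Theta>(1) cd fin by blast
  qed
qed

section \<open>Localisation to Bohr sets\<close>

lemma phi_add:
  assumes L: "L > 0" and \<Theta>: "finite \<Theta>" and s: "bnorm \<Theta> L x + bnorm \<Theta> L y < 1/2"
  shows "phi \<Theta> \<beta> \<alpha> (x + y) = phi \<Theta> \<beta> \<alpha> x + phi \<Theta> \<beta> \<alpha> y"
proof -
  have "round (\<theta> * of_int (x + y)) = round (\<theta> * of_int x) + round (\<theta> * of_int y)" if "\<theta> \<in> \<Theta>" for \<theta>
  proof (rule round_unique_nd)
    have "\<bar>\<theta> * of_int (x + y) - of_int (round (\<theta> * of_int x) + round (\<theta> * of_int y))\<bar>
       \<le> nd (\<theta> * of_int x) + nd (\<theta> * of_int y)"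
      unfolding nd_def by (simp add: distrib_left)
    also have "\<dots> < 1/2" using nd_le_bnorm[OF L \<Theta> that, of x] nd_le_bnorm[OF L \<Theta> that, of y] s by linarith
    finally show "\<bar>\<theta> * of_int (x + y) - of_int (round (\<theta> * of_int x) + round (\<theta> * of_int y))\<bar> < 1/2" .
  qed
  then show ?thesis by (simp add: phi_def distrib_left sum.distrib)
qed

lemma phi_0 [simp]: "phi \<Theta> \<beta> \<alpha> 0 = 0" by (simp add: phi_def)

lemma phi_diff:
  assumes L: "L > 0" and \<Theta>: "finite \<Theta>" and s: "bnorm \<Theta> L x + 2 * bnorm \<Theta> L y < 1/2"
  shows "phi \<Theta> \<beta> \<alpha> (x - y) = phi \<Theta> \<beta> \<alpha> x - phi \<Theta> \<beta> \<alpha> y"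
proof -
  have "bnorm \<Theta> L (x - y) + bnorm \<Theta> L y < 1/2" using bnorm_diff[OF L, of \<Theta> x y] s by linarith
  from phi_add[OF L \<Theta> this] show ?thesis by simp
qed

lemma sum_shift_support:
  fixes G :: "int \<Rightarrow> 'a::comm_monoid_add"
  assumes "finite X" "finite Y" and "\<And>n. G n \<noteq> 0 \<Longrightarrow> n \<in> Y \<and> n - s \<in> X"
  shows "(\<Sum>x\<in>X. G (x + s)) = (\<Sum>n\<in>Y. G n)"
proof -
  have "(\<Sum>x\<in>X. G (x + s)) = (\<Sum>n\<in>(\<lambda>x. x + s) ` X. G n)" by (subst sum.reindex) (auto simp: inj_on_def)
  also have "\<dots> = (\<Sum>n\<in>Y. G n)"
  proof (rule sum.mono_neutral_cong)
    fix n assume n: "n \<in> Y - (\<lambda>x. x + s) ` X"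
    show "G n = 0"
    proof (rule ccontr)
      assume "G n \<noteq> 0"
      then have "n - s + s \<in> (\<lambda>x. x + s) ` X" using assms(3) by blast
      then show False using n by simp
    qed
  qed (use assms in auto)
  finally show ?thesis .
qed

text \<open>Averaging over all translates loses nothing that depends on the weight \<open>w\<close>.\<close>
lemma localise:
  fixes g :: "int \<Rightarrow> int \<Rightarrow> complex" and M q :: int and w :: "int \<Rightarrow> real"
  assumes M: "M > 0" and B: "finite B" "\<And>y. y \<in> B \<Longrightarrow> \<bar>q * y\<bar> \<le> M"
    and w: "\<And>y. w y \<ge> 0"
    and g: "\<And>k n. g k n \<noteq> 0 \<Longrightarrow> \<bar>k\<bar> \<le> M \<and> n \<in> {0..<M}"
  obtains x k1 where "\<bar>x\<bar> \<le> 2 * M"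
    "cmod (\<Sum>y\<in>B. \<Sum>z\<in>B. w y * w z * g (k1 + q * z) (x + q * y))
       \<ge> (\<Sum>y\<in>B. w y)\<^sup>2 * cmod (\<Sum>k\<in>{- M..M}. \<Sum>n\<in>{0..<M}. g k n) / (20 * (of_int M)\<^sup>2)"
proof -
  define G where "G = (\<Sum>k\<in>{- M..M}. \<Sum>n\<in>{0..<M}. g k n)"
  \<comment> \<open>These ranges contain n - q y and k - q z whenever \<open>g k n\<close> is
    nonzero, so each pair (y, z) reproduces the full sum. Their sizes are at most 4 M and 5 M,
    whence 20 M^2.\<close>
  define X where "X = {- M..2 * M}"
  define Y where "Y = {- 2 * M..2 * M}"
  have shift: "(\<Sum>k1\<in>Y. \<Sum>x\<in>X. g (k1 + q * z) (x + q * y)) = G" if y: "y \<in> B" and z: "z \<in> B" for y z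
  proof -
    have 1: "(\<Sum>x\<in>X. g k (x + q * y)) = (\<Sum>n\<in>{0..<M}. g k n)" for k
    proof (rule sum_shift_support)
      fix n assume "g k n \<noteq> 0"
      then show "n \<in> {0..<M} \<and> n - q * y \<in> X" using g[of k n] B(2)[OF y] by (auto simp: X_def)
    qed (auto simp: X_def)
    have "(\<Sum>k1\<in>Y. \<Sum>x\<in>X. g (k1 + q * z) (x + q * y)) = (\<Sum>k1\<in>Y. \<Sum>n\<in>{0..<M}. g (k1 + q * z) n)"
      by (simp only: 1)
    also have "\<dots> = G" unfolding G_def
    proof (rule sum_shift_support)
      fix k assume "(\<Sum>n\<in>{0..<M}. g k n) \<noteq> 0"
      then obtain n where "g k n \<noteq> 0" using sum.not_neutral_contains_not_neutral by blast
      then show "k \<in> {- M..M} \<and> k - q * z \<in> Y" using g[of k n] B(2)[OF z] by (auto simp: Y_def)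
    qed (auto simp: Y_def)
    finally show ?thesis .
  qed
  define T where "T k1 x = (\<Sum>y\<in>B. \<Sum>z\<in>B. w y * w z * g (k1 + q * z) (x + q * y))" for k1 x
  have "(\<Sum>k1\<in>Y. \<Sum>x\<in>X. T k1 x) = (\<Sum>y\<in>B. \<Sum>z\<in>B. \<Sum>k1\<in>Y. \<Sum>x\<in>X. w y * w z * g (k1 + q * z) (x + q * y))"
    unfolding T_def
    by (simp only: sum.swap[of _ B X]) (simp only: sum.swap[of _ B Y])
  also have "\<dots> = (\<Sum>y\<in>B. \<Sum>z\<in>B. w y * w z * G)"
    by (intro sum.cong refl) (simp only: sum_distrib_left[symmetric] shift)
  also have "\<dots> = (\<Sum>y\<in>B. w y)\<^sup>2 * G"
    by (simp add: power2_eq_square sum_distrib_left sum_distrib_right mult_ac)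
  finally have tot: "(\<Sum>k1\<in>Y. \<Sum>x\<in>X. T k1 x) = (\<Sum>y\<in>B. w y)\<^sup>2 * G" .
  have "\<exists>p\<in>Y \<times> X. \<forall>l\<in>Y \<times> X. cmod (T (fst l) (snd l)) \<le> cmod (T (fst p) (snd p))"
    using M by (intro ex_argmax) (auto simp: X_def Y_def)
  then obtain k1 x where x: "x \<in> X" and mx: "\<And>k1' x'. k1' \<in> Y \<Longrightarrow> x' \<in> X \<Longrightarrow> cmod (T k1' x') \<le> cmod (T k1 x)" by force
  have "(\<Sum>y\<in>B. w y)\<^sup>2 * cmod G = cmod (\<Sum>k1\<in>Y. \<Sum>x\<in>X. T k1 x)"
    unfolding tot by (simp add: norm_mult norm_power sum_nonneg w flip: of_real_sum)
  also have "\<dots> \<le> (\<Sum>k1'\<in>Y. \<Sum>x'\<in>X. cmod (T k1 x))"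
    using mx by (intro sum_norm_le) auto
  also have "\<dots> = (4 * of_int M + 1) * (3 * of_int M + 1) * cmod (T k1 x)"
    using M by (simp add: X_def Y_def)
  also have "\<dots> \<le> (5 * of_int M) * (4 * of_int M) * cmod (T k1 x)"
    using M by (intro mult_right_mono mult_mono) auto
  finally have "(\<Sum>y\<in>B. w y)\<^sup>2 * cmod G \<le> 20 * (of_int M)\<^sup>2 * cmod (T k1 x)" by (simp add: power2_eq_square mult_ac)
  then have "(\<Sum>y\<in>B. w y)\<^sup>2 * cmod G / (20 * (of_int M)\<^sup>2) \<le> cmod (T k1 x)" using M by (simp add: field_simps)
  then show ?thesis using that[of x k1] x unfolding T_def G_def X_def by auto
qed

text \<open>With n = x + q y and k = k1 + q z, additivity on the Bohr set splits the phase \<phi>(k)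
  n into a function of z, a linear phase in y and the bilinear q^2 \<phi>(z) y. The step q = 1
  serves for the symmetry, q = 2 for the integration.\<close>

lemma localised_trilinear:
  fixes M q :: int and w :: "int \<Rightarrow> real" and F1 f2 :: "int \<Rightarrow> complex"
  assumes M: "M > 0" and \<Theta>: "finite \<Theta>" and K: "K \<subseteq> bohr \<Theta> (of_int M) (1/64)"
    and F1: "\<And>m. cmod (F1 m) \<le> 1" and f2: "\<And>n. n \<notin> {0..<M} \<Longrightarrow> f2 n = 0"
    and big: "(\<Sum>k\<in>K. cmod (\<Sum>n\<in>{0..<M}. F1 (n + k) * f2 n * e (phi \<Theta> \<beta> \<alpha> k * of_int n))) \<ge> c1 * (of_int M)\<^sup>2"
    and B: "B \<subseteq> bohr \<Theta> (of_int M) (1/64)" and w: "\<And>y. w y \<ge> 0" and q: "q = 1 \<or> q = 2"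
  obtains x \<sigma> Fm Hz where "\<bar>x\<bar> \<le> 2 * M" "\<And>m. cmod (Fm m) \<le> 1" "\<And>m. cmod (Hz m) \<le> 1"
    "cmod (\<Sum>y\<in>B. \<Sum>z\<in>B. w y * w z * (Fm (y + z) * (f2 (x + q * y) * e (\<sigma> * of_int y)) * Hz z
        * e (of_int (q\<^sup>2) * phi \<Theta> \<beta> \<alpha> z * of_int y))) \<ge> c1 / 20 * (\<Sum>y\<in>B. w y)\<^sup>2"
proof -
  have MR: "real_of_int M > 0" using M by simp
  let ?\<phi> = "phi \<Theta> \<beta> \<alpha>"
  define S where "S k = (\<Sum>n\<in>{0..<M}. F1 (n + k) * f2 n * e (?\<phi> k * of_int n))" for k
  \<comment> \<open>These factors absorb the absolute values and the restriction to
    \<open>K\<close>; as functions of \<open>k\<close> alone they end up in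
    \<open>Hz\<close>.\<close>
  define b where "b k = (if k \<in> K then cnj (sgn (S k)) else 0)" for k
  have bb: "cmod (b k) \<le> 1" for k by (simp add: b_def norm_sgn)
  define g where "g k n = b k * (F1 (n + k) * f2 n * e (?\<phi> k * of_int n))" for k n
  have finK: "finite K" using K finite_bohr[OF MR] finite_subset by blast
  have bohrM: "\<bar>k\<bar> \<le> M" "\<bar>2 * k\<bar> \<le> M" if "k \<in> bohr \<Theta> (of_int M) (1/64)" for k
  proof -
    have "\<bar>real_of_int k\<bar> \<le> of_int M * bnorm \<Theta> (of_int M) k" by (rule abs_le_bnorm[OF MR])
    also have "\<dots> \<le> of_int M * (1/64)" using MR that by (intro mult_left_mono) (auto simp: bohr_def)
    finally show "\<bar>k\<bar> \<le> M" "\<bar>2 * k\<bar> \<le> M" using MR by linarith+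
  qed
  have finB: "finite B" using B finite_bohr[OF MR] finite_subset by blast
  have qB: "\<bar>q * y\<bar> \<le> M" if "y \<in> B" for y using q bohrM[of y] B that by auto
  have gs: "\<bar>k\<bar> \<le> M \<and> n \<in> {0..<M}" if "g k n \<noteq> 0" for k n
    using that K f2 bohrM unfolding g_def b_def by (auto split: if_splits)
  obtain x k1 where x: "\<bar>x\<bar> \<le> 2 * M" and loc: "cmod (\<Sum>y\<in>B. \<Sum>z\<in>B. w y * w z * g (k1 + q * z) (x + q * y))
       \<ge> (\<Sum>y\<in>B. w y)\<^sup>2 * cmod (\<Sum>k\<in>{- M..M}. \<Sum>n\<in>{0..<M}. g k n) / (20 * (of_int M)\<^sup>2)"
    by (rule localise[of M B q w g, OF M finB qB w gs])
  have "(\<Sum>k\<in>{- M..M}. \<Sum>n\<in>{0..<M}. g k n) = (\<Sum>k\<in>K. \<Sum>n\<in>{0..<M}. g k n)"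
  proof (rule sum.mono_neutral_right)
    show "K \<subseteq> {- M..M}"
    proof
      fix k assume "k \<in> K"
      then have "\<bar>k\<bar> \<le> M" using K bohrM by blast
      then show "k \<in> {- M..M}" by auto
    qed
    show "\<forall>k\<in>{- M..M} - K. (\<Sum>n\<in>{0..<M}. g k n) = 0" by (auto simp: g_def b_def)
  qed auto
  also have "\<dots> = (\<Sum>k\<in>K. b k * S k)" by (simp add: g_def S_def sum_distrib_left)
  also have "\<dots> = (\<Sum>k\<in>K. complex_of_real (cmod (S k)))"
    by (intro sum.cong refl) (simp add: b_def sgn_eq complex_norm_square[symmetric] power2_eq_square mult.commute)
  finally have "cmod (\<Sum>k\<in>{- M..M}. \<Sum>n\<in>{0..<M}. g k n) = (\<Sum>k\<in>K. cmod (S k))"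
    by (simp add: sum_nonneg flip: of_real_sum)
  then have "cmod (\<Sum>k\<in>{- M..M}. \<Sum>n\<in>{0..<M}. g k n) \<ge> c1 * (of_int M)\<^sup>2" using big by (simp add: S_def)
  then have "(\<Sum>y\<in>B. w y)\<^sup>2 * (c1 * (of_int M)\<^sup>2) / (20 * (of_int M)\<^sup>2)
     \<le> (\<Sum>y\<in>B. w y)\<^sup>2 * cmod (\<Sum>k\<in>{- M..M}. \<Sum>n\<in>{0..<M}. g k n) / (20 * (of_int M)\<^sup>2)"
    by (intro divide_right_mono mult_left_mono) auto
  moreover have "(\<Sum>y\<in>B. w y)\<^sup>2 * (c1 * (of_int M)\<^sup>2) / (20 * (of_int M)\<^sup>2) = c1 / 20 * (\<Sum>y\<in>B. w y)\<^sup>2"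
    using M by simp
  ultimately have loc': "c1 / 20 * (\<Sum>y\<in>B. w y)\<^sup>2 \<le> cmod (\<Sum>y\<in>B. \<Sum>z\<in>B. w y * w z * g (k1 + q * z) (x + q * y))"
    using loc by linarith
  define Fm where "Fm m = F1 (x + k1 + q * m)" for m
  define Hz where "Hz z = b (k1 + q * z) * e (?\<phi> (k1 + q * z) * of_int x)" for z
  define \<sigma> where "\<sigma> = ?\<phi> k1 * of_int q"
  have eq: "g (k1 + q * z) (x + q * y) = Fm (y + z) * (f2 (x + q * y) * e (\<sigma> * of_int y)) * Hz z
        * e (of_int (q\<^sup>2) * ?\<phi> z * of_int y)" if z: "z \<in> B" for y z
  proof (cases "k1 + q * z \<in> K")
    case False
    then show ?thesis by (simp add: g_def Hz_def b_def)
  next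
    case True
    have zb: "bnorm \<Theta> (of_int M) z \<le> 1/64" using B z by (auto simp: bohr_def)
    have phiq: "?\<phi> (q * z) = of_int q * ?\<phi> z" and qz: "bnorm \<Theta> (of_int M) (q * z) \<le> 2/64"
      using q phi_add[OF MR \<Theta>, of z z] bnorm_add[OF MR, of \<Theta> z z] zb by auto
    have kb: "bnorm \<Theta> (of_int M) (k1 + q * z) \<le> 1/64" using True K by (auto simp: bohr_def)
    \<comment> \<open>Only k1 + q z is known to lie in the Bohr set, not k1 itself, hence the detour
      through a difference.\<close>
    have "?\<phi> (k1 + q * z - q * z) = ?\<phi> (k1 + q * z) - ?\<phi> (q * z)"
      by (rule phi_diff[OF MR \<Theta>]) (use kb qz in linarith)
    then have ph: "?\<phi> (k1 + q * z) = ?\<phi> k1 + of_int q * ?\<phi> z" using phiq by simp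
    have "e (?\<phi> (k1 + q * z) * of_int (x + q * y)) = e (?\<phi> (k1 + q * z) * of_int x) * e (\<sigma> * of_int y) * e (of_int (q\<^sup>2) * ?\<phi> z * of_int y)"
      unfolding e_add[symmetric]
      by (rule arg_cong[of _ _ e]) (simp add: ph \<sigma>_def algebra_simps power2_eq_square)
    moreover have "F1 (x + q * y + (k1 + q * z)) = F1 (x + k1 + q * (y + z))"
      by (rule arg_cong[of _ _ F1]) (simp add: algebra_simps)
    ultimately show ?thesis by (simp add: g_def Fm_def Hz_def mult_ac)
  qed
  show ?thesis
  proof (rule that[of x Fm Hz \<sigma>])
    show "cmod (Fm m) \<le> 1" for m by (simp add: Fm_def F1)
    show "cmod (Hz m) \<le> 1" for m by (simp add: Hz_def norm_mult bb)
    show "cmod (\<Sum>y\<in>B. \<Sum>z\<in>B. w y * w z * (Fm (y + z) * (f2 (x + q * y) * e (\<sigma> * of_int y)) * Hz z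
        * e (of_int (q\<^sup>2) * ?\<phi> z * of_int y))) \<ge> c1 / 20 * (\<Sum>y\<in>B. w y)\<^sup>2"
      using loc' eq by (simp cong: sum.cong)
  qed (rule x)
qed

section \<open>Approximate symmetry\<close>

lemma max_ge_average:
  fixes f :: "'a \<Rightarrow> real"
  assumes "finite S" "S \<noteq> {}" "real (card S) \<le> N" "\<And>s. s \<in> S \<Longrightarrow> f s \<ge> 0"
  obtains s where "s \<in> S" "(\<Sum>s\<in>S. f s) \<le> N * f s"
proof -
  obtain s where s: "s \<in> S" "\<forall>l\<in>S. f l \<le> f s" using ex_argmax[OF assms(1,2)] by blast
  have "(\<Sum>l\<in>S. f l) \<le> (\<Sum>l\<in>S. f s)" using s by (intro sum_mono) auto
  also have "\<dots> \<le> N * f s" using assms s by (simp add: mult_right_mono)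
  finally show ?thesis using that s by blast
qed

lemma norm_sum_sq_le:
  assumes "finite S"
  shows "(cmod (\<Sum>s\<in>S. f s))\<^sup>2 \<le> real (card S) * (\<Sum>s\<in>S. (cmod (f s))\<^sup>2)"
proof -
  have "cmod (\<Sum>s\<in>S. f s) \<le> (\<Sum>s\<in>S. cmod (f s))" by (rule norm_sum)
  then have "(cmod (\<Sum>s\<in>S. f s))\<^sup>2 \<le> (\<Sum>s\<in>S. cmod (f s) * 1)\<^sup>2" by (intro power_mono) auto
  also have "\<dots> \<le> (\<Sum>s\<in>S. (cmod (f s))\<^sup>2) * (\<Sum>s\<in>S. 1\<^sup>2)" by (rule Cauchy_Schwarz_ineq_sum)
  finally show ?thesis by (simp add: mult.commute)
qed

definition psi :: "real set \<Rightarrow> real \<Rightarrow> (real \<Rightarrow> real) \<Rightarrow> int \<Rightarrow> int \<Rightarrow> real" where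
  "psi \<Theta> \<beta> \<alpha> a b = phi \<Theta> \<beta> \<alpha> a * of_int b - phi \<Theta> \<beta> \<alpha> b * of_int a"

text \<open>At least 1 at radius 1/64 and zero from 1/32 on, with Lipschitz constant 64 in the
  gauge: a shift by t costs a multiple of the norm of t, which stands in for regularity of the Bohr
  set.\<close>

definition tent :: "real set \<Rightarrow> int \<Rightarrow> int \<Rightarrow> real" where
  "tent \<Theta> M m = max 0 (2 - 64 * bnorm \<Theta> (of_int M) m)"

text \<open>A smoothed exponential sum in the first argument of \<open>psi\<close>, large only if
  \<open>psi\<close> is nearly trivial in that argument, as \<open>antisymmetric_form_small\<close>
  makes precise.\<close>

definition antisym_sum :: "real set \<Rightarrow> real \<Rightarrow> (real \<Rightarrow> real) \<Rightarrow> int \<Rightarrow> int \<Rightarrow> complex" where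
  "antisym_sum \<Theta> \<beta> \<alpha> M w = (\<Sum>m\<in>{- M..M}. of_real (tent \<Theta> M m) * e (psi \<Theta> \<beta> \<alpha> m w))"

lemma bohr_subset_M:
  assumes "M > 0" "\<rho> \<le> 1" shows "bohr \<Theta> (of_int M) \<rho> \<subseteq> {- M..M}"
proof
  fix k assume k: "k \<in> bohr \<Theta> (of_int M) \<rho>"
  have "\<bar>real_of_int k\<bar> \<le> of_int M * bnorm \<Theta> (of_int M) k" using assms by (intro abs_le_bnorm) simp
  also have "\<dots> \<le> of_int M * 1" using assms k by (intro mult_left_mono) (auto simp: bohr_def)
  finally show "k \<in> {- M..M}" by (simp add: abs_le_iff)
qed

lemma card_symmetric_interval: "M > 0 \<Longrightarrow> real (card {- M..M}) \<le> 3 * of_int M"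
  by simp

lemma card_bohr_le:
  assumes "M > 0" "\<rho> \<le> 1" shows "real (card (bohr \<Theta> (of_int M) \<rho>)) \<le> 3 * of_int M"
proof -
  have "card (bohr \<Theta> (of_int M) \<rho>) \<le> card {- M..M}" using bohr_subset_M[OF assms] by (intro card_mono) auto
  then show ?thesis using card_symmetric_interval[OF assms(1)] by linarith
qed

lemma tent_nonneg: "tent \<Theta> M m \<ge> 0" by (simp add: tent_def)
lemma tent_le_2: "M > 0 \<Longrightarrow> tent \<Theta> M m \<le> 2"
  using bnorm_nonneg[of "of_int M" \<Theta> m] by (simp add: tent_def)
lemma tent_support: "tent \<Theta> M m \<noteq> 0 \<Longrightarrow> bnorm \<Theta> (of_int M) m < 1/32" by (auto simp: tent_def max_def split: if_splits)
lemma tent_lipschitz: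
  assumes M: "M > 0" shows "\<bar>tent \<Theta> M m - tent \<Theta> M (m - t)\<bar> \<le> 64 * bnorm \<Theta> (of_int M) t"
  using bnorm_add[of "of_int M" \<Theta> "m - t" t] bnorm_diff[of "of_int M" \<Theta> m t] M bnorm_nonneg[of "of_int M" \<Theta> t]
  unfolding tent_def by auto

lemma antisym_sum_le: assumes M: "M > 0" shows "cmod (antisym_sum \<Theta> \<beta> \<alpha> M w) \<le> 6 * of_int M"
proof -
  have "cmod (antisym_sum \<Theta> \<beta> \<alpha> M w) \<le> (\<Sum>m\<in>{- M..M}. 2)"
    unfolding antisym_sum_def using tent_nonneg tent_le_2[OF M]
    by (intro sum_norm_le) (auto simp: norm_mult)
  then show ?thesis using card_symmetric_interval[OF M] by simp
qed

text \<open>The substitution \<open>p = m + m' - y\<close> makes the phase antisymmetric up to terms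
  depending on \<open>m\<close> or \<open>m'\<close> alone.\<close>
lemma antisymmetric_bilinear_bias:
  fixes M :: int and c2 cB :: real and F G H :: "int \<Rightarrow> complex"
  assumes M: "M > 0" and \<Theta>: "finite \<Theta>"
    and F: "\<And>m. cmod (F m) \<le> 1" and G: "\<And>m. cmod (G m) \<le> 1" and H: "\<And>m. cmod (H m) \<le> 1"
    and c: "c2 > 0" "cB > 0"
  defines "B \<equiv> bohr \<Theta> (of_int M) (1/128)"
  assumes Bc: "real (card B) \<ge> cB * of_int M"
    and big: "cmod (\<Sum>y\<in>B. \<Sum>z\<in>B. F (y + z) * G y * H z * e (phi \<Theta> \<beta> \<alpha> z * of_int y)) \<ge> c2 * (real (card B))\<^sup>2"
  obtains u v where "\<And>m. cmod (u m) \<le> 1" "\<And>m. cmod (v m) \<le> 1"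
    "cmod (\<Sum>m\<in>bohr \<Theta> (of_int M) (1/64). \<Sum>m'\<in>bohr \<Theta> (of_int M) (1/64). u m * v m' * e (psi \<Theta> \<beta> \<alpha> m m'))
      \<ge> c2\<^sup>2 * real (card B) ^ 3 / (3 * of_int M)"
proof -
  have MR: "real_of_int M > 0" using M by simp
  let ?\<phi> = "phi \<Theta> \<beta> \<alpha>"
  let ?b = "bnorm \<Theta> (of_int M)"
  define X where "X = bohr \<Theta> (of_int M) (1/64)"
  have finB: "finite B" and finX: "finite X" unfolding B_def X_def by (rule finite_bohr[OF MR])+
  have Bpos: "real (card B) > 0" using Bc c MR by (smt (verit) mult_pos_pos)
  \<comment> \<open>The extension by zero carries the condition m - y \<in> B after the substitution
    m = y + z.\<close>
  define H' where "H' z = (if z \<in> B then H z else 0)" for z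
  have H'1: "cmod (H' z) \<le> 1" for z using H by (simp add: H'_def)
  define T where "T y = (\<Sum>m\<in>X. F m * H' (m - y) * e (?\<phi> m * of_int y))" for y
  have inner: "(\<Sum>z\<in>B. F (y + z) * G y * H z * e (?\<phi> z * of_int y)) = G y * e (- ?\<phi> y * of_int y) * T y" if y: "y \<in> B" for y
  proof -
    have "(\<Sum>z\<in>B. F (y + z) * G y * H z * e (?\<phi> z * of_int y))
       = (\<Sum>z\<in>B. F (z + y) * H' ((z + y) - y) * e (?\<phi> (z + y) * of_int y) * (G y * e (- ?\<phi> y * of_int y)))"
    proof (intro sum.cong refl)
      fix z assume z: "z \<in> B"
      have "?b z + ?b y < 1/2" using y z by (auto simp: B_def bohr_def)
      then have "?\<phi> (z + y) = ?\<phi> z + ?\<phi> y" by (rule phi_add[OF MR \<Theta>])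
      then have "e (?\<phi> z * of_int y) = e (?\<phi> (z + y) * of_int y) * e (- ?\<phi> y * of_int y)"
        unfolding e_add[symmetric] by (simp add: algebra_simps)
      then show "F (y + z) * G y * H z * e (?\<phi> z * of_int y) = F (z + y) * H' ((z + y) - y) * e (?\<phi> (z + y) * of_int y) * (G y * e (- ?\<phi> y * of_int y))"
        using z by (simp add: H'_def add.commute mult_ac)
    qed
    also have "\<dots> = (\<Sum>m\<in>{m \<in> X. m - y \<in> B}. F m * H' (m - y) * e (?\<phi> m * of_int y) * (G y * e (- ?\<phi> y * of_int y)))"
    proof (rule sum.reindex_bij_witness[of _ "\<lambda>m. m - y" "\<lambda>z. z + y"])
      fix z assume z: "z \<in> B"
      then show "z + y \<in> {m \<in> X. m - y \<in> B}"
        using bnorm_add[OF MR, of \<Theta> z y] y by (auto simp: B_def X_def bohr_def)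
    qed auto
    also have "\<dots> = (\<Sum>m\<in>X. F m * H' (m - y) * e (?\<phi> m * of_int y) * (G y * e (- ?\<phi> y * of_int y)))"
      by (rule sum.mono_neutral_left) (use finX in \<open>auto simp: H'_def\<close>)
    also have "\<dots> = G y * e (- ?\<phi> y * of_int y) * T y" unfolding T_def sum_distrib_left
      by (simp add: mult_ac)
    finally show ?thesis .
  qed
  have "(c2 * (real (card B))\<^sup>2)\<^sup>2 \<le> (cmod (\<Sum>y\<in>B. G y * e (- ?\<phi> y * of_int y) * T y))\<^sup>2"
    using big c inner by (intro power_mono) auto
  also have "\<dots> \<le> real (card B) * (\<Sum>y\<in>B. (cmod (G y * e (- ?\<phi> y * of_int y) * T y))\<^sup>2)"
    by (rule norm_sum_sq_le[OF finB])
  also have "\<dots> \<le> real (card B) * (\<Sum>y\<in>{- M..M}. (cmod (T y))\<^sup>2)"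
  proof (rule mult_left_mono)
    have "(\<Sum>y\<in>B. (cmod (G y * e (- ?\<phi> y * of_int y) * T y))\<^sup>2) \<le> (\<Sum>y\<in>B. (cmod (T y))\<^sup>2)"
      using G by (intro sum_mono power_mono) (auto simp: norm_mult mult_left_le_one_le)
    also have "\<dots> \<le> (\<Sum>y\<in>{- M..M}. (cmod (T y))\<^sup>2)"
      using bohr_subset_M[OF M, of "1/128" \<Theta>] by (intro sum_mono2) (auto simp: B_def)
    finally show "(\<Sum>y\<in>B. (cmod (G y * e (- ?\<phi> y * of_int y) * T y))\<^sup>2) \<le> (\<Sum>y\<in>{- M..M}. (cmod (T y))\<^sup>2)" .
  qed auto
  finally have "real (card B) * (c2\<^sup>2 * real (card B) ^ 3) \<le> real (card B) * (\<Sum>y\<in>{- M..M}. (cmod (T y))\<^sup>2)"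
    by (simp add: power_mult_distrib eval_nat_numeral mult_ac)
  then have 1: "c2\<^sup>2 * real (card B) ^ 3 \<le> (\<Sum>y\<in>{- M..M}. (cmod (T y))\<^sup>2)" using Bpos by (simp add: mult_le_cancel_left)
  \<comment> \<open>With y = m + m' - p the arguments m - y and m' - y become p - m' and p - m, so
    for fixed p each weight involves one variable only.\<close>
  define u where "u p m = F m * cnj (H' (p - m)) * e (?\<phi> m * of_int m - ?\<phi> m * of_int p)" for p m
  define v where "v p m = cnj (F m) * H' (p - m) * e (?\<phi> m * of_int p - ?\<phi> m * of_int m)" for p m
  define R where "R p = (\<Sum>m\<in>X. \<Sum>m'\<in>X. u p m * v p m' * e (psi \<Theta> \<beta> \<alpha> m m'))" for p
  define t where "t m m' y = (F m * H' (m - y) * e (?\<phi> m * of_int y)) * cnj (F m' * H' (m' - y) * e (?\<phi> m' * of_int y))" for m m' y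
  have tp: "t m m' (m + m' - p) = u p m * v p m' * e (psi \<Theta> \<beta> \<alpha> m m')" for m m' p
  proof -
    have "e (?\<phi> m * of_int (m + m' - p)) * cnj (e (?\<phi> m' * of_int (m + m' - p)))
       = e (?\<phi> m * of_int m - ?\<phi> m * of_int p) * e (?\<phi> m' * of_int p - ?\<phi> m' * of_int m') * e (psi \<Theta> \<beta> \<alpha> m m')"
      unfolding cnj_e e_add[symmetric] psi_def by (rule arg_cong[of _ _ e]) (simp add: algebra_simps)
    then show ?thesis unfolding t_def u_def v_def by (simp add: mult_ac)
  qed
  have tneg: "(\<Sum>y\<in>{- M..M}. t m m' y) = (\<Sum>p\<in>{- M..M}. t m m' (m + m' - p))" if m: "m \<in> X" "m' \<in> X" for m m'
  proof -
    have supp: "?b (m - y) \<le> 1/128 \<and> ?b (m' - y) \<le> 1/128" if "t m m' y \<noteq> 0" for y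
      using that by (auto simp: t_def H'_def B_def bohr_def split: if_splits)
    have mb: "?b m \<le> 1/64" "?b m' \<le> 1/64" using m by (auto simp: X_def bohr_def)
    have inM: "y \<in> {- M..M}" if "?b y \<le> 1" for y using that bohr_subset_M[OF M, of 1 \<Theta>] by (auto simp: bohr_def)
    have "(\<Sum>p\<in>{- M..M}. t m m' (m + m' - p)) = (\<Sum>q\<in>uminus ` {- M..M}. t m m' (q + (m + m')))"
      by (subst sum.reindex) (auto simp: algebra_simps)
    also have "uminus ` {- M..M} = {- M..M}" by simp
    also have "(\<Sum>q\<in>{- M..M}. t m m' (q + (m + m'))) = (\<Sum>y\<in>{- M..M}. t m m' y)"
    proof (rule sum_shift_support)
      fix y assume "t m m' y \<noteq> 0"
      note s = supp[OF this]
      have y: "y = m - (m - y)" "y - (m + m') = - ((m - y) + m')" by auto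
      have "?b y \<le> ?b m + ?b (m - y)" by (subst y(1)) (rule bnorm_diff[OF MR])
      moreover have "?b (y - (m + m')) \<le> ?b (m - y) + ?b m'" unfolding y(2) bnorm_minus by (rule bnorm_add[OF MR])
      ultimately show "y \<in> {- M..M} \<and> y - (m + m') \<in> {- M..M}" using s mb by (auto intro!: inM simp del: atLeastAtMost_iff)
    qed auto
    finally show ?thesis by simp
  qed
  have "complex_of_real (\<Sum>y\<in>{- M..M}. (cmod (T y))\<^sup>2) = (\<Sum>y\<in>{- M..M}. \<Sum>m\<in>X. \<Sum>m'\<in>X. t m m' y)"
    unfolding of_real_sum T_def cmod_sum_sq t_def by simp
  also have "\<dots> = (\<Sum>m\<in>X. \<Sum>m'\<in>X. \<Sum>y\<in>{- M..M}. t m m' y)"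
    by (subst sum.swap, rule sum.cong[OF refl]) (rule sum.swap)
  also have "\<dots> = (\<Sum>m\<in>X. \<Sum>m'\<in>X. \<Sum>p\<in>{- M..M}. t m m' (m + m' - p))"
    by (rule sum.cong[OF refl], rule sum.cong[OF refl], rule tneg)
  also have "\<dots> = (\<Sum>m\<in>X. \<Sum>p\<in>{- M..M}. \<Sum>m'\<in>X. t m m' (m + m' - p))" by (intro sum.cong refl sum.swap)
  also have "\<dots> = (\<Sum>p\<in>{- M..M}. R p)" unfolding R_def tp by (rule sum.swap)
  finally have 2: "complex_of_real (\<Sum>y\<in>{- M..M}. (cmod (T y))\<^sup>2) = (\<Sum>p\<in>{- M..M}. R p)" .
  have "(\<Sum>y\<in>{- M..M}. (cmod (T y))\<^sup>2) = cmod (\<Sum>p\<in>{- M..M}. R p)"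
    unfolding 2[symmetric] norm_of_real by (simp add: sum_nonneg)
  also have "\<dots> \<le> (\<Sum>p\<in>{- M..M}. cmod (R p))" by (rule norm_sum)
  finally have 3: "c2\<^sup>2 * real (card B) ^ 3 \<le> (\<Sum>p\<in>{- M..M}. cmod (R p))" using 1 by linarith
  obtain p where p: "(\<Sum>p\<in>{- M..M}. cmod (R p)) \<le> (3 * of_int M) * cmod (R p)"
    using max_ge_average[of "{- M..M}" "3 * of_int M" "\<lambda>p. cmod (R p)"] card_symmetric_interval[OF M] M by auto
  have "c2\<^sup>2 * real (card B) ^ 3 / (3 * of_int M) \<le> cmod (R p)" using 3 p MR by (simp add: field_simps)
  moreover have "cmod (u p m) \<le> 1" "cmod (v p m) \<le> 1" for m
    using F H'1 by (auto simp: u_def v_def norm_mult mult_le_one)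
  ultimately show ?thesis using that[of "u p" "v p"] unfolding R_def X_def by blast
qed

text \<open>Cauchy-Schwarz in m removes \<open>u\<close>, and the sharp cutoff in m is majorised by
  \<open>tent\<close> at that moment. Expanding the square makes \<open>v\<close> harmless and
  leaves sums that depend on m' - l only, by additivity in the second argument; a good
  \<open>l\<close> and popularity then give \<open>W\<close>.\<close>

lemma antisymmetric_bias_large_set:
  fixes M :: int and c2 cB :: real and u v :: "int \<Rightarrow> complex"
  assumes M: "M > 0" and \<Theta>: "finite \<Theta>"
    and u: "\<And>m. cmod (u m) \<le> 1" and v: "\<And>m. cmod (v m) \<le> 1" and c: "\<kappa> > 0" "cB > 0"
  defines "X \<equiv> bohr \<Theta> (of_int M) (1/64)"
  assumes Xc: "real (card X) \<ge> cB * of_int M"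
    and big: "cmod (\<Sum>m\<in>X. \<Sum>m'\<in>X. u m * v m' * e (psi \<Theta> \<beta> \<alpha> m m')) \<ge> \<kappa> * (of_int M)\<^sup>2"
  obtains W where "W \<subseteq> bohr \<Theta> (of_int M) (1/32)" "real (card W) \<ge> \<kappa>\<^sup>2 / 54 * cB / 6 * of_int M"
    "\<And>w. w \<in> W \<Longrightarrow> cmod (antisym_sum \<Theta> \<beta> \<alpha> M w) \<ge> \<kappa>\<^sup>2 / 54 * of_int M"
proof -
  have MR: "real_of_int M > 0" using M by simp
  let ?\<phi> = "phi \<Theta> \<beta> \<alpha>"
  let ?\<psi> = "psi \<Theta> \<beta> \<alpha>"
  let ?b = "bnorm \<Theta> (of_int M)"
  let ?Y = "antisym_sum \<Theta> \<beta> \<alpha> M"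
  have finX: "finite X" unfolding X_def by (rule finite_bohr[OF MR])
  have X3: "real (card X) \<le> 3 * of_int M" unfolding X_def by (rule card_bohr_le[OF M]) simp
  have Xpos: "real (card X) > 0" using Xc c MR by (smt (verit) mult_pos_pos)
  then have Xne: "X \<noteq> {}" by auto
  define V where "V m = (\<Sum>m'\<in>X. v m' * e (?\<psi> m m'))" for m
  have sub: "?\<psi> m m' - ?\<psi> m l = ?\<psi> m (m' - l)" if "m' \<in> X" "l \<in> X" for m m' l
  proof -
    have "?\<phi> (m' - l) = ?\<phi> m' - ?\<phi> l" by (rule phi_diff[OF MR \<Theta>]) (use that in \<open>auto simp: X_def bohr_def\<close>)
    then show ?thesis unfolding psi_def by (simp only:) (simp add: algebra_simps)
  qed
  have "(\<kappa> * (of_int M)\<^sup>2)\<^sup>2 \<le> (cmod (\<Sum>m\<in>X. u m * V m))\<^sup>2"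
    using big c unfolding V_def by (intro power_mono) (auto simp: sum_distrib_left mult.assoc)
  also have "\<dots> \<le> real (card X) * (\<Sum>m\<in>X. (cmod (u m * V m))\<^sup>2)" by (rule norm_sum_sq_le[OF finX])
  also have "\<dots> \<le> real (card X) * (\<Sum>m\<in>{- M..M}. tent \<Theta> M m * (cmod (V m))\<^sup>2)"
  proof (rule mult_left_mono)
    have "(\<Sum>m\<in>X. (cmod (u m * V m))\<^sup>2) \<le> (\<Sum>m\<in>X. tent \<Theta> M m * (cmod (V m))\<^sup>2)"
    proof (rule sum_mono)
      fix m assume "m \<in> X"
      then have "1 \<le> tent \<Theta> M m" by (simp add: X_def bohr_def tent_def)
      then have "1 * (cmod (V m))\<^sup>2 \<le> tent \<Theta> M m * (cmod (V m))\<^sup>2" by (intro mult_right_mono) auto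
      moreover have "(cmod (u m * V m))\<^sup>2 \<le> (cmod (V m))\<^sup>2" using u by (intro power_mono) (auto simp: norm_mult mult_left_le_one_le)
      ultimately show "(cmod (u m * V m))\<^sup>2 \<le> tent \<Theta> M m * (cmod (V m))\<^sup>2" by linarith
    qed
    also have "\<dots> \<le> (\<Sum>m\<in>{- M..M}. tent \<Theta> M m * (cmod (V m))\<^sup>2)"
      using bohr_subset_M[OF M, of "1/64" \<Theta>] tent_nonneg by (intro sum_mono2) (auto simp: X_def)
    finally show "(\<Sum>m\<in>X. (cmod (u m * V m))\<^sup>2) \<le> (\<Sum>m\<in>{- M..M}. tent \<Theta> M m * (cmod (V m))\<^sup>2)" .
  qed auto
  also have "(\<Sum>m\<in>{- M..M}. tent \<Theta> M m * (cmod (V m))\<^sup>2) \<le> (\<Sum>l\<in>X. \<Sum>m'\<in>X. cmod (?Y (m' - l)))"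
  proof -
    have "complex_of_real (\<Sum>m\<in>{- M..M}. tent \<Theta> M m * (cmod (V m))\<^sup>2)
       = (\<Sum>m\<in>{- M..M}. \<Sum>m'\<in>X. \<Sum>l\<in>X. v m' * cnj (v l) * (of_real (tent \<Theta> M m) * e (?\<psi> m (m' - l))))"
      unfolding of_real_sum of_real_mult V_def cmod_sum_sq sum_distrib_left
      by (intro sum.cong refl) (simp add: sub[symmetric] e_diff mult_ac)
    also have "\<dots> = (\<Sum>m'\<in>X. \<Sum>l\<in>X. v m' * cnj (v l) * ?Y (m' - l))"
      unfolding antisym_sum_def sum_distrib_left
      by (subst sum.swap, rule sum.cong[OF refl]) (rule sum.swap)
    also have "\<dots> = (\<Sum>l\<in>X. \<Sum>m'\<in>X. v m' * cnj (v l) * ?Y (m' - l))" by (rule sum.swap)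
    finally have eq: "complex_of_real (\<Sum>m\<in>{- M..M}. tent \<Theta> M m * (cmod (V m))\<^sup>2) = (\<Sum>l\<in>X. \<Sum>m'\<in>X. v m' * cnj (v l) * ?Y (m' - l))" .
    have "(\<Sum>m\<in>{- M..M}. tent \<Theta> M m * (cmod (V m))\<^sup>2) \<ge> 0"
      by (intro sum_nonneg mult_nonneg_nonneg tent_nonneg) auto
    then have "(\<Sum>m\<in>{- M..M}. tent \<Theta> M m * (cmod (V m))\<^sup>2) = cmod (\<Sum>l\<in>X. \<Sum>m'\<in>X. v m' * cnj (v l) * ?Y (m' - l))"
      unfolding eq[symmetric] norm_of_real by (rule abs_of_nonneg[symmetric])
    also have "\<dots> \<le> (\<Sum>l\<in>X. \<Sum>m'\<in>X. cmod (?Y (m' - l)))"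
    proof (intro sum_norm_le order_trans[OF norm_sum] sum_mono)
      fix l m'
      have "cmod (v m' * cnj (v l)) \<le> 1" using v by (simp add: norm_mult mult_le_one)
      then show "cmod (v m' * cnj (v l) * ?Y (m' - l)) \<le> cmod (?Y (m' - l))"
        unfolding norm_mult[of "v m' * cnj (v l)"] by (intro mult_left_le_one_le) auto
    qed
    finally show ?thesis .
  qed
  finally have 1: "(\<kappa> * (of_int M)\<^sup>2)\<^sup>2 \<le> real (card X) * (\<Sum>l\<in>X. \<Sum>m'\<in>X. cmod (?Y (m' - l)))"
    by (simp add: mult_left_mono)
  obtain l where l: "l \<in> X" "(\<Sum>l\<in>X. \<Sum>m'\<in>X. cmod (?Y (m' - l))) \<le> 3 * of_int M * (\<Sum>m'\<in>X. cmod (?Y (m' - l)))"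
    using max_ge_average[OF finX Xne X3, of "\<lambda>l. \<Sum>m'\<in>X. cmod (?Y (m' - l))"] by (auto simp: sum_nonneg)
  define Z where "Z = (\<Sum>m'\<in>X. cmod (?Y (m' - l)))"
  have Z0: "Z \<ge> 0" by (simp add: Z_def sum_nonneg)
  have "(\<kappa> * (of_int M)\<^sup>2)\<^sup>2 \<le> real (card X) * (3 * of_int M * Z)"
    using 1 l(2) unfolding Z_def by (meson mult_left_mono of_nat_0_le_iff order_trans)
  also have "\<dots> \<le> (3 * of_int M) * (3 * of_int M * Z)" using X3 Z0 MR by (intro mult_right_mono) auto
  finally have "(of_int M)\<^sup>2 * (\<kappa>\<^sup>2 * (of_int M)\<^sup>2) \<le> (of_int M)\<^sup>2 * (9 * Z)"
    by (simp add: power_mult_distrib power2_eq_square mult_ac)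
  then have Z: "\<kappa>\<^sup>2 * (of_int M)\<^sup>2 \<le> 9 * Z" using MR by (simp add: mult_le_cancel_left)
  \<comment> \<open>54 is 9 * 3 * 2: two factors 3 M lost above, the bound 3 M for the size of
    \<open>X\<close>, and the 2 in \<open>popular_card\<close>.\<close>
  define c3 where "c3 = \<kappa>\<^sup>2 / 54"
  have c3: "c3 > 0" using c by (simp add: c3_def)
  have "2 * (c3 * of_int M) * real (card X) \<le> 2 * (c3 * of_int M) * (3 * of_int M)"
    using X3 c3 MR by (intro mult_left_mono) auto
  also have "\<dots> \<le> Z" using Z by (simp add: c3_def power2_eq_square)
  finally have pop: "2 * (c3 * of_int M) * real (card X) \<le> (\<Sum>m'\<in>X. cmod (?Y (m' - l)))" by (simp add: Z_def)
  define W0 where "W0 = {m' \<in> X. cmod (?Y (m' - l)) \<ge> c3 * of_int M}"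
  have "real (card W0) * (6 * of_int M) \<ge> c3 * of_int M * real (card X)"
    unfolding W0_def using popular_card[OF finX antisym_sum_le[OF M] _ pop] c3 MR by simp
  then have "of_int M * (c3 * real (card X)) \<le> of_int M * (6 * real (card W0))" by (simp add: mult_ac)
  then have "c3 * real (card X) \<le> 6 * real (card W0)" using MR by (simp add: mult_le_cancel_left)
  moreover have "c3 * (cB * of_int M) \<le> c3 * real (card X)" using Xc c3 by (intro mult_left_mono) auto
  ultimately have W0: "real (card W0) \<ge> c3 * cB / 6 * of_int M" by simp
  define W where "W = (\<lambda>m'. m' - l) ` W0"
  have cW: "card W = card W0" unfolding W_def by (intro card_image) (auto simp: inj_on_def)
  show ?thesis
  proof (rule that[of W])
    show "W \<subseteq> bohr \<Theta> (of_int M) (1/32)"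
    proof
      fix w assume "w \<in> W"
      then obtain m' where "m' \<in> X" "w = m' - l" by (auto simp: W_def W0_def)
      then show "w \<in> bohr \<Theta> (of_int M) (1/32)" using l(1) bnorm_diff[OF MR, of \<Theta> m' l] by (auto simp: X_def bohr_def)
    qed
    show "real (card W) \<ge> \<kappa>\<^sup>2 / 54 * cB / 6 * of_int M" using W0 cW by (simp add: c3_def)
    show "cmod (?Y w) \<ge> \<kappa>\<^sup>2 / 54 * of_int M" if "w \<in> W" for w using that by (auto simp: W_def W0_def c3_def)
  qed
qed

text \<open>Multiplication by e(\<psi>(t, w)) translates the summation variable by t, which a
  Lipschitz weight hardly notices; a large sum therefore forces \<psi>(t, w) to be almost an
  integer. 192 is 3 * 64.\<close>

lemma antisymmetric_form_small:
  fixes M :: int and c3 :: real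
  assumes M: "M > 0" and \<Theta>: "finite \<Theta>" and Y: "cmod (antisym_sum \<Theta> \<beta> \<alpha> M w) \<ge> c3 * of_int M"
    and t: "bnorm \<Theta> (of_int M) t \<le> 1/128"
  shows "c3 * cmod (1 - e (psi \<Theta> \<beta> \<alpha> t w)) \<le> 192 * bnorm \<Theta> (of_int M) t"
proof -
  have MR: "real_of_int M > 0" using M by simp
  let ?\<phi> = "phi \<Theta> \<beta> \<alpha>"
  let ?\<psi> = "psi \<Theta> \<beta> \<alpha>"
  let ?b = "bnorm \<Theta> (of_int M)"
  let ?Y = "antisym_sum \<Theta> \<beta> \<alpha> M w"
  define G where "G n = of_real (tent \<Theta> M (n - t)) * e (?\<psi> n w)" for n
  have "e (?\<psi> t w) * ?Y = (\<Sum>m\<in>{- M..M}. G (m + t))"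
    unfolding antisym_sum_def sum_distrib_left
  proof (intro sum.cong refl)
    fix m
    show "e (?\<psi> t w) * (complex_of_real (tent \<Theta> M m) * e (?\<psi> m w)) = G (m + t)"
    proof (cases "tent \<Theta> M m = 0")
      case True then show ?thesis by (simp add: G_def)
    next
      case False
      have "?b m + ?b t < 1/2" using tent_support[OF False] t by linarith
      from phi_add[OF MR \<Theta> this] have "?\<psi> (m + t) w = ?\<psi> t w + ?\<psi> m w"
        unfolding psi_def by (simp only:) (simp add: algebra_simps)
      then show ?thesis by (simp add: G_def e_add mult_ac)
    qed
  qed
  also have "\<dots> = (\<Sum>n\<in>{- M..M}. G n)"
  proof (rule sum_shift_support)
    fix n assume "G n \<noteq> 0"
    then have "?b (n - t) < 1/32" by (intro tent_support) (auto simp: G_def)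
    moreover have "?b n \<le> ?b (n - t) + ?b t" using bnorm_add[OF MR, of \<Theta> "n - t" t] by simp
    ultimately have "n \<in> bohr \<Theta> (of_int M) 1" "n - t \<in> bohr \<Theta> (of_int M) 1" using t by (auto simp: bohr_def)
    then show "n \<in> {- M..M} \<and> n - t \<in> {- M..M}" using bohr_subset_M[OF M, of 1 \<Theta>] by blast
  qed auto
  finally have "(1 - e (?\<psi> t w)) * ?Y = (\<Sum>m\<in>{- M..M}. of_real (tent \<Theta> M m - tent \<Theta> M (m - t)) * e (?\<psi> m w))"
    by (simp add: left_diff_distrib G_def sum_subtractf antisym_sum_def)
  then have "cmod (1 - e (?\<psi> t w)) * cmod ?Y = cmod (\<Sum>m\<in>{- M..M}. of_real (tent \<Theta> M m - tent \<Theta> M (m - t)) * e (?\<psi> m w))"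
    by (metis norm_mult)
  also have "\<dots> \<le> (\<Sum>m\<in>{- M..M}. 64 * ?b t)"
  proof (rule sum_norm_le)
    fix m
    have "cmod (complex_of_real (tent \<Theta> M m - tent \<Theta> M (m - t)) * e (?\<psi> m w)) = \<bar>tent \<Theta> M m - tent \<Theta> M (m - t)\<bar>"
      by (simp add: norm_mult del: of_real_diff)
    then show "cmod (complex_of_real (tent \<Theta> M m - tent \<Theta> M (m - t)) * e (?\<psi> m w)) \<le> 64 * ?b t"
      using tent_lipschitz[OF M] by simp
  qed
  also have "\<dots> = real (card {- M..M}) * (64 * ?b t)" by simp
  also have "\<dots> \<le> (3 * of_int M) * (64 * ?b t)"
    by (rule mult_right_mono[OF card_symmetric_interval[OF M]]) (use bnorm_nonneg[OF MR] in simp)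
  finally have "cmod (1 - e (?\<psi> t w)) * cmod ?Y \<le> of_int M * (192 * ?b t)" by simp
  moreover have "cmod (1 - e (?\<psi> t w)) * (c3 * of_int M) \<le> cmod (1 - e (?\<psi> t w)) * cmod ?Y"
    using Y by (intro mult_left_mono) auto
  ultimately have "of_int M * (c3 * cmod (1 - e (?\<psi> t w))) \<le> of_int M * (192 * ?b t)" by (simp add: mult_ac)
  then show ?thesis using MR by (simp add: mult_le_cancel_left)
qed

lemma norm_1_minus_e_add: "cmod (1 - e (x + y)) \<le> cmod (1 - e x) + cmod (1 - e y)"
proof -
  have "1 - e (x + y) = (1 - e x) + e x * (1 - e y)" by (simp add: e_add algebra_simps)
  then have "cmod (1 - e (x + y)) \<le> cmod (1 - e x) + cmod (e x * (1 - e y))" by (metis norm_triangle_ineq)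
  then show ?thesis by (simp add: norm_mult)
qed

lemma norm_1_minus_e_minus: "cmod (1 - e (- x)) = cmod (1 - e x)"
proof -
  have "1 - e (- x) = cnj (1 - e x)" by (simp add: cnj_e)
  then show ?thesis by (metis complex_mod_cnj)
qed

text \<open>Bogolyubov's lemma writes every n of a smaller Bohr set as w1 + w2 - w3 - w4 with all
  four points in the set where \<open>psi\<close> is almost trivial, and \<open>psi\<close> is
  additive there. The bound is linear in the norm of t, so that shrinking the radius makes the error
  as small as desired.\<close>

theorem approximate_symmetry:
  fixes d :: nat and c1 :: real
  assumes c1: "c1 > 0"
  shows "\<exists>(d'::nat) C. C > 0 \<and> (\<forall>M \<Theta> \<beta> \<alpha> K F1 f2. M > 0 \<longrightarrow> finite \<Theta> \<longrightarrow> card \<Theta> \<le> d \<longrightarrow> K \<subseteq> bohr \<Theta> (of_int M) (1/64) \<longrightarrow>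
    (\<forall>m. cmod (F1 m) \<le> 1) \<longrightarrow> (\<forall>m. cmod (f2 m) \<le> 1) \<longrightarrow> (\<forall>n. n \<notin> {0..<M} \<longrightarrow> f2 n = 0) \<longrightarrow>
    (\<Sum>k\<in>K. cmod (\<Sum>n\<in>{0..<M}. F1 (n + k) * f2 n * e (phi \<Theta> \<beta> \<alpha> k * of_int n))) \<ge> c1 * (of_int M)\<^sup>2 \<longrightarrow>
    (\<exists>\<Theta>'. finite \<Theta>' \<and> \<Theta> \<subseteq> \<Theta>' \<and> card \<Theta>' \<le> d' \<and>
      (\<forall>n t. bnorm \<Theta>' (of_int M) n \<le> 1/64 \<longrightarrow> bnorm \<Theta>' (of_int M) t \<le> 1/128 \<longrightarrow>
         cmod (1 - e (psi \<Theta> \<beta> \<alpha> t n)) \<le> C * bnorm \<Theta>' (of_int M) t)))"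
proof -
  obtain cB where cB: "cB > 0" and Bcard: "\<And>\<Theta> L. finite \<Theta> \<Longrightarrow> card \<Theta> \<le> d \<Longrightarrow> L > 0 \<Longrightarrow> real (card (bohr \<Theta> L (1/128))) \<ge> cB * L"
    using bohr_card_lower[of "1/128" d] by auto
  define c2 where "c2 = c1 / 20"
  have c2: "c2 > 0" using c1 by (simp add: c2_def)
  define \<kappa> where "\<kappa> = c2\<^sup>2 * cB ^ 3 / 3"
  have \<kappa>: "\<kappa> > 0" using c2 cB by (simp add: \<kappa>_def)
  define c3 where "c3 = \<kappa>\<^sup>2 / 54"
  have c3: "c3 > 0" using \<kappa> by (simp add: c3_def)
  define c4 where "c4 = c3 * cB / 6"
  have c4: "c4 > 0" using c3 cB by (simp add: c4_def)
  define d' where "d' = d + nat \<lfloor>128 / c4\<^sup>2\<rfloor>"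
  \<comment> \<open>Four terms w, each contributing 192 / c3.\<close>
  define C where "C = 768 / c3"
  show ?thesis
  proof (intro exI[of _ d'] exI[of _ C] conjI allI impI)
    show "C > 0" using c3 by (simp add: C_def)
    fix M \<Theta> \<beta> \<alpha> K and F1 f2 :: "int \<Rightarrow> complex"
    assume M: "M > 0" and \<Theta>: "finite \<Theta>" "card \<Theta> \<le> d" and K: "K \<subseteq> bohr \<Theta> (of_int M) (1/64)"
      and F1: "\<forall>m. cmod (F1 m) \<le> 1" and f2: "\<forall>m. cmod (f2 m) \<le> 1" and f20: "\<forall>n. n \<notin> {0..<M} \<longrightarrow> f2 n = 0"
      and big: "(\<Sum>k\<in>K. cmod (\<Sum>n\<in>{0..<M}. F1 (n + k) * f2 n * e (phi \<Theta> \<beta> \<alpha> k * of_int n))) \<ge> c1 * (of_int M)\<^sup>2"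
    have MR: "real_of_int M > 0" using M by simp
    define B where "B = bohr \<Theta> (of_int M) (1/128)"
    have finB: "finite B" unfolding B_def by (rule finite_bohr[OF MR])
    have Bsub: "B \<subseteq> bohr \<Theta> (of_int M) (1/64)" by (auto simp: B_def bohr_def)
    have Bc: "real (card B) \<ge> cB * of_int M" unfolding B_def by (rule Bcard[OF \<Theta> MR])
    obtain x \<sigma> Fm Hz where FH: "\<And>m. cmod (Fm m) \<le> 1" "\<And>m. cmod (Hz m) \<le> 1"
      and tri: "cmod (\<Sum>y\<in>B. \<Sum>z\<in>B. of_real 1 * of_real 1 * (Fm (y + z) * (f2 (x + 1 * y) * e (\<sigma> * of_int y)) * Hz z
        * e (of_int (1\<^sup>2) * phi \<Theta> \<beta> \<alpha> z * of_int y))) \<ge> c1 / 20 * (\<Sum>y\<in>B. 1)\<^sup>2"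
      by (rule localised_trilinear[OF M \<Theta>(1) K _ _ big Bsub, of "\<lambda>_. 1" 1]) (use F1 f20 in auto)
    define G where "G y = f2 (x + y) * e (\<sigma> * of_int y)" for y
    have G: "cmod (G y) \<le> 1" for y using f2 by (simp add: G_def norm_mult)
    have tri': "c2 * (real (card B))\<^sup>2 \<le> cmod (\<Sum>y\<in>B. \<Sum>z\<in>B. Fm (y + z) * G y * Hz z * e (phi \<Theta> \<beta> \<alpha> z * of_int y))"
      using tri by (simp add: c2_def G_def)
    obtain u v where uv: "\<And>m. cmod (u m) \<le> 1" "\<And>m. cmod (v m) \<le> 1"
      "cmod (\<Sum>m\<in>bohr \<Theta> (of_int M) (1/64). \<Sum>m'\<in>bohr \<Theta> (of_int M) (1/64). u m * v m' * e (psi \<Theta> \<beta> \<alpha> m m'))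
      \<ge> c2\<^sup>2 * real (card B) ^ 3 / (3 * of_int M)"
      using antisymmetric_bilinear_bias[OF M \<Theta>(1) FH(1) G FH(2) c2 cB Bc[unfolded B_def] tri'[unfolded B_def]] unfolding B_def by blast
    have "\<kappa> * (of_int M)\<^sup>2 = c2\<^sup>2 * (cB * of_int M) ^ 3 / (3 * of_int M)"
      using MR by (simp add: \<kappa>_def power_mult_distrib field_simps eval_nat_numeral)
    also have "\<dots> \<le> c2\<^sup>2 * real (card B) ^ 3 / (3 * of_int M)"
      using Bc cB MR by (intro divide_right_mono mult_left_mono power_mono) auto
    finally have uv3: "\<kappa> * (of_int M)\<^sup>2 \<le> cmod (\<Sum>m\<in>bohr \<Theta> (of_int M) (1/64). \<Sum>m'\<in>bohr \<Theta> (of_int M) (1/64). u m * v m' * e (psi \<Theta> \<beta> \<alpha> m m'))"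
      using uv(3) by linarith
    have "card B \<le> card (bohr \<Theta> (of_int M) (1/64))" using Bsub finite_bohr[OF MR] by (intro card_mono)
    then have Xc: "real (card (bohr \<Theta> (of_int M) (1/64))) \<ge> cB * of_int M" using Bc by linarith
    obtain W where W: "W \<subseteq> bohr \<Theta> (of_int M) (1/32)" "real (card W) \<ge> \<kappa>\<^sup>2 / 54 * cB / 6 * of_int M"
      and WY: "\<And>w. w \<in> W \<Longrightarrow> cmod (antisym_sum \<Theta> \<beta> \<alpha> M w) \<ge> \<kappa>\<^sup>2 / 54 * of_int M"
      using antisymmetric_bias_large_set[OF M \<Theta>(1) uv(1,2) \<kappa> cB Xc uv3] by blast
    have WM: "W \<subseteq> {- M..M}" using W(1) bohr_subset_M[OF M, of "1/32" \<Theta>] by auto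
    have Wc: "real (card W) \<ge> c4 * of_int M" using W(2) by (simp add: c4_def c3_def)
    obtain \<Theta>2 where \<Theta>2: "finite \<Theta>2" "real (card \<Theta>2) \<le> 128 / c4\<^sup>2"
      and bog: "\<forall>n. \<bar>n\<bar> \<le> M \<longrightarrow> (\<forall>\<theta>\<in>\<Theta>2. nd (\<theta> * of_int n) \<le> 1/4)
       \<longrightarrow> (\<exists>w1\<in>W. \<exists>w2\<in>W. \<exists>w3\<in>W. \<exists>w4\<in>W. n = w1 + w2 - w3 - w4)"
      by (rule bogolyubov[OF M WM c4 Wc])
    have cd2: "card \<Theta>2 \<le> nat \<lfloor>128 / c4\<^sup>2\<rfloor>" using \<Theta>2(2) by (simp add: le_nat_iff le_floor_iff)
    define \<Theta>' where "\<Theta>' = \<Theta> \<union> \<Theta>2"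
    have fin': "finite \<Theta>'" using \<Theta> \<Theta>2 by (simp add: \<Theta>'_def)
    show "\<exists>\<Theta>'. finite \<Theta>' \<and> \<Theta> \<subseteq> \<Theta>' \<and> card \<Theta>' \<le> d' \<and>
      (\<forall>n t. bnorm \<Theta>' (of_int M) n \<le> 1/64 \<longrightarrow> bnorm \<Theta>' (of_int M) t \<le> 1/128 \<longrightarrow>
         cmod (1 - e (psi \<Theta> \<beta> \<alpha> t n)) \<le> C * bnorm \<Theta>' (of_int M) t)"
    proof (intro exI[of _ \<Theta>'] conjI allI impI)
      show "finite \<Theta>'" by (rule fin')
      show "\<Theta> \<subseteq> \<Theta>'" by (simp add: \<Theta>'_def)
      show "card \<Theta>' \<le> d'" unfolding \<Theta>'_def d'_def using card_Un_le[of \<Theta> \<Theta>2] \<Theta>(2) cd2 by linarith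
      fix n t assume n: "bnorm \<Theta>' (of_int M) n \<le> 1/64" and t: "bnorm \<Theta>' (of_int M) t \<le> 1/128"
      have tb: "bnorm \<Theta> (of_int M) t \<le> bnorm \<Theta>' (of_int M) t" by (rule bnorm_mono[OF fin']) (simp add: \<Theta>'_def)
      have "n \<in> bohr \<Theta>' (of_int M) 1" using n by (simp add: bohr_def)
      then have "n \<in> {- M..M}" using bohr_subset_M[OF M, of 1 \<Theta>'] by auto
      then have "\<bar>n\<bar> \<le> M" by auto
      moreover have "nd (\<theta> * of_int n) \<le> 1/4" if "\<theta> \<in> \<Theta>2" for \<theta>
        using nd_le_bnorm[OF MR fin', of \<theta> n] that n by (simp add: \<Theta>'_def)
      ultimately obtain w1 w2 w3 w4 where w: "w1 \<in> W" "w2 \<in> W" "w3 \<in> W" "w4 \<in> W" "n = w1 + w2 - w3 - w4"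
        using bog by blast
      let ?b = "bnorm \<Theta> (of_int M)"
      let ?\<phi> = "phi \<Theta> \<beta> \<alpha>"
      let ?\<psi> = "psi \<Theta> \<beta> \<alpha>"
      have wb: "?b w1 \<le> 1/32" "?b w2 \<le> 1/32" "?b w3 \<le> 1/32" "?b w4 \<le> 1/32"
        using w W(1) by (auto simp: bohr_def)
      have b12: "?b (w1 + w2) \<le> 1/16" using bnorm_add[OF MR, of \<Theta> w1 w2] wb by linarith
      have b123: "?b (w1 + w2 - w3) \<le> 3/32" using bnorm_diff[OF MR, of \<Theta> "w1 + w2" w3] wb b12 by linarith
      have "?\<phi> (w1 + w2) = ?\<phi> w1 + ?\<phi> w2" by (rule phi_add[OF MR \<Theta>(1)]) (use wb in linarith)
      moreover have "?\<phi> (w1 + w2 - w3) = ?\<phi> (w1 + w2) - ?\<phi> w3" by (rule phi_diff[OF MR \<Theta>(1)]) (use wb b12 in linarith)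
      moreover have "?\<phi> (w1 + w2 - w3 - w4) = ?\<phi> (w1 + w2 - w3) - ?\<phi> w4" by (rule phi_diff[OF MR \<Theta>(1)]) (use wb b123 in linarith)
      ultimately have "?\<phi> n = ?\<phi> w1 + ?\<phi> w2 - ?\<phi> w3 - ?\<phi> w4" using w(5) by simp
      then have "?\<psi> t n = ?\<psi> t w1 + (?\<psi> t w2 + (- ?\<psi> t w3 + - ?\<psi> t w4))"
        unfolding psi_def by (simp only:) (simp add: w(5) algebra_simps)
      note psin = this
      have 1: "cmod (1 - e (- ?\<psi> t w3 + - ?\<psi> t w4)) \<le> cmod (1 - e (?\<psi> t w3)) + cmod (1 - e (?\<psi> t w4))"
        using norm_1_minus_e_add[of "- ?\<psi> t w3" "- ?\<psi> t w4"] unfolding norm_1_minus_e_minus .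
      note 2 = order_trans[OF norm_1_minus_e_add add_left_mono[OF 1]]
      note 3 = order_trans[OF norm_1_minus_e_add add_left_mono[OF 2]]
      have "cmod (1 - e (?\<psi> t n)) \<le> cmod (1 - e (?\<psi> t w1)) + (cmod (1 - e (?\<psi> t w2)) + (cmod (1 - e (?\<psi> t w3)) + cmod (1 - e (?\<psi> t w4))))"
        unfolding psin by (rule 3)
      moreover have wsm: "cmod (1 - e (?\<psi> t w)) \<le> 192 / c3 * bnorm \<Theta>' (of_int M) t" if "w \<in> W" for w
      proof -
        have "c3 * cmod (1 - e (?\<psi> t w)) \<le> 192 * ?b t"
          by (rule antisymmetric_form_small[OF M \<Theta>(1)]) (use WY[OF that] tb t in \<open>auto simp: c3_def\<close>)
        then have "c3 * cmod (1 - e (?\<psi> t w)) \<le> 192 * bnorm \<Theta>' (of_int M) t" using tb by linarith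
        then show ?thesis using c3 by (simp add: field_simps)
      qed
      ultimately have "cmod (1 - e (?\<psi> t n)) \<le> 4 * (192 / c3 * bnorm \<Theta>' (of_int M) t)"
        using wsm[OF w(1)] wsm[OF w(2)] wsm[OF w(3)] wsm[OF w(4)] by linarith
      then show "cmod (1 - e (?\<psi> t n)) \<le> C * bnorm \<Theta>' (of_int M) t" by (simp add: C_def)
    qed
  qed
qed

section \<open>Integration of the derivative\<close>

text \<open>The autocorrelation of the indicator of \<open>B\<close> is positive definite, so it is a convex
  combination of characters (up to normalisation) and can be removed from a correlation.\<close>
lemma remove_autocorrelation_weight:
  fixes B Y :: "int set" and M :: int and g :: "int \<Rightarrow> complex"
  assumes M: "M > 0" and B: "B \<subseteq> {- M..M}" "B \<noteq> {}" and Y: "Y \<subseteq> {- 2 * M..2 * M}"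
  obtains k where "cmod (\<Sum>y\<in>Y. of_real (real (rep B y) / real (card B)) * g y) \<le> cmod (\<Sum>y\<in>Y. g y * chr (8 * M) k y)"
proof -
  \<comment> \<open>a - b - y is at most 4 M in size, so divisibility by 8 M means that it
    vanishes.\<close>
  define P where "P = 8 * M"
  have P: "P > 0" using M by (simp add: P_def)
  have finB: "finite B" and finY: "finite Y" using B Y finite_subset by blast+
  have Bpos: "real (card B) > 0" using finB B by (simp add: card_gt_0_iff)
  have inj: "inj_on (\<lambda>x. x mod P) B"
  proof (rule inj_onI)
    fix x y assume xy: "x \<in> B" "y \<in> B" and eq: "x mod P = y mod P"
    have "P dvd x - y" using eq by (simp add: mod_eq_dvd_iff)
    moreover have "\<bar>x - y\<bar> < P" using subsetD[OF B(1) xy(1)] subsetD[OF B(1) xy(2)] M by (auto simp: P_def)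
    ultimately show "x = y" using dvd_imp_le_int[of "x - y" P] P by linarith
  qed
  define S where "S k = (\<Sum>b\<in>B. chr P k b)" for k
  have pars: "(\<Sum>k\<in>{0..<P}. (cmod (S k))\<^sup>2) = of_int P * real (card B)"
    using parseval[OF P finB inj, of "\<lambda>_. 1"] by (simp add: S_def)
  \<comment> \<open>The coefficients |S(k)|^2 are nonnegative with sum P |B|; after division by P
    |B| they are the weights of the convex combination.\<close>
  have rep: "of_int P * of_nat (rep B y) = (\<Sum>k\<in>{0..<P}. complex_of_real ((cmod (S k))\<^sup>2) * chr P (- k) y)" if y: "y \<in> Y" for y
  proof -
    have "(\<Sum>k\<in>{0..<P}. complex_of_real ((cmod (S k))\<^sup>2) * chr P (- k) y)
      = (\<Sum>k\<in>{0..<P}. \<Sum>a\<in>B. \<Sum>b\<in>B. chr P k (a - b - y))"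
      unfolding S_def cmod_sum_sq by (simp add: sum_distrib_right chr_diff chr_minus_left)
    also have "\<dots> = (\<Sum>a\<in>B. \<Sum>b\<in>B. \<Sum>k\<in>{0..<P}. chr P k (a - b - y))"
      by (subst sum.swap, rule sum.cong[OF refl]) (rule sum.swap)
    also have "\<dots> = (\<Sum>a\<in>B. \<Sum>b\<in>B. if b = a - y then of_int P else 0)"
    proof (intro sum.cong refl)
      fix a b assume ab: "a \<in> B" "b \<in> B"
      have "\<bar>a - b - y\<bar> < P" using subsetD[OF B(1) ab(1)] subsetD[OF B(1) ab(2)] subsetD[OF Y y] M by (auto simp: P_def)
      then have "P dvd a - b - y \<longleftrightarrow> b = a - y" using dvd_imp_le_int[of "a - b - y" P] P by (cases "a - b - y = 0") auto
      then show "(\<Sum>k\<in>{0..<P}. chr P k (a - b - y)) = (if b = a - y then of_int P else 0)"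
        unfolding sum_chr[OF P] by simp
    qed
    also have "\<dots> = (\<Sum>a\<in>B. if a - y \<in> B then of_int P else 0)" using finB by (simp add: sum.delta)
    also have "\<dots> = of_int P * of_nat (rep B y)" using finB by (simp add: rep_def sum.If_cases Int_def)
    finally show ?thesis by simp
  qed
  have "\<exists>k\<in>{0..<P}. \<forall>l\<in>{0..<P}. cmod (\<Sum>y\<in>Y. g y * chr P (- l) y) \<le> cmod (\<Sum>y\<in>Y. g y * chr P (- k) y)"
    using P by (intro ex_argmax) auto
  then obtain k where k: "\<And>l. l \<in> {0..<P} \<Longrightarrow> cmod (\<Sum>y\<in>Y. g y * chr P (- l) y) \<le> cmod (\<Sum>y\<in>Y. g y * chr P (- k) y)" by blast
  have "(of_int P * of_nat (card B)) * (\<Sum>y\<in>Y. of_real (real (rep B y) / real (card B)) * g y)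
    = (\<Sum>y\<in>Y. (of_int P * of_nat (rep B y)) * g y)"
    using Bpos by (simp add: sum_distrib_left mult.assoc)
  also have "\<dots> = (\<Sum>y\<in>Y. \<Sum>l\<in>{0..<P}. complex_of_real ((cmod (S l))\<^sup>2) * (g y * chr P (- l) y))"
  proof (rule sum.cong[OF refl])
    fix y assume "y \<in> Y"
    show "of_int P * of_nat (rep B y) * g y = (\<Sum>l\<in>{0..<P}. complex_of_real ((cmod (S l))\<^sup>2) * (g y * chr P (- l) y))"
      unfolding rep[OF \<open>y \<in> Y\<close>] by (simp only: sum_distrib_left sum_distrib_right mult_ac)
  qed
  also have "\<dots> = (\<Sum>l\<in>{0..<P}. complex_of_real ((cmod (S l))\<^sup>2) * (\<Sum>y\<in>Y. g y * chr P (- l) y))"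
    by (subst sum.swap) (simp only: sum_distrib_left)
  finally have eq: "(of_int P * of_nat (card B)) * (\<Sum>y\<in>Y. of_real (real (rep B y) / real (card B)) * g y)
     = (\<Sum>l\<in>{0..<P}. complex_of_real ((cmod (S l))\<^sup>2) * (\<Sum>y\<in>Y. g y * chr P (- l) y))" .
  have "(of_int P * real (card B)) * cmod (\<Sum>y\<in>Y. of_real (real (rep B y) / real (card B)) * g y)
     = cmod (\<Sum>l\<in>{0..<P}. complex_of_real ((cmod (S l))\<^sup>2) * (\<Sum>y\<in>Y. g y * chr P (- l) y))"
    unfolding eq[symmetric] norm_mult using P by simp
  also have "\<dots> \<le> (\<Sum>l\<in>{0..<P}. (cmod (S l))\<^sup>2 * cmod (\<Sum>y\<in>Y. g y * chr P (- k) y))"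
  proof (rule sum_norm_le)
    fix l assume "l \<in> {0..<P}"
    then have "(cmod (S l))\<^sup>2 * cmod (\<Sum>y\<in>Y. g y * chr P (- l) y) \<le> (cmod (S l))\<^sup>2 * cmod (\<Sum>y\<in>Y. g y * chr P (- k) y)"
      using k by (intro mult_left_mono) auto
    then show "cmod (complex_of_real ((cmod (S l))\<^sup>2) * (\<Sum>y\<in>Y. g y * chr P (- l) y)) \<le> (cmod (S l))\<^sup>2 * cmod (\<Sum>y\<in>Y. g y * chr P (- k) y)"
      by (simp add: norm_mult norm_power)
  qed
  also have "\<dots> = (of_int P * real (card B)) * cmod (\<Sum>y\<in>Y. g y * chr P (- k) y)"
    by (simp only: sum_distrib_right[symmetric] pars)
  finally have "cmod (\<Sum>y\<in>Y. of_real (real (rep B y) / real (card B)) * g y) \<le> cmod (\<Sum>y\<in>Y. g y * chr P (- k) y)"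
    using P Bpos by (simp add: mult_le_cancel_left)
  then show ?thesis using that[of "- k"] by (simp add: P_def)
qed

text \<open>Hermite's identity floor(u) + floor(u + 1/2) = floor(2u). The nilcharacters at hand
  offer floors of multiples of n without a shift by 1/2, hence this form of the rounding.\<close>

lemma round_eq_floor_diff: "round u = \<lfloor>2 * u\<rfloor> - \<lfloor>u\<rfloor>" for u :: real
proof (cases "u - of_int \<lfloor>u\<rfloor> < 1/2")
  case True
  have "\<lfloor>u + 1/2\<rfloor> = \<lfloor>u\<rfloor>" by (rule floor_unique) (use True in linarith)+
  moreover have "\<lfloor>2 * u\<rfloor> = 2 * \<lfloor>u\<rfloor>" by (rule floor_unique) (use True in \<open>simp; linarith\<close>)+
  ultimately show ?thesis by (simp add: round_def)
next
  case False
  have "\<lfloor>u + 1/2\<rfloor> = \<lfloor>u\<rfloor> + 1" by (rule floor_unique) (use False in \<open>simp; linarith\<close>)+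
  moreover have "\<lfloor>2 * u\<rfloor> = 2 * \<lfloor>u\<rfloor> + 1" by (rule floor_unique) (use False in \<open>simp; linarith\<close>)+
  ultimately show ?thesis by (simp add: round_def)
qed

text \<open>A rounding of \<open>\<theta> y\<close> with \<open>y = (n - x)/2\<close> becomes a floor of a multiple of \<open>n\<close>, without
  a shift inside: use the floor if \<open>\<theta> x/2\<close> is far from the integers, and the rounding otherwise.\<close>
lemma round_shift_floor:
  fixes \<theta> :: real and x :: int
  shows "\<exists>a b c :: int. \<bar>a\<bar> \<le> 1 \<and> \<bar>b\<bar> \<le> 1 \<and> (\<forall>y. nd (\<theta> * of_int y) \<le> 1/8 \<longrightarrow>
     round (\<theta> * of_int y) = a * \<lfloor>\<theta> * of_int (x + 2 * y)\<rfloor> + b * \<lfloor>\<theta> / 2 * of_int (x + 2 * y)\<rfloor> - c)"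
proof -
  define s where "s = \<theta> / 2 * of_int x"
  have sn: "\<theta> / 2 * of_int (x + 2 * y) = s + \<theta> * of_int y" for y by (simp add: s_def algebra_simps)
  show ?thesis
  proof (cases "1/4 \<le> frac s \<and> frac s < 3/4")
    case True
    \<comment> \<open>Here s is at least 1/4 away from the integers, so a deviation of at most 1/8
      does not carry s + \<theta> y across one.\<close>
    have "round (\<theta> * of_int y) = 0 * \<lfloor>\<theta> * of_int (x + 2 * y)\<rfloor> + 1 * \<lfloor>\<theta> / 2 * of_int (x + 2 * y)\<rfloor> - \<lfloor>s\<rfloor>"
      if "nd (\<theta> * of_int y) \<le> 1/8" for y
    proof -
      have "\<lfloor>s + \<theta> * of_int y\<rfloor> = \<lfloor>s\<rfloor> + round (\<theta> * of_int y)"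
        using True that unfolding nd_def frac_def by linarith
      then show ?thesis unfolding sn by simp
    qed
    then show ?thesis by (intro exI[of _ 0] exI[of _ 1] exI[of _ "\<lfloor>s\<rfloor>"]) auto
  next
    case False
    then have "\<bar>s - of_int \<lfloor>s\<rfloor>\<bar> \<le> 1/4 \<or> \<bar>s - of_int (\<lfloor>s\<rfloor> + 1)\<bar> \<le> 1/4"
      unfolding frac_def by simp linarith
    then have s4: "\<bar>s - of_int (round s)\<bar> \<le> 1/4"
      using round_diff_minimal[of s "\<lfloor>s\<rfloor>"] round_diff_minimal[of s "\<lfloor>s\<rfloor> + 1"] by linarith
    \<comment> \<open>Here s is within 1/4 of an integer, and 1/4 + 1/8 < 1/2 lets the roundings
      add.\<close>
    have "round (\<theta> * of_int y) = 1 * \<lfloor>\<theta> * of_int (x + 2 * y)\<rfloor> + (- 1) * \<lfloor>\<theta> / 2 * of_int (x + 2 * y)\<rfloor> - round s"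
      if "nd (\<theta> * of_int y) \<le> 1/8" for y
    proof -
      have "round (s + \<theta> * of_int y) = round s + round (\<theta> * of_int y)"
        by (rule round_unique_nd) (use s4 that in \<open>unfold nd_def of_int_add; linarith\<close>)
      moreover have "2 * (\<theta> / 2 * of_int (x + 2 * y)) = \<theta> * of_int (x + 2 * y)" by simp
      ultimately show ?thesis using round_eq_floor_diff[of "\<theta> / 2 * of_int (x + 2 * y)"] unfolding sn by simp
    qed
    then show ?thesis by (intro exI[of _ 1] exI[of _ "- 1"] exI[of _ "round s"]) auto
  qed
qed

lemma parity_projection:
  fixes x n :: int
  shows "(if even (n - x) then 1 else 0) = (1 + e (1/2 * of_int (n - x))) / 2"
proof (cases "even (n - x)")
  case True
  then obtain m where "n - x = 2 * m" by blast
  then have "1/2 * real_of_int (n - x) = of_int m" by simp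
  then show ?thesis using True by (simp only: e_of_int) simp
next
  case False
  then obtain m where "n - x = 2 * m + 1" using oddE by blast
  then have "1/2 * real_of_int (n - x) = 1/2 + of_int m" by simp
  moreover have "e (1/2) = - 1" by (simp add: e_def)
  ultimately show ?thesis using False by (simp only: e_add_int) simp
qed

text \<open>The indicator of even n - x is the mean of the characters 1 and (-1)^(n-x), so up to
  unimodular factors the sum over the progression is the mean of two linearly twisted sums over the
  whole interval; the larger one is chosen.\<close>

lemma sum_over_progression:
  fixes N x M :: int and h :: "int \<Rightarrow> complex"
  assumes N: "0 < N" "N \<le> M" and x: "\<bar>x\<bar> \<le> 2 * M"
  obtains \<mu> where "cmod (\<Sum>y\<in>{y \<in> {- 2 * M..2 * M}. x + 2 * y \<in> {1..N}}. h (x + 2 * y) * e (\<tau> * of_int y))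
    \<le> cmod (\<Sum>n\<in>{1..N}. h n * e (\<mu> * of_int n))"
proof -
  define Y where "Y = {y \<in> {- 2 * M..2 * M}. x + 2 * y \<in> {1..N}}"
  define T where "T \<mu> = (\<Sum>n\<in>{1..N}. h n * e (\<mu> * of_int n))" for \<mu>
  have "(\<Sum>y\<in>Y. h (x + 2 * y) * e (\<tau> * of_int y)) = (\<Sum>n\<in>{n \<in> {1..N}. even (n - x)}. h n * e (\<tau> / 2 * of_int (n - x)))"
  proof (rule sum.reindex_bij_witness[of _ "\<lambda>n. (n - x) div 2" "\<lambda>y. x + 2 * y"])
    fix n assume n: "n \<in> {n \<in> {1..N}. even (n - x)}"
    then have eq: "2 * ((n - x) div 2) = n - x" by simp
    then show 1: "x + 2 * ((n - x) div 2) = n" by simp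
    have "\<bar>2 * ((n - x) div 2)\<bar> \<le> 4 * M" unfolding eq using n N x by auto
    then show "(n - x) div 2 \<in> Y" unfolding Y_def using n 1 by auto
  qed (auto simp: Y_def)
  also have "\<dots> = (\<Sum>n\<in>{1..N}. (if even (n - x) then 1 else 0) * (h n * e (\<tau> / 2 * of_int (n - x))))"
    by (rule sum.mono_neutral_cong_left) auto
  also have "\<dots> = (\<Sum>n\<in>{1..N}. (h n * e (\<tau> / 2 * of_int (n - x))) / 2 + (h n * (e (\<tau> / 2 * of_int (n - x)) * e (1/2 * of_int (n - x)))) / 2)"
    by (intro sum.cong refl) (simp only: parity_projection, simp add: algebra_simps add_divide_distrib)
  also have "\<dots> = (\<Sum>n\<in>{1..N}. (h n * e (\<tau> / 2 * of_int (n - x))) / 2) + (\<Sum>n\<in>{1..N}. (h n * (e (\<tau> / 2 * of_int (n - x)) * e (1/2 * of_int (n - x)))) / 2)"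
    by (rule sum.distrib)
  also have "(\<Sum>n\<in>{1..N}. (h n * e (\<tau> / 2 * of_int (n - x))) / 2) = e (- (\<tau> / 2) * of_int x) * T (\<tau> / 2) / 2"
  proof -
    have "e (\<tau> / 2 * of_int (n - x)) = e (- (\<tau> / 2) * of_int x) * e (\<tau> / 2 * of_int n)" for n
      unfolding e_add[symmetric] by (rule arg_cong[of _ _ e]) (simp add: algebra_simps diff_divide_distrib)
    then show ?thesis by (simp add: T_def sum_distrib_left sum_divide_distrib mult_ac)
  qed
  also have "(\<Sum>n\<in>{1..N}. (h n * (e (\<tau> / 2 * of_int (n - x)) * e (1/2 * of_int (n - x)))) / 2)
     = e (- (\<tau> / 2 + 1/2) * of_int x) * T (\<tau> / 2 + 1/2) / 2"
  proof -
    have "e (\<tau> / 2 * of_int (n - x)) * e (1/2 * of_int (n - x)) = e (- (\<tau> / 2 + 1/2) * of_int x) * e ((\<tau> / 2 + 1/2) * of_int n)" for n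
      unfolding e_add[symmetric] by (rule arg_cong[of _ _ e]) (simp add: algebra_simps diff_divide_distrib)
    then show ?thesis by (simp add: T_def sum_distrib_left sum_divide_distrib mult_ac)
  qed
  finally have "cmod (\<Sum>y\<in>Y. h (x + 2 * y) * e (\<tau> * of_int y)) \<le> cmod (e (- (\<tau> / 2) * of_int x) * T (\<tau> / 2) / 2) + cmod (e (- (\<tau> / 2 + 1/2) * of_int x) * T (\<tau> / 2 + 1/2) / 2)"
    by (simp only: norm_triangle_ineq)
  also have "\<dots> = cmod (T (\<tau> / 2)) / 2 + cmod (T (\<tau> / 2 + 1/2)) / 2" by (simp add: norm_mult norm_divide)
  finally have le: "cmod (\<Sum>y\<in>Y. h (x + 2 * y) * e (\<tau> * of_int y)) \<le> cmod (T (\<tau> / 2)) / 2 + cmod (T (\<tau> / 2 + 1/2)) / 2" .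
  show ?thesis
  proof (cases "cmod (T (\<tau> / 2)) \<le> cmod (T (\<tau> / 2 + 1/2))")
    case True
    then show ?thesis using le that[of "\<tau> / 2 + 1/2"] unfolding T_def Y_def by simp
  next
    case False
    then show ?thesis using le that[of "\<tau> / 2"] unfolding T_def Y_def by simp
  qed
qed

text \<open>Each pair of elements of \<open>B\<close> is counted at exactly one difference, so the
  weight has total mass |B|^2 / |B|.\<close>

lemma sum_rep_diffset:
  assumes B: "finite B" "B \<noteq> {}" and D: "finite D" "diffset B \<subseteq> D"
  shows "(\<Sum>y\<in>D. real (rep B y) / real (card B)) = real (card B)"
proof -
  have "(\<Sum>y\<in>D. rep B y) = (\<Sum>y\<in>D. card {a \<in> B. a - y \<in> B})" by (simp add: rep_def)
  also have "\<dots> = (\<Sum>a\<in>B. card {y \<in> D. a - y \<in> B})" by (rule sum_card_swap) (use B D in auto)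
  also have "\<dots> = (\<Sum>a\<in>B. card B)"
  proof (intro sum.cong refl)
    fix a assume a: "a \<in> B"
    show "card {y \<in> D. a - y \<in> B} = card B"
    proof (rule bij_betw_same_card[of "\<lambda>y. a - y"], rule bij_betw_byWitness[where f' = "\<lambda>b. a - b"])
      have "a - b \<in> D" if "b \<in> B" for b using a that D(2) unfolding diffset_def by blast
      then show "(\<lambda>b. a - b) ` B \<subseteq> {y \<in> D. a - y \<in> B}" by auto
    qed auto
  qed
  finally have "real (\<Sum>y\<in>D. rep B y) = real (card B) * real (card B)" by simp
  then show ?thesis using B by (simp add: sum_divide_distrib[symmetric])
qed

text \<open>Localised with step 2, the bilinear phase is a second difference of Q up to a small
  error. Distributing Q over the three functions leaves a trilinear form without a phase, so
  \<open>trilinear_bound\<close> yields a linear character that correlates with the weighted e(-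
  Q(y)), and Q(y) is \<phi>(y) n at n = x + 2y. The remaining work rewrites this phase in terms of n
  and drops the weight and the parity condition.\<close>

theorem bracket_quadratic_correlation:
  fixes c :: real
  assumes c: "0 < c" "c \<le> 1"
  shows "\<exists>(d::nat) c5. c5 > 0 \<and> (\<forall>N M F. 0 < N \<longrightarrow> N < M \<longrightarrow> periodic M F \<longrightarrow> (\<forall>m. cmod (F m) \<le> 1) \<longrightarrow>
    (\<forall>n\<in>{0..<M}. n \<notin> {1..N} \<longrightarrow> F n = 0) \<longrightarrow>
    (\<Sum>h\<in>{0..<M}. \<Sum>h1\<in>{0..<M}. (cmod (\<Sum>x\<in>{0..<M}. Delta h1 (Delta h F) x))\<^sup>2) \<ge> 2 * c * of_int M ^ 4 \<longrightarrow>
    (\<exists>(\<Theta>::real set) \<alpha> a b l2 l1. finite \<Theta> \<and> card \<Theta> \<le> d \<and> (\<forall>\<theta>. \<bar>a \<theta>\<bar> \<le> (1::int) \<and> \<bar>b \<theta>\<bar> \<le> (1::int)) \<and>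
      cmod (\<Sum>n\<in>{1..N}. cnj (F n) * e (l2 * (of_int n)\<^sup>2 + l1 * of_int n +
         (\<Sum>\<theta>\<in>\<Theta>. \<alpha> \<theta> * of_int n * of_int (a \<theta> * \<lfloor>\<theta> * of_int n\<rfloor> + b \<theta> * \<lfloor>\<theta> / 2 * of_int n\<rfloor>))))
      \<ge> c5 * of_int M))"
proof -
  obtain d :: nat and c1 where c1: "c1 > 0" and deriv: "\<forall>M F. M > 0 \<longrightarrow> periodic M F \<longrightarrow> (\<forall>m. cmod (F m) \<le> 1) \<longrightarrow>
    (\<Sum>h\<in>{0..<M}. \<Sum>h1\<in>{0..<M}. (cmod (\<Sum>x\<in>{0..<M}. Delta h1 (Delta h F) x))\<^sup>2) \<ge> 2 * c * of_int M ^ 4 \<longrightarrow>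
    (\<exists>\<Theta> \<beta> \<alpha> K h0 \<xi>0. finite \<Theta> \<and> card \<Theta> \<le> d \<and> K \<subseteq> bohr \<Theta> (of_int M) (1/64) \<and>
      (\<Sum>k\<in>K. cmod (\<Sum>n\<in>{0..<M}. F (n + k + h0) * (cnj (F n) * e (\<xi>0 * of_int n)) * e (phi \<Theta> \<beta> \<alpha> k * of_int n)))
        \<ge> c1 * (of_int M)\<^sup>2)"
    using derivative_bracket_linear[OF c] by (elim exE conjE)
  obtain d' :: nat and C where C: "C > 0" and sym: "\<forall>M \<Theta> \<beta> \<alpha> K F1 f2. M > 0 \<longrightarrow> finite \<Theta> \<longrightarrow> card \<Theta> \<le> d \<longrightarrow> K \<subseteq> bohr \<Theta> (of_int M) (1/64) \<longrightarrow>
    (\<forall>m. cmod (F1 m) \<le> 1) \<longrightarrow> (\<forall>m. cmod (f2 m) \<le> 1) \<longrightarrow> (\<forall>n. n \<notin> {0..<M} \<longrightarrow> f2 n = 0) \<longrightarrow>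
    (\<Sum>k\<in>K. cmod (\<Sum>n\<in>{0..<M}. F1 (n + k) * f2 n * e (phi \<Theta> \<beta> \<alpha> k * of_int n))) \<ge> c1 * (of_int M)\<^sup>2 \<longrightarrow>
    (\<exists>\<Theta>'. finite \<Theta>' \<and> \<Theta> \<subseteq> \<Theta>' \<and> card \<Theta>' \<le> d' \<and>
      (\<forall>n t. bnorm \<Theta>' (of_int M) n \<le> 1/64 \<longrightarrow> bnorm \<Theta>' (of_int M) t \<le> 1/128 \<longrightarrow>
         cmod (1 - e (psi \<Theta> \<beta> \<alpha> t n)) \<le> C * bnorm \<Theta>' (of_int M) t))"
    using approximate_symmetry[OF c1, of d] by (elim exE conjE)
  define c2 where "c2 = c1 / 20"
  have c2: "c2 > 0" using c1 by (simp add: c2_def)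
  \<comment> \<open>\<open>D\<close> has radius 2 \<rho>, which must not exceed the 1/128 of the
    approximate symmetry; the second entry makes the error 2 C (2 \<rho>) at most half of the main
    term \<open>c2\<close>.\<close>
  define \<rho> where "\<rho> = min (1/256) (c2 / (8 * C))"
  have \<rho>: "\<rho> > 0" "\<rho> \<le> 1/256" "4 * C * \<rho> \<le> c2 / 2"
  proof -
    show "\<rho> > 0" "\<rho> \<le> 1/256" using c2 C by (auto simp: \<rho>_def)
    have "4 * C * \<rho> \<le> 4 * C * (c2 / (8 * C))" using C by (intro mult_left_mono) (auto simp: \<rho>_def)
    then show "4 * C * \<rho> \<le> c2 / 2" using C by simp
  qed
  obtain cB where cB: "cB > 0" and Bcard: "\<And>\<Theta> L. finite \<Theta> \<Longrightarrow> card \<Theta> \<le> d' \<Longrightarrow> L > 0 \<Longrightarrow> real (card (bohr \<Theta> L \<rho>)) \<ge> cB * L"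
    using bohr_card_lower[OF \<rho>(1), of d'] by auto
  \<comment> \<open>The main term c2 / 2 divided by 5: the two l2 norms contribute sqrt(3 M) sqrt(8
    M) \<le> 5 M.\<close>
  define c5 where "c5 = c2 / 10 * cB\<^sup>2"
  show ?thesis
  proof (intro exI[of _ d] exI[of _ c5] conjI allI impI)
    show "c5 > 0" using c2 cB by (simp add: c5_def)
    fix N M :: int and F :: "int \<Rightarrow> complex"
    assume N: "0 < N" and NM: "N < M" and per: "periodic M F" and bd: "\<forall>m. cmod (F m) \<le> 1"
      and F0: "\<forall>n\<in>{0..<M}. n \<notin> {1..N} \<longrightarrow> F n = 0"
      and U: "(\<Sum>h\<in>{0..<M}. \<Sum>h1\<in>{0..<M}. (cmod (\<Sum>x\<in>{0..<M}. Delta h1 (Delta h F) x))\<^sup>2) \<ge> 2 * c * of_int M ^ 4"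
    have M: "M > 0" using N NM by simp
    have MR: "real_of_int M > 0" using M by simp
    from deriv[THEN spec, THEN spec, THEN mp, OF M, THEN mp, OF per, THEN mp, OF bd, THEN mp, OF U] obtain \<Theta> \<beta> \<alpha> K h0 \<xi>0 where \<Theta>: "finite \<Theta>" "card \<Theta> \<le> d" and K: "K \<subseteq> bohr \<Theta> (of_int M) (1/64)"
      and big: "(\<Sum>k\<in>K. cmod (\<Sum>n\<in>{0..<M}. F (n + k + h0) * (cnj (F n) * e (\<xi>0 * of_int n)) * e (phi \<Theta> \<beta> \<alpha> k * of_int n)))
        \<ge> c1 * (of_int M)\<^sup>2" by blast
    define F1 where "F1 m = F (m + h0)" for m
    define f2 where "f2 n = (if n \<in> {0..<M} then cnj (F n) * e (\<xi>0 * of_int n) else 0)" for n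
    have F1b: "\<forall>m. cmod (F1 m) \<le> 1" and f2b: "\<forall>m. cmod (f2 m) \<le> 1" and f20: "\<forall>n. n \<notin> {0..<M} \<longrightarrow> f2 n = 0"
      using bd by (auto simp: F1_def f2_def norm_mult)
    have big': "(\<Sum>k\<in>K. cmod (\<Sum>n\<in>{0..<M}. F1 (n + k) * f2 n * e (phi \<Theta> \<beta> \<alpha> k * of_int n))) \<ge> c1 * (of_int M)\<^sup>2"
      using big by (simp add: F1_def f2_def)
    from sym[THEN spec, THEN spec, THEN spec, THEN spec, THEN spec, THEN spec, THEN spec, THEN mp, OF M, THEN mp, OF \<Theta>(1),
      THEN mp, OF \<Theta>(2), THEN mp, OF K, THEN mp, OF F1b, THEN mp, OF f2b, THEN mp, OF f20, THEN mp, OF big'] obtain \<Theta>' where \<Theta>': "finite \<Theta>'" "\<Theta> \<subseteq> \<Theta>'" "card \<Theta>' \<le> d'"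
      and symm: "\<And>n t. bnorm \<Theta>' (of_int M) n \<le> 1/64 \<Longrightarrow> bnorm \<Theta>' (of_int M) t \<le> 1/128 \<Longrightarrow>
         cmod (1 - e (psi \<Theta> \<beta> \<alpha> t n)) \<le> C * bnorm \<Theta>' (of_int M) t" by blast
    let ?\<phi> = "phi \<Theta> \<beta> \<alpha>"
    let ?b' = "bnorm \<Theta>' (of_int M)"
    define B where "B = bohr \<Theta>' (of_int M) \<rho>"
    define D where "D = bohr \<Theta>' (of_int M) (2 * \<rho>)"
    have finB: "finite B" and finD: "finite D" unfolding B_def D_def by (rule finite_bohr[OF MR])+
    have Bc: "real (card B) \<ge> cB * of_int M" unfolding B_def by (rule Bcard[OF \<Theta>'(1,3) MR])
    have Bpos: "real (card B) > 0" using Bc mult_pos_pos[OF cB MR] by linarith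
    then have Bne: "B \<noteq> {}" by auto
    have BM: "B \<subseteq> {- M..M}" and DM: "D \<subseteq> {- M..M}" unfolding B_def D_def using \<rho> by (auto intro!: bohr_subset_M[OF M])
    have dB: "diffset B \<subseteq> D"
    proof
      fix y assume "y \<in> diffset B"
      then obtain a b where "y = a - b" "a \<in> B" "b \<in> B" by (auto simp: diffset_def)
      then show "y \<in> D" using bnorm_diff[OF MR, of \<Theta>' a b] by (simp add: B_def D_def bohr_def)
    qed
    \<comment> \<open>This weight is nonnegative, at most 1 and supported in \<open>D\<close>, which
      serves the estimates, and it is positive definite, which allows its removal.\<close>
    define w where "w y = real (rep B y) / real (card B)" for y
    have w0: "w y \<ge> 0" for y by (simp add: w_def)
    have w1: "w y \<le> 1" for y using rep_le_card[OF finB, of y] Bpos by (simp add: w_def)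
    have wD: "w y = 0" if "y \<notin> D" for y
    proof -
      have "rep B y = 0" using rep_pos_diffset[of B y] dB that by blast
      then show ?thesis by (simp add: w_def)
    qed
    have sumw: "(\<Sum>y\<in>D. w y) = real (card B)" unfolding w_def by (rule sum_rep_diffset[OF finB Bne finD dB])
    have bD: "bnorm \<Theta> (of_int M) y \<le> ?b' y" for y by (rule bnorm_mono[OF \<Theta>'(1,2)])
    have D128: "?b' y \<le> 2 * \<rho>" "?b' y \<le> 1/128" "bnorm \<Theta> (of_int M) y \<le> 1/128" if "y \<in> D" for y
      using that \<rho> bD[of y] by (auto simp: D_def bohr_def)
    have Dsub: "D \<subseteq> bohr \<Theta> (of_int M) (1/64)" using D128(3) by (force simp: bohr_def)
    obtain x \<sigma> Fm Hz where x: "\<bar>x\<bar> \<le> 2 * M" and FH: "\<And>m. cmod (Fm m) \<le> 1" "\<And>m. cmod (Hz m) \<le> 1"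
      and tri: "cmod (\<Sum>y\<in>D. \<Sum>z\<in>D. w y * w z * (Fm (y + z) * (f2 (x + 2 * y) * e (\<sigma> * of_int y)) * Hz z
        * e (of_int (2\<^sup>2) * ?\<phi> z * of_int y))) \<ge> c1 / 20 * (\<Sum>y\<in>D. w y)\<^sup>2"
      by (rule localised_trilinear[OF M \<Theta>(1) K _ _ big' Dsub, of w 2]) (use F1b f20 w0 in auto)
    define G where "G y = f2 (x + 2 * y) * e (\<sigma> * of_int y)" for y
    have G1: "cmod (G y) \<le> 1" for y using f2b by (simp add: G_def norm_mult)
    define Q where "Q y = ?\<phi> y * of_int (x + 2 * y)" for y
    define S1 where "S1 = (\<Sum>y\<in>D. \<Sum>z\<in>D. w y * w z * (Fm (y + z) * G y * Hz z * e (4 * ?\<phi> z * of_int y)))"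
    define S2 where "S2 = (\<Sum>y\<in>D. \<Sum>z\<in>D. (Fm (y + z) * e (Q (y + z))) * (w y * (G y * e (- Q y))) * (w z * (Hz z * e (- Q z))))"
    have S1: "cmod S1 \<ge> c2 * (real (card B))\<^sup>2" using tri unfolding sumw by (simp add: S1_def G_def c2_def mult.assoc)
    have "cmod (S1 - S2) \<le> (\<Sum>y\<in>D. \<Sum>z\<in>D. w y * w z * (c2 / 2))"
      unfolding S1_def S2_def sum_subtractf[symmetric]
    proof (intro sum_norm_le order_trans[OF norm_sum] sum_mono)
      fix y z assume y: "y \<in> D" and z: "z \<in> D"
      have ph: "?\<phi> (y + z) = ?\<phi> y + ?\<phi> z" by (rule phi_add[OF MR \<Theta>(1)]) (use D128(3)[OF y] D128(3)[OF z] in linarith)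
      \<comment> \<open>The even steps are made for this identity: with step 1 it would involve half
        of \<open>psi\<close>, which is not controlled mod 1.\<close>
      have q4: "4 * ?\<phi> z * of_int y = (Q (y + z) + - Q y + - Q z) + (psi \<Theta> \<beta> \<alpha> z y + psi \<Theta> \<beta> \<alpha> z y)"
        unfolding Q_def psi_def ph by (simp add: algebra_simps)
      define V where "V = of_real (w y * w z) * (Fm (y + z) * G y * Hz z * e (Q (y + z) + - Q y + - Q z))"
      have "w y * w z * (Fm (y + z) * G y * Hz z * e (4 * ?\<phi> z * of_int y))
         - (Fm (y + z) * e (Q (y + z))) * (w y * (G y * e (- Q y))) * (w z * (Hz z * e (- Q z)))
         = V * (e (psi \<Theta> \<beta> \<alpha> z y + psi \<Theta> \<beta> \<alpha> z y) - 1)"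
        unfolding q4 V_def by (simp only: e_add) (simp add: algebra_simps)
      then have "cmod (w y * w z * (Fm (y + z) * G y * Hz z * e (4 * ?\<phi> z * of_int y))
         - (Fm (y + z) * e (Q (y + z))) * (w y * (G y * e (- Q y))) * (w z * (Hz z * e (- Q z))))
         = cmod V * cmod (1 - e (psi \<Theta> \<beta> \<alpha> z y + psi \<Theta> \<beta> \<alpha> z y))"
        by (simp add: norm_mult norm_minus_commute)
      also have "\<dots> \<le> (w y * w z) * (c2 / 2)"
      proof (intro mult_mono)
        have "cmod (Fm (y + z) * G y * Hz z) \<le> 1" using FH G1 by (simp add: norm_mult mult_le_one)
        then show "cmod V \<le> w y * w z" using w0[of y] w0[of z]
          by (simp add: V_def norm_mult mult_left_le)
        have "cmod (1 - e (psi \<Theta> \<beta> \<alpha> z y + psi \<Theta> \<beta> \<alpha> z y)) \<le> 2 * cmod (1 - e (psi \<Theta> \<beta> \<alpha> z y))"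
          using norm_1_minus_e_add[of "psi \<Theta> \<beta> \<alpha> z y" "psi \<Theta> \<beta> \<alpha> z y"] by simp
        also have "\<dots> \<le> 2 * (C * ?b' z)" using symm[of y z] D128(2)[OF y] D128(2)[OF z] by simp
        also have "\<dots> \<le> 2 * (C * (2 * \<rho>))" using C D128(1)[OF z] by (intro mult_left_mono) auto
        also have "\<dots> \<le> c2 / 2" using \<rho>(3) by simp
        finally show "cmod (1 - e (psi \<Theta> \<beta> \<alpha> z y + psi \<Theta> \<beta> \<alpha> z y)) \<le> c2 / 2" .
      qed (use w0 in auto)
      finally show "cmod (w y * w z * (Fm (y + z) * G y * Hz z * e (4 * ?\<phi> z * of_int y))
         - (Fm (y + z) * e (Q (y + z))) * (w y * (G y * e (- Q y))) * (w z * (Hz z * e (- Q z))))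
         \<le> w y * w z * (c2 / 2)" .
    qed
    also have "\<dots> = (real (card B))\<^sup>2 * (c2 / 2)"
      by (simp only: sum_distrib_right[symmetric] sum_distrib_left[symmetric] sumw power2_eq_square)
    finally have "cmod (S1 - S2) \<le> c2 / 2 * (real (card B))\<^sup>2" by (simp add: mult_ac)
    then have S2: "cmod S2 \<ge> c2 / 2 * (real (card B))\<^sup>2"
      using S1 norm_triangle_ineq2[of S1 "S1 - S2"] by simp
    define P where "P = 8 * M"
    have P: "P > 0" using M by (simp add: P_def)
    \<comment> \<open>Representatives in [-4M, 4M): \<open>A\<close> becomes periodic, as
      \<open>trilinear_bound\<close> requires, and agrees with the original function at every y +
      z.\<close>
    define r where "r m = (m + 4 * M) mod P - 4 * M" for m
    define A where "A m = Fm (r m) * e (Q (r m))" for m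
    have rm: "r m = m" if "\<bar>m\<bar> \<le> 2 * M" for m
    proof -
      have "(m + 4 * M) mod P = m + 4 * M" using that M by (intro mod_pos_pos_trivial) (auto simp: P_def)
      then show ?thesis by (simp add: r_def)
    qed
    have Aper: "periodic P A" by (simp add: periodic_def A_def r_def mod_add_left_eq)
    have A1: "cmod (A m) \<le> 1" for m using FH by (simp add: A_def norm_mult)
    define W where "W k = (\<Sum>y\<in>D. (w y * (G y * e (- Q y))) * chr P k y)" for k
    have "\<exists>k\<in>{0..<P}. \<forall>l\<in>{0..<P}. cmod (W l) \<le> cmod (W k)" using P by (intro ex_argmax) auto
    then obtain k0 where k0: "\<And>l. l \<in> {0..<P} \<Longrightarrow> cmod (W l) \<le> cmod (W k0)" by blast
    have injD: "inj_on (\<lambda>x. x mod P) D"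
    proof (rule inj_onI)
      fix y z assume yz: "y \<in> D" "z \<in> D" and eq: "y mod P = z mod P"
      have "P dvd y - z" using eq by (simp add: mod_eq_dvd_iff)
      moreover have "\<bar>y - z\<bar> < P" using subsetD[OF DM yz(1)] subsetD[OF DM yz(2)] M by (auto simp: P_def)
      ultimately show "y = z" using dvd_imp_le_int[of "y - z" P] P by linarith
    qed
    have "S2 = (\<Sum>y\<in>D. \<Sum>z\<in>D. A (y + z) * (w y * (G y * e (- Q y))) * (w z * (Hz z * e (- Q z))))"
      unfolding S2_def
    proof (intro sum.cong refl)
      fix y z assume "y \<in> D" "z \<in> D"
      then have "\<bar>y + z\<bar> \<le> 2 * M" using subsetD[OF DM, of y] subsetD[OF DM, of z] by auto
      from rm[OF this] show "(Fm (y + z) * e (Q (y + z))) * (w y * (G y * e (- Q y))) * (w z * (Hz z * e (- Q z)))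
        = A (y + z) * (w y * (G y * e (- Q y))) * (w z * (Hz z * e (- Q z)))" by (simp add: A_def)
    qed
    then have "cmod S2 \<le> cmod (W k0) * sqrt (\<Sum>z\<in>D. (cmod (w z * (Hz z * e (- Q z))))\<^sup>2) * sqrt (\<Sum>m\<in>{0..<P}. (cmod (A m))\<^sup>2)"
      using trilinear_bound[OF P Aper finD finD injD, of "\<lambda>y. w y * (G y * e (- Q y))" "cmod (W k0)" "\<lambda>z. w z * (Hz z * e (- Q z))"] k0
      unfolding W_def by simp
    also have "\<dots> \<le> cmod (W k0) * sqrt (3 * of_int M) * sqrt (8 * of_int M)"
    proof (intro mult_mono mult_left_mono real_sqrt_le_mono)
      have "(\<Sum>z\<in>D. (cmod (w z * (Hz z * e (- Q z))))\<^sup>2) \<le> (\<Sum>z\<in>D. 1)"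
      proof (rule sum_mono)
        fix z
        have "cmod (w z * (Hz z * e (- Q z))) \<le> 1" using w0[of z] w1[of z] FH(2)[of z] by (simp add: norm_mult mult_le_one)
        then show "(cmod (w z * (Hz z * e (- Q z))))\<^sup>2 \<le> 1" by (simp add: power_le_one)
      qed
      also have "\<dots> \<le> 3 * of_int M" unfolding D_def using card_bohr_le[OF M, of "2 * \<rho>" \<Theta>'] \<rho> by simp
      finally show "(\<Sum>z\<in>D. (cmod (w z * (Hz z * e (- Q z))))\<^sup>2) \<le> 3 * of_int M" .
      have "(\<Sum>m\<in>{0..<P}. (cmod (A m))\<^sup>2) \<le> (\<Sum>m\<in>{0..<P}. 1)" using A1 by (intro sum_mono) (simp add: power_le_one)
      then show "(\<Sum>m\<in>{0..<P}. (cmod (A m))\<^sup>2) \<le> 8 * of_int M" using P by (simp add: P_def)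
    qed (use MR in \<open>auto simp: sum_nonneg\<close>)
    also have "\<dots> = cmod (W k0) * sqrt (24 * (of_int M)\<^sup>2)"
      by (simp add: real_sqrt_mult[symmetric] power2_eq_square)
    also have "\<dots> \<le> cmod (W k0) * (5 * of_int M)"
    proof (rule mult_left_mono)
      have "24 * (real_of_int M)\<^sup>2 \<le> (5 * of_int M)\<^sup>2" by (simp add: power_mult_distrib)
      then show "sqrt (24 * (of_int M)\<^sup>2) \<le> 5 * of_int M" using MR by (intro real_le_lsqrt) auto
    qed auto
    finally have "c2 / 2 * (real (card B))\<^sup>2 \<le> cmod (W k0) * (5 * of_int M)" using S2 by linarith
    moreover have "c2 / 2 * (cB * of_int M)\<^sup>2 \<le> c2 / 2 * (real (card B))\<^sup>2"
      using Bc cB MR c2 by (intro mult_left_mono power_mono) auto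
    ultimately have "(of_int M * (c5 * of_int M)) * 5 \<le> of_int M * cmod (W k0) * 5"
      by (simp add: c5_def power_mult_distrib power2_eq_square mult_ac)
    then have Wbig: "c5 * of_int M \<le> cmod (W k0)" using MR by (simp add: mult_le_cancel_left)
    have "\<forall>\<theta>. \<exists>a b c :: int. \<bar>a\<bar> \<le> 1 \<and> \<bar>b\<bar> \<le> 1 \<and> (\<forall>y. nd (\<theta> * of_int y) \<le> 1/8 \<longrightarrow>
     round (\<theta> * of_int y) = a * \<lfloor>\<theta> * of_int (x + 2 * y)\<rfloor> + b * \<lfloor>\<theta> / 2 * of_int (x + 2 * y)\<rfloor> - c)"
      by (intro allI round_shift_floor)
    then obtain a b s where abc: "\<And>\<theta>. \<bar>a \<theta>\<bar> \<le> (1::int)" "\<And>\<theta>. \<bar>b \<theta>\<bar> \<le> (1::int)"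
      and rs: "\<And>\<theta> y. nd (\<theta> * of_int y) \<le> 1/8 \<Longrightarrow>
     round (\<theta> * of_int y) = a \<theta> * \<lfloor>\<theta> * of_int (x + 2 * y)\<rfloor> + b \<theta> * \<lfloor>\<theta> / 2 * of_int (x + 2 * y)\<rfloor> - s \<theta>"
      by metis
    define R where "R \<theta> n = a \<theta> * \<lfloor>\<theta> * of_int n\<rfloor> + b \<theta> * \<lfloor>\<theta> / 2 * of_int n\<rfloor>" for \<theta> and n :: int
    \<comment> \<open>This is - \<phi>(y) n with y = (n - x) / 2: the linear part of \<phi> gives
      the quadratic term and a linear one, the constants \<open>s\<close> another linear term, and
      only the floors in \<open>R\<close> give genuine brackets.\<close>
    define \<Psi> where "\<Psi> n = - (\<beta> / 2) * (of_int n)\<^sup>2 + (\<beta> / 2 * of_int x + (\<Sum>\<theta>\<in>\<Theta>. \<alpha> \<theta> * of_int (s \<theta>))) * of_int n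
        + (\<Sum>\<theta>\<in>\<Theta>. - \<alpha> \<theta> * of_int n * of_int (R \<theta> n))" for n :: int
    have Q\<Psi>: "- Q y = \<Psi> (x + 2 * y)" if y: "y \<in> D" for y
    proof -
      have "round (\<theta> * of_int y) = R \<theta> (x + 2 * y) - s \<theta>" if "\<theta> \<in> \<Theta>" for \<theta>
        unfolding R_def by (rule rs) (use nd_le_bnorm[OF MR \<Theta>(1) that, of y] D128(3)[OF y] in linarith)
      then have "?\<phi> y = \<beta> * of_int y + (\<Sum>\<theta>\<in>\<Theta>. \<alpha> \<theta> * of_int (R \<theta> (x + 2 * y) - s \<theta>))" by (simp add: phi_def)
      also have "\<dots> = \<beta> * of_int y + (\<Sum>\<theta>\<in>\<Theta>. \<alpha> \<theta> * of_int (R \<theta> (x + 2 * y))) - (\<Sum>\<theta>\<in>\<Theta>. \<alpha> \<theta> * of_int (s \<theta>))"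
        by (simp add: right_diff_distrib sum_subtractf)
      finally have phy: "?\<phi> y = \<beta> * of_int y + (\<Sum>\<theta>\<in>\<Theta>. \<alpha> \<theta> * of_int (R \<theta> (x + 2 * y))) - (\<Sum>\<theta>\<in>\<Theta>. \<alpha> \<theta> * of_int (s \<theta>))" .
      have "(\<Sum>\<theta>\<in>\<Theta>. - \<alpha> \<theta> * of_int (x + 2 * y) * of_int (R \<theta> (x + 2 * y))) = - of_int (x + 2 * y) * (\<Sum>\<theta>\<in>\<Theta>. \<alpha> \<theta> * of_int (R \<theta> (x + 2 * y)))"
        unfolding sum_distrib_left by (intro sum.cong refl) (simp add: algebra_simps)
      then show ?thesis unfolding \<Psi>_def Q_def phy by (simp add: algebra_simps power2_eq_square)
    qed
    \<comment> \<open>Points of \<open>D\<close> outside \<open>Y\<close> drop out because F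
      vanishes off [1, N], points of \<open>Y\<close> outside \<open>D\<close> because the weight
      vanishes there; so the sum may be taken over \<open>Y\<close>, where all conditions concern n
      = x + 2y.\<close>
    define Y where "Y = {y \<in> {- 2 * M..2 * M}. x + 2 * y \<in> {1..N}}"
    define g where "g y = cnj (F (x + 2 * y)) * e (\<xi>0 * of_int (x + 2 * y)) * e (\<Psi> (x + 2 * y)) * e (\<sigma> * of_int y) * chr P k0 y" for y
    have "W k0 = (\<Sum>y\<in>Y. of_real (real (rep B y) / real (card B)) * g y)"
      unfolding W_def
    proof (rule sum.mono_neutral_cong)
      show "finite D" by (rule finD)
      show "finite Y" by (rule finite_subset[of _ "{- 2 * M..2 * M}"]) (auto simp: Y_def)
      fix y
      show "of_real (real (rep B y) / real (card B)) * g y = 0" if "y \<in> Y - D"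
        using wD[of y] that by (auto simp: w_def)
      show "(w y * (G y * e (- Q y))) * chr P k0 y = 0" if "y \<in> D - Y"
      proof -
        have "y \<in> {- 2 * M..2 * M}" using subsetD[OF DM, of y] that M by auto
        then have "x + 2 * y \<notin> {1..N}" using that by (auto simp: Y_def)
        then have "f2 (x + 2 * y) = 0" using F0 by (auto simp: f2_def)
        then show ?thesis by (simp add: G_def)
      qed
      show "(w y * (G y * e (- Q y))) * chr P k0 y = of_real (real (rep B y) / real (card B)) * g y" if "y \<in> D \<inter> Y"
      proof -
        have "x + 2 * y \<in> {0..<M}" using that NM by (auto simp: Y_def)
        moreover have "- Q y = \<Psi> (x + 2 * y)" using that Q\<Psi> by blast
        ultimately show ?thesis by (simp add: w_def g_def G_def f2_def mult_ac)
      qed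
    qed
    moreover obtain k1 where "cmod (\<Sum>y\<in>Y. of_real (real (rep B y) / real (card B)) * g y) \<le> cmod (\<Sum>y\<in>Y. g y * chr (8 * M) k1 y)"
      by (rule remove_autocorrelation_weight[OF M BM Bne, of Y g]) (auto simp: Y_def)
    ultimately have g1: "c5 * of_int M \<le> cmod (\<Sum>y\<in>Y. g y * chr P k1 y)" using Wbig by (simp add: P_def)
    define h where "h n = cnj (F n) * e (\<xi>0 * of_int n) * e (\<Psi> n)" for n
    define \<tau> where "\<tau> = \<sigma> + of_int (k0 + k1) / of_int P"
    have "g y * chr P k1 y = h (x + 2 * y) * e (\<tau> * of_int y)" for y
    proof -
      have "e (\<tau> * of_int y) = e (\<sigma> * of_int y) * chr P k0 y * chr P k1 y"
        unfolding chr_def e_add[symmetric] \<tau>_def by (rule arg_cong[of _ _ e]) (simp add: algebra_simps add_divide_distrib)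
      then show ?thesis by (simp add: g_def h_def mult_ac)
    qed
    then have g2: "c5 * of_int M \<le> cmod (\<Sum>y\<in>Y. h (x + 2 * y) * e (\<tau> * of_int y))" using g1 by simp
    obtain \<mu> where "cmod (\<Sum>y\<in>Y. h (x + 2 * y) * e (\<tau> * of_int y)) \<le> cmod (\<Sum>n\<in>{1..N}. h n * e (\<mu> * of_int n))"
      unfolding Y_def by (rule sum_over_progression[OF N less_imp_le[OF NM] x])
    then have g3: "c5 * of_int M \<le> cmod (\<Sum>n\<in>{1..N}. h n * e (\<mu> * of_int n))" using g2 by linarith
    define l2 where "l2 = - (\<beta> / 2)"
    define l1 where "l1 = \<beta> / 2 * of_int x + (\<Sum>\<theta>\<in>\<Theta>. \<alpha> \<theta> * of_int (s \<theta>)) + \<xi>0 + \<mu>"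
    have "h n * e (\<mu> * of_int n) = cnj (F n) * e (l2 * (of_int n)\<^sup>2 + l1 * of_int n +
         (\<Sum>\<theta>\<in>\<Theta>. (- \<alpha> \<theta>) * of_int n * of_int (a \<theta> * \<lfloor>\<theta> * of_int n\<rfloor> + b \<theta> * \<lfloor>\<theta> / 2 * of_int n\<rfloor>)))" for n
    proof -
      have "e (\<xi>0 * of_int n) * e (\<Psi> n) * e (\<mu> * of_int n) = e (l2 * (of_int n)\<^sup>2 + l1 * of_int n +
         (\<Sum>\<theta>\<in>\<Theta>. (- \<alpha> \<theta>) * of_int n * of_int (R \<theta> n)))"
        unfolding e_add[symmetric] by (rule arg_cong[of _ _ e]) (simp add: \<Psi>_def l2_def l1_def distrib_right)
      then show ?thesis unfolding h_def R_def by (simp only: mult.assoc)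
    qed
    then have "c5 * of_int M \<le> cmod (\<Sum>n\<in>{1..N}. cnj (F n) * e (l2 * (of_int n)\<^sup>2 + l1 * of_int n +
         (\<Sum>\<theta>\<in>\<Theta>. (- \<alpha> \<theta>) * of_int n * of_int (a \<theta> * \<lfloor>\<theta> * of_int n\<rfloor> + b \<theta> * \<lfloor>\<theta> / 2 * of_int n\<rfloor>))))"
      using g3 by (simp only:)
    then show "\<exists>(\<Theta>::real set) \<alpha> a b l2 l1. finite \<Theta> \<and> card \<Theta> \<le> d \<and> (\<forall>\<theta>. \<bar>a \<theta>\<bar> \<le> (1::int) \<and> \<bar>b \<theta>\<bar> \<le> (1::int)) \<and>
      cmod (\<Sum>n\<in>{1..N}. cnj (F n) * e (l2 * (of_int n)\<^sup>2 + l1 * of_int n +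
         (\<Sum>\<theta>\<in>\<Theta>. \<alpha> \<theta> * of_int n * of_int (a \<theta> * \<lfloor>\<theta> * of_int n\<rfloor> + b \<theta> * \<lfloor>\<theta> / 2 * of_int n\<rfloor>))))
      \<ge> c5 * of_int M"
      using \<Theta> abc by (intro exI[of _ \<Theta>] exI[of _ "\<lambda>\<theta>. - \<alpha> \<theta>"] exI[of _ a] exI[of _ b] exI[of _ l2] exI[of _ l1] conjI) auto
  qed
qed

section \<open>Bracket quadratics as nilcharacters\<close>

lemma periodic_zext: "periodic (int M) (zext M N f)"
  by (simp add: periodic_def zext_def)

lemma zext_bounded: "(\<And>n. n \<in> {1..int N} \<Longrightarrow> cmod (f n) \<le> 1) \<Longrightarrow> cmod (zext M N f m) \<le> 1"
  by (simp add: zext_def Let_def)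

lemma zext_eq:
  assumes "n \<in> {0..<int M}"
  shows "zext M N f n = (if n \<in> {1..int N} then f n else 0)"
  using assms by (simp add: zext_def Let_def)

text \<open>Grouping the last two differences into a squared modulus shows the quantity to be real
  and nonnegative, so that \<open>U3_cyc\<close> takes the eighth root of a nonnegative number equal
  to it.\<close>

lemma U3_cyc_pow8_eq:
  assumes M: "M > 0" and per: "periodic (int M) F"
  shows "U3_cyc_pow8 M F = of_real ((\<Sum>h\<in>{0..<int M}. \<Sum>h1\<in>{0..<int M}.
     (cmod (\<Sum>x\<in>{0..<int M}. Delta h1 (Delta h F) x))\<^sup>2) / real M ^ 4)"
proof -
  let ?I = "{0..<int M}"
  have "(\<Sum>x\<in>?I. \<Sum>h1\<in>?I. \<Sum>h2\<in>?I. \<Sum>h\<in>?I. Delta h1 (Delta h2 (Delta h F)) x)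
     = (\<Sum>x\<in>?I. \<Sum>h1\<in>?I. \<Sum>h\<in>?I. \<Sum>h2\<in>?I. Delta h1 (Delta h2 (Delta h F)) x)"
    by (intro sum.cong refl sum.swap)
  also have "\<dots> = (\<Sum>x\<in>?I. \<Sum>h\<in>?I. \<Sum>h1\<in>?I. \<Sum>h2\<in>?I. Delta h1 (Delta h2 (Delta h F)) x)"
    by (intro sum.cong refl sum.swap)
  also have "\<dots> = (\<Sum>h\<in>?I. \<Sum>x\<in>?I. \<Sum>h1\<in>?I. \<Sum>h2\<in>?I. Delta h1 (Delta h2 (Delta h F)) x)"
    by (rule sum.swap)
  also have "\<dots> = (\<Sum>h\<in>?I. of_real (\<Sum>h1\<in>?I. (cmod (\<Sum>x\<in>?I. Delta h1 (Delta h F) x))\<^sup>2))"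
    using M by (intro sum.cong refl U2_identity Delta_periodic per) auto
  finally show ?thesis unfolding U3_cyc_pow8_def by simp
qed

text \<open>For an indicator all terms are nonnegative, so it is enough to keep h and h1 up to N/4,
  where at least N/2 points have all four translates in [1, N]. The constant is (1/4) (1/4) (1/2)^2
  / 8^4.\<close>

lemma U3_indicator_lower:
  fixes N :: nat
  assumes N: "N \<ge> 1"
  shows "Re (U3_cyc_pow8 (8 * N) (zext (8 * N) N (\<lambda>_. 1))) \<ge> 1 / 2 ^ 18"
proof -
  define M where "M = int (8 * N)"
  define p where "p = int N div 4"
  define g where "g = zext (8 * N) N (\<lambda>_. 1)"
  define J where "J y = (if 1 \<le> y mod M \<and> y mod M \<le> int N then 1 else 0 :: real)" for y
  have gJ: "g y = of_real (J y)" for y by (simp add: g_def zext_def J_def M_def Let_def)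
  have J0: "J y \<ge> 0" for y by (simp add: J_def)
  have J1: "J y = 1" if "y \<in> {1..int N}" for y
    using that N by (simp add: J_def M_def mod_pos_pos_trivial)
  have p: "4 * p \<le> int N" "int N \<le> 4 * p + 3" "p \<ge> 0" unfolding p_def by auto
  have M: "M > 0" "int N < M" using N by (auto simp: M_def)
  have inner: "(cmod (\<Sum>x\<in>{0..<M}. Delta h1 (Delta h g) x))\<^sup>2 \<ge> (real N / 2)\<^sup>2" if h: "h \<in> {0..p}" "h1 \<in> {0..p}" for h h1
  proof -
    define j where "j x = J (x + h1 + h) * J (x + h1) * (J (x + h) * J x)" for x
    have j0: "j x \<ge> 0" for x using J0 by (simp add: j_def)
    have "(\<Sum>x\<in>{0..<M}. Delta h1 (Delta h g) x) = of_real (\<Sum>x\<in>{0..<M}. j x)"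
      unfolding of_real_sum by (intro sum.cong refl) (simp add: Delta_def gJ j_def)
    then have "cmod (\<Sum>x\<in>{0..<M}. Delta h1 (Delta h g) x) = (\<Sum>x\<in>{0..<M}. j x)"
      using j0 by (simp only: norm_of_real) (simp add: sum_nonneg)
    also have "\<dots> \<ge> (\<Sum>x\<in>{1..int N - 2 * p}. j x)"
    proof (rule sum_mono2)
      show "{1..int N - 2 * p} \<subseteq> {0..<M}"
      proof
        fix x assume "x \<in> {1..int N - 2 * p}"
        then have "1 \<le> x" "x \<le> int N - 2 * p" by auto
        then show "x \<in> {0..<M}" using M p(3) by simp
      qed
    qed (use j0 in auto)
    also have "(\<Sum>x\<in>{1..int N - 2 * p}. j x) = (\<Sum>x\<in>{1..int N - 2 * p}. 1)"
    proof (intro sum.cong refl)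
      fix x assume "x \<in> {1..int N - 2 * p}"
      then have "x + h1 + h \<in> {1..int N}" "x + h1 \<in> {1..int N}" "x + h \<in> {1..int N}" "x \<in> {1..int N}"
        using h p by auto
      then show "j x = 1" by (simp only: j_def J1)
    qed
    also have "\<dots> = of_int (int N - 2 * p)" using p by simp
    finally have "real N / 2 \<le> cmod (\<Sum>x\<in>{0..<M}. Delta h1 (Delta h g) x)" using p by linarith
    then show ?thesis by (intro power_mono) auto
  qed
  \<comment> \<open>The interval contains p + 1 integers, which is at least N/4 even when p =
    0.\<close>
  have cp: "real (card {0..p}) \<ge> real N / 4" using p by simp
  have "(real N / 4) * (real N / 4) * (real N / 2)\<^sup>2 \<le> real (card {0..p}) * real (card {0..p}) * (real N / 2)\<^sup>2"
    using cp by (intro mult_right_mono mult_mono) auto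
  also have "\<dots> = (\<Sum>h\<in>{0..p}. \<Sum>h1\<in>{0..p}. (real N / 2)\<^sup>2)" using p(3) by simp
  also have "\<dots> \<le> (\<Sum>h\<in>{0..p}. \<Sum>h1\<in>{0..p}. (cmod (\<Sum>x\<in>{0..<M}. Delta h1 (Delta h g) x))\<^sup>2)"
    using inner by (intro sum_mono) auto
  also have "\<dots> \<le> (\<Sum>h\<in>{0..p}. \<Sum>h1\<in>{0..<M}. (cmod (\<Sum>x\<in>{0..<M}. Delta h1 (Delta h g) x))\<^sup>2)"
    using p M by (intro sum_mono sum_mono2) auto
  also have "\<dots> \<le> (\<Sum>h\<in>{0..<M}. \<Sum>h1\<in>{0..<M}. (cmod (\<Sum>x\<in>{0..<M}. Delta h1 (Delta h g) x))\<^sup>2)"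
    using p M by (intro sum_mono2 sum_nonneg) auto
  finally have "(real N / 4) * (real N / 4) * (real N / 2)\<^sup>2 / real (8 * N) ^ 4
     \<le> (\<Sum>h\<in>{0..<M}. \<Sum>h1\<in>{0..<M}. (cmod (\<Sum>x\<in>{0..<M}. Delta h1 (Delta h g) x))\<^sup>2) / real (8 * N) ^ 4"
    by (rule divide_right_mono) simp
  moreover have "(real N / 4) * (real N / 4) * (real N / 2)\<^sup>2 / real (8 * N) ^ 4 = 1 / 2 ^ 18"
    using N by (simp add: eval_nat_numeral)
  moreover have "Re (U3_cyc_pow8 (8 * N) g) = (\<Sum>h\<in>{0..<M}. \<Sum>h1\<in>{0..<M}. (cmod (\<Sum>x\<in>{0..<M}. Delta h1 (Delta h g) x))\<^sup>2) / real (8 * N) ^ 4"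
    using U3_cyc_pow8_eq[of "8 * N" g] N periodic_zext[of "8 * N" N] unfolding g_def M_def by simp
  ultimately show ?thesis by (simp add: g_def)
qed

text \<open>The indicator stands in the denominator, so its lower bound is what turns a bound for
  the normalised norm into one for the cyclic sum of \<open>f\<close>.\<close>

lemma U3_interval_lower:
  fixes N :: nat
  assumes N: "N \<ge> 1" and \<delta>: "0 < \<delta>" and U: "U3_interval N f \<ge> \<delta>"
  shows "(\<Sum>h\<in>{0..<int (8 * N)}. \<Sum>h1\<in>{0..<int (8 * N)}.
     (cmod (\<Sum>x\<in>{0..<int (8 * N)}. Delta h1 (Delta h (zext (8 * N) N f)) x))\<^sup>2) \<ge> \<delta> ^ 8 / 2 ^ 18 * of_int (int (8 * N)) ^ 4"
    (is "?V \<ge> _")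
proof -
  define A where "A = Re (U3_cyc_pow8 (8 * N) (zext (8 * N) N f))"
  define B where "B = Re (U3_cyc_pow8 (8 * N) (zext (8 * N) N (\<lambda>_. 1)))"
  have B: "B \<ge> 1 / 2 ^ 18" unfolding B_def by (rule U3_indicator_lower[OF N])
  then have B0: "B > 0" by (smt (verit) divide_pos_pos zero_less_power)
  have AV: "A = ?V / real (8 * N) ^ 4"
    unfolding A_def using U3_cyc_pow8_eq[of "8 * N" "zext (8 * N) N f"] N periodic_zext[of "8 * N" N] by simp
  have A0: "A \<ge> 0" unfolding AV by (intro divide_nonneg_nonneg sum_nonneg) auto
  have "A \<ge> \<delta> ^ 8 * B"
  proof (rule ccontr)
    assume "\<not> A \<ge> \<delta> ^ 8 * B"
    then have "A powr (1/8) < (\<delta> ^ 8 * B) powr (1/8)" using A0 by (intro powr_less_mono2) auto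
    also have "\<dots> = \<delta> * B powr (1/8)"
    proof -
      have "\<delta> ^ 8 = \<delta> powr 8" using \<delta> by (simp add: powr_numeral)
      then have "(\<delta> ^ 8) powr (1/8) = \<delta> powr (8 * (1/8))" by (simp only: powr_powr)
      also have "\<dots> = \<delta>" using \<delta> by simp
      finally show ?thesis using \<delta> B0 by (simp add: powr_mult)
    qed
    finally have "A powr (1/8) / B powr (1/8) < \<delta>" using B0 by (simp add: field_simps)
    then show False using U by (simp add: U3_interval_def U3_cyc_def A_def B_def)
  qed
  moreover have "\<delta> ^ 8 * (1 / 2 ^ 18) \<le> \<delta> ^ 8 * B" using B \<delta> by (intro mult_left_mono) auto
  ultimately have le: "\<delta> ^ 8 / 2 ^ 18 \<le> ?V / real (8 * N) ^ 4" using AV by simp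
  have pos: "real (8 * N) ^ 4 > 0" using N by simp
  from pos_le_divide_eq[OF pos, THEN iffD1, OF le] show ?thesis by simp
qed

section \<open>Bracket phases as products of the functions F\<close>

lemma prod_e: "finite S \<Longrightarrow> (\<Prod>s\<in>S. e (f s)) = e (\<Sum>s\<in>S. f s)"
  by (induction S rule: finite_induct) (auto simp: e_add)

lemma e_powi: "e x powi m = e (of_int m * x)"
proof (cases "m \<ge> 0")
  case True
  then show ?thesis by (simp add: power_int_def e_power)
next
  case False
  have "inverse (e y) = e (- y)" for y
    using e_mult_cnj[of y] by (simp add: cnj_e inverse_unique)
  then show ?thesis using False by (simp add: power_int_def power_inverse[symmetric] e_power)
qed

lemma finite_pairs: "finite (pairs k)"
  by (rule finite_subset[of _ "{1..k} \<times> {1..k}"]) (auto simp: pairs_def)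

text \<open>The exponents of the nilcharacter are supported on diagonals of pairs (u j, v j);
  injectivity of \<open>u\<close> ensures that no pair is hit twice.\<close>

lemma sum_pairs_diagonal:
  fixes G :: "nat \<Rightarrow> nat \<Rightarrow> real"
  assumes "\<And>j. j \<in> {1..D} \<Longrightarrow> (u j, v j) \<in> pairs k" "inj_on u {1..D}"
  shows "(\<Sum>(i, i')\<in>pairs k. if \<exists>j\<in>{1..D}. i = u j \<and> i' = v j then G i i' else 0) = (\<Sum>j\<in>{1..D}. G (u j) (v j))"
proof -
  define S where "S = (\<lambda>j. (u j, v j)) ` {1..D}"
  have "(\<Sum>(i, i')\<in>pairs k. if \<exists>j\<in>{1..D}. i = u j \<and> i' = v j then G i i' else 0) = (\<Sum>(i, i')\<in>S. G i i')"
  proof (rule sum.mono_neutral_cong_right[OF finite_pairs])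
    show "S \<subseteq> pairs k" using assms(1) by (auto simp: S_def)
    show "\<forall>p\<in>pairs k - S. (case p of (i, i') \<Rightarrow> if \<exists>j\<in>{1..D}. i = u j \<and> i' = v j then G i i' else 0) = 0"
      by (auto simp: S_def)
    fix p assume "p \<in> S"
    then obtain j where "j \<in> {1..D}" "p = (u j, v j)" by (auto simp: S_def)
    moreover from this have "\<exists>l\<in>{1..D}. u j = u l \<and> v j = v l" by blast
    ultimately show "(case p of (i, i') \<Rightarrow> if \<exists>j\<in>{1..D}. i = u j \<and> i' = v j then G i i' else 0) = (case p of (i, i') \<Rightarrow> G i i')"
      by simp
  qed
  also have "\<dots> = (\<Sum>j\<in>{1..D}. G (u j) (v j))"
    unfolding S_def by (subst sum.reindex) (use assms(2) in \<open>auto simp: inj_on_def\<close>)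
  finally show ?thesis .
qed

text \<open>Generators: \<open>1..D\<close> carry the \<open>\<theta>\<close>, \<open>D+1..2D\<close> the \<open>\<theta>/2\<close>, and \<open>2D+1..3D\<close> the coefficients \<open>- \<alpha>\<close>.\<close>
lemma bracket_quadratic_as_chi:
  fixes \<Theta> :: "real set"
  assumes \<Theta>: "finite \<Theta>" and ab: "\<And>\<theta>. \<bar>a \<theta>\<bar> \<le> (1::int)" "\<And>\<theta>. \<bar>b \<theta>\<bar> \<le> (1::int)"
  obtains m \<xi> where "\<And>i i'. \<bar>m i' i\<bar> \<le> (2::int)"
    "\<And>n. chi l2 l1 (3 * card \<Theta>) m (poly_seq \<xi> (\<lambda>_ _. 0) (\<lambda>_ _. 0) (\<lambda>_ _. 0)) n
       = e (l2 * (of_int n)\<^sup>2 + l1 * of_int n +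
         (\<Sum>\<theta>\<in>\<Theta>. \<alpha> \<theta> * of_int n * of_int (a \<theta> * \<lfloor>\<theta> * of_int n\<rfloor> + b \<theta> * \<lfloor>\<theta> / 2 * of_int n\<rfloor>)))"
proof -
  define D where "D = card \<Theta>"
  obtain h where h: "bij_betw h {1..D} \<Theta>" using ex_bij_betw_nat_finite_1[OF \<Theta>] by (auto simp: D_def)
  define \<xi> where "\<xi> i = (if i \<le> D then h i else if i \<le> 2 * D then h (i - D) / 2 else - \<alpha> (h (i - 2 * D)))" for i
  define m1 where "m1 i' i = (if \<exists>j\<in>{1..D}. i = j \<and> i' = j + 2 * D then a (h i) else 0)" for i' i
  define m2 where "m2 i' i = (if \<exists>j\<in>{1..D}. i = j + D \<and> i' = j + 2 * D then b (h (i - D)) else 0)" for i' i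
  define m where "m i' i = m1 i' i + m2 i' i" for i' i
  \<comment> \<open>With zero polynomials q the function F is e(- \<xi>' n floor(\<xi> n)); the
    minus sign is cancelled by the coefficients - \<alpha> on the third block of generators.\<close>
  define t where "t n i i' = - (\<xi> i' * of_int n * of_int \<lfloor>\<xi> i * of_int n\<rfloor>)" for i i' and n :: int
  show ?thesis
  proof (rule that[of m \<xi>])
    fix i i'
    have "\<bar>m1 i' i\<bar> \<le> 1" "\<bar>m2 i' i\<bar> \<le> 1" using ab by (auto simp: m1_def m2_def)
    then show "\<bar>m i' i\<bar> \<le> 2" unfolding m_def by linarith
  next
    fix n :: int
    have F: "F_comm i' i (poly_seq \<xi> (\<lambda>_ _. 0) (\<lambda>_ _. 0) (\<lambda>_ _. 0) n) powi (m i' i) = e (of_int (m i' i) * t n i i')" for i i'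
      by (simp add: F_comm_def poly_seq_def e_powi t_def)
    have "(\<Prod>(i, i')\<in>pairs (3 * D). F_comm i' i (poly_seq \<xi> (\<lambda>_ _. 0) (\<lambda>_ _. 0) (\<lambda>_ _. 0) n) powi (m i' i))
       = e (\<Sum>(i, i')\<in>pairs (3 * D). of_int (m i' i) * t n i i')"
      unfolding F by (simp add: split_def prod_e[OF finite_pairs])
    also have "(\<Sum>(i, i')\<in>pairs (3 * D). of_int (m i' i) * t n i i')
       = (\<Sum>(i, i')\<in>pairs (3 * D). if \<exists>j\<in>{1..D}. i = j \<and> i' = j + 2 * D then of_int (a (h i)) * t n i i' else 0)
       + (\<Sum>(i, i')\<in>pairs (3 * D). if \<exists>j\<in>{1..D}. i = j + D \<and> i' = j + 2 * D then of_int (b (h (i - D))) * t n i i' else 0)"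
      unfolding sum.distrib[symmetric] by (intro sum.cong refl) (auto simp: m_def m1_def m2_def distrib_right)
    also have "(\<Sum>(i, i')\<in>pairs (3 * D). if \<exists>j\<in>{1..D}. i = j \<and> i' = j + 2 * D then of_int (a (h i)) * t n i i' else 0)
       = (\<Sum>j\<in>{1..D}. of_int (a (h j)) * t n j (j + 2 * D))"
      by (rule sum_pairs_diagonal[where u = "\<lambda>j. j"]) (auto simp: pairs_def)
    also have "(\<Sum>(i, i')\<in>pairs (3 * D). if \<exists>j\<in>{1..D}. i = j + D \<and> i' = j + 2 * D then of_int (b (h (i - D))) * t n i i' else 0)
       = (\<Sum>j\<in>{1..D}. of_int (b (h (j + D - D))) * t n (j + D) (j + 2 * D))"
      by (rule sum_pairs_diagonal) (auto simp: pairs_def)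
    also have "(\<Sum>j\<in>{1..D}. of_int (a (h j)) * t n j (j + 2 * D)) + (\<Sum>j\<in>{1..D}. of_int (b (h (j + D - D))) * t n (j + D) (j + 2 * D))
       = (\<Sum>j\<in>{1..D}. \<alpha> (h j) * of_int n * of_int (a (h j) * \<lfloor>h j * of_int n\<rfloor> + b (h j) * \<lfloor>h j / 2 * of_int n\<rfloor>))"
      unfolding sum.distrib[symmetric] by (intro sum.cong refl) (auto simp: t_def \<xi>_def algebra_simps)
    also have "\<dots> = (\<Sum>\<theta>\<in>\<Theta>. \<alpha> \<theta> * of_int n * of_int (a \<theta> * \<lfloor>\<theta> * of_int n\<rfloor> + b \<theta> * \<lfloor>\<theta> / 2 * of_int n\<rfloor>))"
      by (rule sum.reindex_bij_betw[OF h])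
    finally show "chi l2 l1 (3 * card \<Theta>) m (poly_seq \<xi> (\<lambda>_ _. 0) (\<lambda>_ _. 0) (\<lambda>_ _. 0)) n
       = e (l2 * (of_int n)\<^sup>2 + l1 * of_int n +
         (\<Sum>\<theta>\<in>\<Theta>. \<alpha> \<theta> * of_int n * of_int (a \<theta> * \<lfloor>\<theta> * of_int n\<rfloor> + b \<theta> * \<lfloor>\<theta> / 2 * of_int n\<rfloor>)))"
      unfolding chi_def D_def[symmetric] by (simp only: e_add)
  qed
qed

theorem theorem5p4:
  "\<forall>\<delta>::real. 0 < \<delta> \<and> \<delta> \<le> 1 \<longrightarrow>
    (\<exists>C::real. \<exists>c::real. c > 0 \<and>
      (\<forall>(N::nat) (f::int \<Rightarrow> complex).
         N \<ge> 1 \<and> (\<forall>n\<in>{1..int N}. norm (f n) \<le> 1) \<and> U3_interval N f \<ge> \<delta> \<longrightarrow>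
         (\<exists>(\<alpha>::real) (\<beta>::real) (k::nat) (m::nat \<Rightarrow> nat \<Rightarrow> int) (\<xi>::nat \<Rightarrow> real)
             (qa::nat \<Rightarrow> nat \<Rightarrow> real) (qb::nat \<Rightarrow> nat \<Rightarrow> real) (qc::nat \<Rightarrow> nat \<Rightarrow> real).
            real k \<le> C \<and>
            (\<forall>(i, i')\<in>pairs k. real_of_int \<bar>m i' i\<bar> \<le> C) \<and>
            norm ((\<Sum>n\<in>{1..int N}. f n * cnj (chi \<alpha> \<beta> k m (poly_seq \<xi> qa qb qc) n)) / of_nat N)
              \<ge> c)))"
proof (intro allI impI)
  fix \<delta> :: real assume \<delta>: "0 < \<delta> \<and> \<delta> \<le> 1"
  \<comment> \<open>2^18 comes from the norm of the indicator, the further 2 from the factor in the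
    hypothesis of \<open>bracket_quadratic_correlation\<close>.\<close>
  define c0 where "c0 = \<delta> ^ 8 / 2 ^ 19"
  have c0: "0 < c0" "c0 \<le> 1"
  proof -
    show "0 < c0" using \<delta> by (simp add: c0_def)
    have "\<delta> ^ 8 \<le> 1" using \<delta> by (simp add: power_le_one)
    then show "c0 \<le> 1" by (simp add: c0_def)
  qed
  obtain d :: nat and c5 where c5: "c5 > 0" and main: "\<forall>N M F. 0 < N \<longrightarrow> N < M \<longrightarrow> periodic M F \<longrightarrow> (\<forall>m. cmod (F m) \<le> 1) \<longrightarrow>
    (\<forall>n\<in>{0..<M}. n \<notin> {1..N} \<longrightarrow> F n = 0) \<longrightarrow>
    (\<Sum>h\<in>{0..<M}. \<Sum>h1\<in>{0..<M}. (cmod (\<Sum>x\<in>{0..<M}. Delta h1 (Delta h F) x))\<^sup>2) \<ge> 2 * c0 * of_int M ^ 4 \<longrightarrow>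
    (\<exists>(\<Theta>::real set) \<alpha> a b l2 l1. finite \<Theta> \<and> card \<Theta> \<le> d \<and> (\<forall>\<theta>. \<bar>a \<theta>\<bar> \<le> (1::int) \<and> \<bar>b \<theta>\<bar> \<le> (1::int)) \<and>
      cmod (\<Sum>n\<in>{1..N}. cnj (F n) * e (l2 * (of_int n)\<^sup>2 + l1 * of_int n +
         (\<Sum>\<theta>\<in>\<Theta>. \<alpha> \<theta> * of_int n * of_int (a \<theta> * \<lfloor>\<theta> * of_int n\<rfloor> + b \<theta> * \<lfloor>\<theta> / 2 * of_int n\<rfloor>))))
      \<ge> c5 * of_int M)"
    using bracket_quadratic_correlation[OF c0] by (elim exE conjE)
  \<comment> \<open>3 d bounds the number of generators, three for each frequency, and 2 bounds the
    exponents.\<close>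
  define C where "C = 3 * real d + 2"
  show "\<exists>C::real. \<exists>c::real. c > 0 \<and>
      (\<forall>(N::nat) (f::int \<Rightarrow> complex).
         N \<ge> 1 \<and> (\<forall>n\<in>{1..int N}. norm (f n) \<le> 1) \<and> U3_interval N f \<ge> \<delta> \<longrightarrow>
         (\<exists>(\<alpha>::real) (\<beta>::real) (k::nat) (m::nat \<Rightarrow> nat \<Rightarrow> int) (\<xi>::nat \<Rightarrow> real)
             (qa::nat \<Rightarrow> nat \<Rightarrow> real) (qb::nat \<Rightarrow> nat \<Rightarrow> real) (qc::nat \<Rightarrow> nat \<Rightarrow> real).
            real k \<le> C \<and>
            (\<forall>(i, i')\<in>pairs k. real_of_int \<bar>m i' i\<bar> \<le> C) \<and>
            norm ((\<Sum>n\<in>{1..int N}. f n * cnj (chi \<alpha> \<beta> k m (poly_seq \<xi> qa qb qc) n)) / of_nat N)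
              \<ge> c))"
  proof (rule exI[of _ C], rule exI[of _ c5], intro conjI allI impI)
    show "c5 > 0" by (rule c5)
    fix N :: nat and f :: "int \<Rightarrow> complex"
    assume asm: "N \<ge> 1 \<and> (\<forall>n\<in>{1..int N}. norm (f n) \<le> 1) \<and> U3_interval N f \<ge> \<delta>"
    define M where "M = int (8 * N)"
    define F where "F = zext (8 * N) N f"
    have N: "0 < int N" "int N < M" using asm by (auto simp: M_def)
    have per: "periodic M F" unfolding M_def F_def by (rule periodic_zext)
    have bd: "\<forall>m. cmod (F m) \<le> 1" unfolding F_def using asm by (intro allI zext_bounded) auto
    have Feq: "F n = (if n \<in> {1..int N} then f n else 0)" if "n \<in> {0..<M}" for n
      using zext_eq[of n "8 * N" N f] that by (simp add: F_def M_def)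
    then have F0: "\<forall>n\<in>{0..<M}. n \<notin> {1..int N} \<longrightarrow> F n = 0" by auto
    have U: "(\<Sum>h\<in>{0..<M}. \<Sum>h1\<in>{0..<M}. (cmod (\<Sum>x\<in>{0..<M}. Delta h1 (Delta h F) x))\<^sup>2) \<ge> 2 * c0 * of_int M ^ 4"
      using U3_interval_lower[of N \<delta> f] asm \<delta> unfolding M_def F_def c0_def by simp
    obtain \<Theta> :: "real set" and \<alpha> a b l2 l1 where \<Theta>: "finite \<Theta>" "card \<Theta> \<le> d" and ab: "\<forall>\<theta>. \<bar>a \<theta>\<bar> \<le> (1::int) \<and> \<bar>b \<theta>\<bar> \<le> (1::int)"
      and cor: "cmod (\<Sum>n\<in>{1..int N}. cnj (F n) * e (l2 * (of_int n)\<^sup>2 + l1 * of_int n +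
         (\<Sum>\<theta>\<in>\<Theta>. \<alpha> \<theta> * of_int n * of_int (a \<theta> * \<lfloor>\<theta> * of_int n\<rfloor> + b \<theta> * \<lfloor>\<theta> / 2 * of_int n\<rfloor>))))
      \<ge> c5 * of_int M"
      using main[THEN spec, THEN spec, THEN spec, THEN mp, OF N(1), THEN mp, OF N(2), THEN mp, OF per, THEN mp, OF bd, THEN mp, OF F0, THEN mp, OF U]
      by (elim exE conjE)
    obtain m \<xi> where m: "\<And>i i'. \<bar>m i' i\<bar> \<le> (2::int)"
      and chi: "\<And>n. chi l2 l1 (3 * card \<Theta>) m (poly_seq \<xi> (\<lambda>_ _. 0) (\<lambda>_ _. 0) (\<lambda>_ _. 0)) n
       = e (l2 * (of_int n)\<^sup>2 + l1 * of_int n +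
         (\<Sum>\<theta>\<in>\<Theta>. \<alpha> \<theta> * of_int n * of_int (a \<theta> * \<lfloor>\<theta> * of_int n\<rfloor> + b \<theta> * \<lfloor>\<theta> / 2 * of_int n\<rfloor>)))"
      by (rule bracket_quadratic_as_chi[OF \<Theta>(1), of a b l2 l1 \<alpha>]) (use ab in auto)
    let ?\<chi> = "chi l2 l1 (3 * card \<Theta>) m (poly_seq \<xi> (\<lambda>_ _. 0) (\<lambda>_ _. 0) (\<lambda>_ _. 0))"
    \<comment> \<open>The correlation was obtained for the conjugate of F; conjugating the whole sum
      moves the bar to the nilcharacter without changing the modulus.\<close>
    have "(\<Sum>n\<in>{1..int N}. f n * cnj (?\<chi> n)) = cnj (\<Sum>n\<in>{1..int N}. cnj (F n) * ?\<chi> n)"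
      using Feq N by (simp add: cnj_sum)
    then have "cmod (\<Sum>n\<in>{1..int N}. f n * cnj (?\<chi> n)) = cmod (\<Sum>n\<in>{1..int N}. cnj (F n) * ?\<chi> n)"
      by (simp only: complex_mod_cnj)
    then have "c5 * of_int M \<le> cmod (\<Sum>n\<in>{1..int N}. f n * cnj (?\<chi> n))" using cor by (simp only: chi)
    moreover have "c5 * real N \<le> c5 * of_int M" using c5 by (simp add: M_def)
    ultimately have "c5 * real N \<le> cmod (\<Sum>n\<in>{1..int N}. f n * cnj (?\<chi> n))" by linarith
    then have fin: "c5 \<le> norm ((\<Sum>n\<in>{1..int N}. f n * cnj (?\<chi> n)) / of_nat N)"
      using asm by (simp add: norm_divide pos_le_divide_eq)
    have "real_of_int \<bar>m i' i\<bar> \<le> C" for i i'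
    proof -
      have "real_of_int \<bar>m i' i\<bar> \<le> 2" using m[of i' i] by linarith
      then show ?thesis by (simp add: C_def)
    qed
    moreover have "real (3 * card \<Theta>) \<le> C" using \<Theta>(2) by (simp add: C_def)
    ultimately show "\<exists>(\<alpha>::real) (\<beta>::real) (k::nat) (m::nat \<Rightarrow> nat \<Rightarrow> int) (\<xi>::nat \<Rightarrow> real)
             (qa::nat \<Rightarrow> nat \<Rightarrow> real) (qb::nat \<Rightarrow> nat \<Rightarrow> real) (qc::nat \<Rightarrow> nat \<Rightarrow> real).
            real k \<le> C \<and>
            (\<forall>(i, i')\<in>pairs k. real_of_int \<bar>m i' i\<bar> \<le> C) \<and>
            norm ((\<Sum>n\<in>{1..int N}. f n * cnj (chi \<alpha> \<beta> k m (poly_seq \<xi> qa qb qc) n)) / of_nat N)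
              \<ge> c5"
      using fin by blast
  qed
qed

end
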